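(* Let $D\subset\mathbb{Z}^d$ be finite, let $f=(f(x))_{x\in D}$ be a non-degenerate centred Gaussian vector with covariance matrix $K=(K_{x,y})_{x,y\in D}$, let $\Xi:\mathcal{P}(D)\to\mathbb{R}$ be any function on the subsets of $D$, and let $\ell\in\mathbb{R}$. Then for every $m\ge1$, $$\mathrm{Var}\Big[\sum_{m'\ge m}Q_{m'}[\Xi(f-\ell)]\Big]=\sum_{x,y\in D^m}\prod_{i=1}^mK_{x_i,y_i}\int_0^1\int_0^{t_0}\cdots\int_0^{t_{m-2}}P^{t_{m-1}}(x;y)\,dt_{m-1}\cdots dt_0,$$ where $P^t(x;y)$ is the $m+m$ joint pivotal intensity of $\Xi$ at $(x,y)$ with respect to level $\ell$.
   Context: $\Xi(f-\ell):=\Xi(\{x\in D:f(x)>\ell\})$. $Q_m$ denotes orthogonal projection in $L^2$ onto the $m$-th homogeneous chaos of the Gaussian Hilbert space spanned by $\{f(x)\}_{x\in D}$ (the orthogonal complement of the $L^2$-closure of polynomials of degree $\le m-1$ in the $L^2$-closure of polynomials of degree $\le m$). Hermite polynomials: for a non-degenerate centred Gaussian vector $X$ with density $\varphi_X$ and a multi-index $\alpha$, $H^\alpha_X(x)=(-1)^{|\alpha|}\partial^\alpha\varphi_X(x)/\varphi_X(x)$. Discrete derivatives: for $y\in D$, $E\subseteq D$, $d_y\Xi(E)=\Xi(E\cup\{y\})-\Xi(E\setminus\{y\})$. For $y\in D^m$ let $\underline y=(y_1',\dots,y_n')$ be the subvector of distinct elements and $d_{\underline y}=d_{y_1'}\cdots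 d_{y_n'}$; for $g:D\to\mathbb{R}$, $d_{\underline y}\Xi(g):=d_{\underline y}\Xi(\{g>0\})$. Let $\alpha^y\in\mathbb{N}_0^D$ be the multi-index counting occurrences of points in $y$, and $\tilde\alpha^y_i=\max\{\alpha^y_i-1,0\}$. Joint pivotal intensity: let $\tilde f$ be an independent copy of $f$ and $f^t=tf+\sqrt{1-t^2}\,\tilde f$. For $t\in[0,1)$ and $x,y\in D^m$, $$P^t(x;y)=\mathbb{E}\Big[d_{\underline x}\Xi(f-\ell)\,d_{\underline y}\Xi(f^t-\ell)\,H^{\tilde\alpha^x,\tilde\alpha^y}_{f,f^t}(f,f^t)\,\Big|\,f(\underline x)=\ell,\ f^t(\underline y)=\ell\Big]\,\varphi_{f(\underline x),f^t(\underline y)}(\ell,\ell),$$ where $\varphi_{f(\underline x),f^t(\underline y)}$ is the density of $(f(\underline x),f^t(\underline y))$, $f(\underline x)=\ell$ means that all coordinates equal $\ell$, and $H_{f,f^t}$ is the Hermite polynomial of the (unconditioned, non-degenerate) Gaussian vector $(f,f^t)$ on $D\times D$ coordinates (first block of derivatives for $f$, second for $f^t$). *)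

theory Defs
  imports "HOL-Probability.Probability"
begin

section \<open>Gaussian vectors indexed by a finite set\<close>

text \<open>
  A vector indexed by a finite set \<open>I\<close> is a function \<open>'i \<Rightarrow> real\<close> of which only the values
  on \<open>I\<close> matter, and similarly for \<open>I \<times> I\<close> matrices.
\<close>

definition set_det :: "'i set \<Rightarrow> ('i \<Rightarrow> 'i \<Rightarrow> real) \<Rightarrow> real" where
  "set_det I C = (\<Sum>p | p permutes I. of_int (sign p) * (\<Prod>i\<in>I. C i (p i)))"

text \<open>For an invertible matrix the entries on \<open>I \<times> I\<close> of the chosen inverse are unique.\<close>

definition set_inverse :: "'i set \<Rightarrow> ('i \<Rightarrow> 'i \<Rightarrow> real) \<Rightarrow> 'i \<Rightarrow> 'i \<Rightarrow> real" where
  "set_inverse I C = (SOME B. \<forall>i\<in>I. \<forall>j\<in>I. (\<Sum>k\<in>I. C i k * B k j) = (if i = j then 1 else 0))"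

definition gaussian_density :: "'i set \<Rightarrow> ('i \<Rightarrow> 'i \<Rightarrow> real) \<Rightarrow> ('i \<Rightarrow> real) \<Rightarrow> real" where
  "gaussian_density I C u =
     exp (- (\<Sum>i\<in>I. \<Sum>j\<in>I. u i * set_inverse I C i j * u j) / 2) /
     sqrt ((2 * pi) ^ card I * set_det I C)"

definition nondegenerate_gaussian ::
    "'a measure \<Rightarrow> 'i set \<Rightarrow> ('i \<Rightarrow> 'a \<Rightarrow> real) \<Rightarrow> ('i \<Rightarrow> 'i \<Rightarrow> real) \<Rightarrow> bool" where
  "nondegenerate_gaussian M I X C \<longleftrightarrow>
     (\<forall>i\<in>I. \<forall>j\<in>I. C i j = C j i) \<and>
     (\<forall>a. (\<exists>i\<in>I. a i \<noteq> 0) \<longrightarrow> (\<Sum>i\<in>I. \<Sum>j\<in>I. a i * C i j * a j) > 0) \<and>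
     distributed M (Pi\<^sub>M I (\<lambda>_. lborel)) (\<lambda>\<omega>. \<lambda>i\<in>I. X i \<omega>)
       (\<lambda>u. ennreal (gaussian_density I C u))"

definition covariance_matrix :: "'a measure \<Rightarrow> ('i \<Rightarrow> 'a \<Rightarrow> real) \<Rightarrow> 'i \<Rightarrow> 'i \<Rightarrow> real" where
  "covariance_matrix M X i j =
     integral\<^sup>L M (\<lambda>\<omega>. (X i \<omega> - integral\<^sup>L M (X i)) * (X j \<omega> - integral\<^sup>L M (X j)))"

text \<open>The density of the subvector \<open>(X i)\<close>, \<open>i \<in> J\<close>, of a centred Gaussian vector \<open>X\<close> on \<open>M\<close>.\<close>

definition vec_density ::
    "'a measure \<Rightarrow> 'i set \<Rightarrow> ('i \<Rightarrow> 'a \<Rightarrow> real) \<Rightarrow> ('i \<Rightarrow> real) \<Rightarrow> real" where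
  "vec_density M J X = gaussian_density J (covariance_matrix M X)"

text \<open>
  \<open>\<E>[g(X) | X\<^sub>J = c]\<close> for \<open>J \<subseteq> I\<close>: integration against the conditional density
  \<open>\<phi>\<^bsub>X\<^esub>(c, v) / \<phi>\<^bsub>X\<^sub>J\<^esub>(c)\<close> of the remaining coordinates \<open>v\<close>.
\<close>

definition cond_expectation_at ::
    "'a measure \<Rightarrow> 'i set \<Rightarrow> ('i \<Rightarrow> 'a \<Rightarrow> real) \<Rightarrow> 'i set \<Rightarrow> ('i \<Rightarrow> real) \<Rightarrow>
     (('i \<Rightarrow> real) \<Rightarrow> real) \<Rightarrow> real" where
  "cond_expectation_at M I X J c g =
     (LINT v|Pi\<^sub>M (I - J) (\<lambda>_. lborel).
        g (merge J (I - J) (c, v)) *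
        (vec_density M I X (merge J (I - J) (c, v)) / vec_density M J X c))"


section \<open>Hermite polynomials\<close>

definition coord_deriv :: "'i \<Rightarrow> (('i \<Rightarrow> real) \<Rightarrow> real) \<Rightarrow> ('i \<Rightarrow> real) \<Rightarrow> real" where
  "coord_deriv i g u = deriv (\<lambda>s. g (u(i := s))) (u i)"

text \<open>
  \<open>\<partial>\<^sup>\<alpha> g\<close>, with the partial derivatives taken in an arbitrary order; it is only applied to
  smooth \<open>g\<close>, for which the order is irrelevant.
\<close>

definition mixed_deriv ::
    "'i set \<Rightarrow> ('i \<Rightarrow> nat) \<Rightarrow> (('i \<Rightarrow> real) \<Rightarrow> real) \<Rightarrow> ('i \<Rightarrow> real) \<Rightarrow> real" where
  "mixed_deriv I \<alpha> g =
     foldr coord_deriv (SOME xs. set xs \<subseteq> I \<and> (\<forall>i\<in>I. count_list xs i = \<alpha> i)) g"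

definition hermite ::
    "'a measure \<Rightarrow> 'i set \<Rightarrow> ('i \<Rightarrow> 'a \<Rightarrow> real) \<Rightarrow> ('i \<Rightarrow> nat) \<Rightarrow> ('i \<Rightarrow> real) \<Rightarrow> real" where
  "hermite M I X \<alpha> u =
     (-1) ^ (\<Sum>i\<in>I. \<alpha> i) * mixed_deriv I \<alpha> (vec_density M I X) u / vec_density M I X u"


section \<open>Discrete derivatives and the joint pivotal intensity\<close>

definition excursion_set :: "'i set \<Rightarrow> real \<Rightarrow> ('i \<Rightarrow> real) \<Rightarrow> 'i set" where
  "excursion_set D l g = {x\<in>D. g x > l}"

definition discrete_deriv :: "'i \<Rightarrow> ('i set \<Rightarrow> real) \<Rightarrow> 'i set \<Rightarrow> real" where
  "discrete_deriv y \<Xi> E = \<Xi> (insert y E) - \<Xi> (E - {y})"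

text \<open>
  \<open>d\<^bsub>\<underline>y\<^esub>\<close>; the operators \<open>discrete_deriv\<close> commute, so the order in which \<open>remdups\<close> lists the
  distinct elements is immaterial.
\<close>

definition discrete_derivs :: "'i list \<Rightarrow> ('i set \<Rightarrow> real) \<Rightarrow> 'i set \<Rightarrow> real" where
  "discrete_derivs y \<Xi> = foldr discrete_deriv (remdups y) \<Xi>"

text \<open>Truncated subtraction on \<open>nat\<close> gives \<open>max {\<alpha>\<^sup>y\<^sub>i - 1, 0}\<close>.\<close>

definition reduced_count :: "'i list \<Rightarrow> 'i \<Rightarrow> nat" where
  "reduced_count y i = count_list y i - 1"

text \<open>
  The vector \<open>(f, f\<^sup>t)\<close>, indexed by \<open>D <+> D\<close>, on the product space \<open>M \<Otimes>\<^sub>M M\<close>: \<open>f\<close> is read off the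
  first component and its independent copy off the second one.
\<close>

definition interpolated_pair ::
    "('i \<Rightarrow> 'a \<Rightarrow> real) \<Rightarrow> real \<Rightarrow> 'i + 'i \<Rightarrow> 'a \<times> 'a \<Rightarrow> real" where
  "interpolated_pair f t i \<omega> =
     (case i of
        Inl x \<Rightarrow> f x (fst \<omega>)
      | Inr y \<Rightarrow> t * f y (fst \<omega>) + sqrt (1 - t\<^sup>2) * f y (snd \<omega>))"

definition pivotal_intensity ::
    "'a measure \<Rightarrow> 'i set \<Rightarrow> ('i \<Rightarrow> 'a \<Rightarrow> real) \<Rightarrow> ('i set \<Rightarrow> real) \<Rightarrow> real \<Rightarrow>
     real \<Rightarrow> 'i list \<Rightarrow> 'i list \<Rightarrow> real" where
  "pivotal_intensity M D f \<Xi> l t x y =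
     (let N = M \<Otimes>\<^sub>M M;
          X = interpolated_pair f t;
          J = set x <+> set y
      in cond_expectation_at N (D <+> D) X J (\<lambda>_. l)
           (\<lambda>u. discrete_derivs x \<Xi> (excursion_set D l (\<lambda>z. u (Inl z))) *
                discrete_derivs y \<Xi> (excursion_set D l (\<lambda>z. u (Inr z))) *
                hermite N (D <+> D) X (case_sum (reduced_count x) (reduced_count y)) u) *
         vec_density N J X (\<lambda>_. l))"

text \<open>
  \<open>iterated_integral m g s\<close> is
  \<open>\<integral>\<^sub>0\<^sup>s \<integral>\<^sub>0\<^bsup>t\<^sub>0\<^esup> \<dots> \<integral>\<^sub>0\<^bsup>t\<^bsub>m-2\<^esub>\<^esup> g(t\<^bsub>m-1\<^esub>) dt\<^bsub>m-1\<^esub> \<dots> dt\<^sub>0\<close> (\<open>m\<close> integrals).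
\<close>

fun iterated_integral :: "nat \<Rightarrow> (real \<Rightarrow> real) \<Rightarrow> real \<Rightarrow> real" where
  "iterated_integral 0 g s = g s"
| "iterated_integral (Suc m) g s = (LINT t:{0..s}|lborel. iterated_integral m g t)"


section \<open>Homogeneous chaoses\<close>

text \<open>Elements of \<open>L\<^sup>2\<close> are represented by functions rather than by classes modulo null sets.\<close>

definition L2 :: "'a measure \<Rightarrow> ('a \<Rightarrow> real) set" where
  "L2 M = {X \<in> borel_measurable M. integrable M (\<lambda>\<omega>. (X \<omega>)\<^sup>2)}"

definition L2_closure :: "'a measure \<Rightarrow> ('a \<Rightarrow> real) set \<Rightarrow> ('a \<Rightarrow> real) set" where
  "L2_closure M S =
     {X \<in> L2 M. \<forall>e>0. \<exists>Y \<in> S \<inter> L2 M. (LINT \<omega>|M. (X \<omega> - Y \<omega>)\<^sup>2) < e}"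

text \<open>
  Polynomials of degree at most \<open>n\<close> in the variables \<open>f x\<close>, \<open>x \<in> D\<close>, as sums over a finite set
  \<open>A\<close> of multi-indices.
\<close>

definition polynomial_rvs :: "'i set \<Rightarrow> ('i \<Rightarrow> 'a \<Rightarrow> real) \<Rightarrow> nat \<Rightarrow> ('a \<Rightarrow> real) set" where
  "polynomial_rvs D f n =
     {\<lambda>\<omega>. \<Sum>\<alpha>\<in>A. c \<alpha> * (\<Prod>x\<in>D. f x \<omega> ^ \<alpha> x) | (A :: ('i \<Rightarrow> nat) set) c.
        finite A \<and> (\<forall>\<alpha>\<in>A. (\<Sum>x\<in>D. \<alpha> x) \<le> n)}"

fun chaos :: "'a measure \<Rightarrow> 'i set \<Rightarrow> ('i \<Rightarrow> 'a \<Rightarrow> real) \<Rightarrow> nat \<Rightarrow> ('a \<Rightarrow> real) set" where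
  "chaos M D f 0 = L2_closure M (polynomial_rvs D f 0)"
| "chaos M D f (Suc n) =
     {X \<in> L2_closure M (polynomial_rvs D f (Suc n)).
        \<forall>Y \<in> L2_closure M (polynomial_rvs D f n). (LINT \<omega>|M. X \<omega> * Y \<omega>) = 0}"

text \<open>The orthogonal projection \<open>Q\<^sub>n[X]\<close>, unique up to null sets.\<close>

definition chaos_proj ::
    "'a measure \<Rightarrow> 'i set \<Rightarrow> ('i \<Rightarrow> 'a \<Rightarrow> real) \<Rightarrow> nat \<Rightarrow> ('a \<Rightarrow> real) \<Rightarrow> 'a \<Rightarrow> real" where
  "chaos_proj M D f n X =
     (SOME Y. Y \<in> chaos M D f n \<and>
        (\<forall>Z \<in> chaos M D f n. (LINT \<omega>|M. (X \<omega> - Y \<omega>) * Z \<omega>) = 0))"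

text \<open>The sum of \<open>Q\<^sub>k[X]\<close> over \<open>k \<ge> m\<close>, as a limit in \<open>L\<^sup>2\<close>; unique up to null sets.\<close>

definition chaos_tail ::
    "'a measure \<Rightarrow> 'i set \<Rightarrow> ('i \<Rightarrow> 'a \<Rightarrow> real) \<Rightarrow> nat \<Rightarrow> ('a \<Rightarrow> real) \<Rightarrow> 'a \<Rightarrow> real" where
  "chaos_tail M D f m X =
     (SOME S. S \<in> L2 M \<and>
        (\<lambda>n. LINT \<omega>|M. ((\<Sum>k\<in>{m..<n}. chaos_proj M D f k X \<omega>) - S \<omega>)\<^sup>2) \<longlonglongrightarrow> 0)"

end

theory Submission
  imports Defs "Jordan_Normal_Form.Determinant"
begin

text \<open>
  Let \<open>F u = \<Xi> {x. u x > l}\<close> and let \<open>\<phi>\<^sub>t\<close> be the density of \<open>(f, f\<^sup>t)\<close>. By the heat equation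
  \<open>\<partial>\<^sub>t \<phi>\<^sub>t = (\<Sum>a b. K a b * \<partial>\<^sub>a \<partial>'\<^sub>b \<phi>\<^sub>t)\<close>, the \<open>m\<close>-th derivative of
  \<open>\<Phi> t = \<E>[F(f) F(f\<^sup>t)]\<close> is a sum over \<open>x\<close> and \<open>y\<close> of products of covariances with
  \<open>F \<otimes> F\<close> integrated against \<open>m + m\<close> derivatives of \<open>\<phi>\<^sub>t\<close>. Integrating by parts once in each
  distinct coordinate turns \<open>F \<otimes> F\<close> into its discrete derivatives at level \<open>l\<close>, and the
  remaining derivatives into a Hermite polynomial: this is the joint pivotal intensity.
  By the Ornstein--Uhlenbeck semigroup property these derivatives of \<open>\<Phi>\<close> are nonnegative, so \<open>\<Phi>\<close>
  is absolutely monotone and its Taylor series converges up to \<open>\<Phi> 1 = \<E>[F(f)\<^sup>2]\<close>. Its \<open>k\<close>-th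
  coefficient is the second moment of the \<open>k\<close>-th chaos projection, by the Hermite expansion.
  Hence the variance of the chaos tail is the Taylor remainder of \<open>\<Phi>\<close> at 1, in integral form.
\<close>


section \<open>Covariance matrices\<close>

text \<open>Two obstacles shape the argument. F is a step function, so every derivative has to fall
  on the Gaussian density; and that density degenerates at t = 1, so all bounds are for t < 1. The
  integrals of the statement nevertheless reach 1, a single intensity may change sign, and the
  integral of a function that is not integrable is 0 by convention. Exchanging the sum over x and y
  with the outermost integral therefore requires a domination. Positivity supplies it. Two vectors
  that are conditionally independent given w, each with correlation s to w, have correlation s^2.
  Hence at t = s^2 the intensities form a Gram matrix in L2, with vectors \<open>\<tau> s x\<close>.
  Its contraction with the m-th tensor power of K is nonnegative, and coercivity of K makes it at
  least \<open>b0 ^ m\<close> times the modulus of each entry. So each intensity is dominated by a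
  multiple of the m-th derivative of \<Phi>, whose m-fold integral up to 1 is finite by absolute
  monotonicity. On the Hermite side, the same tensor power of K cancels the entries of the inverse
  of K in the Gram matrix of Hermite polynomials and leaves only the factor k! of the Taylor
  coefficient.\<close>

text \<open>Conjugation by the enumeration \<open>e\<close> is a sign-preserving bijection between
  the permutations of \<open>{0..<n}\<close> and those of \<open>I\<close>. This makes matrix theory
  available for \<open>set_det\<close>.\<close>

lemma set_det_eq_det:
  assumes e: "bij_betw e {0..<n} I"
  shows "set_det I C = Determinant.det (mat n n (\<lambda>(i, j). C (e i) (e j)))"
proof -
  let ?g = "inv_into {0..<n} e"
  let ?t = "\<lambda>p x. if x \<in> I then e (p (?g x)) else x"
  have bij: "bij_betw ?t {p. p permutes {0..<n}} {p. p permutes I}"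
    by (rule bij_betw_permutations[OF e])
  have eq: "of_int (sign (?t p)) * (\<Prod>i\<in>I. C i (?t p i)) =
      of_int (sign p) * (\<Prod>i = 0..<n. C (e i) (e (p i)))" if p: "p permutes {0..<n}" for p
  proof -
    interpret P: permutes_bij_finite p "{0..<n}" I e ?g "?t p"
      using p e by unfold_locales (auto simp: bij_betw_inv_into_left)
    have "(\<Prod>i\<in>I. C i (?t p i)) = (\<Prod>i\<in>I. C i (e (p (?g i))))"
      by (intro prod.cong) auto
    also have "\<dots> = (\<Prod>i = 0..<n. C (e i) (e (p (?g (e i)))))"
      using prod.reindex_bij_betw[OF e, of "\<lambda>i. C i (e (p (?g i)))"] by simp
    also have "\<dots> = (\<Prod>i = 0..<n. C (e i) (e (p i)))"
      by (intro prod.cong) (auto simp: P.f'_f)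
    finally show ?thesis
      using P.sign_p' by simp
  qed
  have "set_det I C = (\<Sum>p | p permutes {0..<n}. of_int (sign (?t p)) * (\<Prod>i\<in>I. C i (?t p i)))"
    unfolding set_det_def by (rule sum.reindex_bij_betw[OF bij, symmetric])
  also have "\<dots> = (\<Sum>p | p permutes {0..<n}. of_int (sign p) * (\<Prod>i = 0..<n. C (e i) (e (p i))))"
    by (intro sum.cong refl eq) simp
  also have "\<dots> = Determinant.det (mat n n (\<lambda>(i, j). C (e i) (e j)))"
    by (subst Determinant.det_def'[of _ n], simp)
      (intro sum.cong refl arg_cong2[where f = times] prod.cong, auto dest: permutes_in_image)
  finally show ?thesis .
qed

section \<open>Positive definite matrices and their inverses\<close>

text \<open>The algebraic half of \<open>nondegenerate_gaussian\<close>, split off because it is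
  also applied to the covariance of the pair and to its restrictions to subsets.\<close>

definition pos_def :: "'i set \<Rightarrow> ('i \<Rightarrow> 'i \<Rightarrow> real) \<Rightarrow> bool" where
  "pos_def I C \<longleftrightarrow> (\<forall>i\<in>I. \<forall>j\<in>I. C i j = C j i) \<and>
     (\<forall>a. (\<exists>i\<in>I. a i \<noteq> 0) \<longrightarrow> (\<Sum>i\<in>I. \<Sum>j\<in>I. a i * C i j * a j) > 0)"

lemma pos_def_ker:
  assumes "finite I" "pos_def I C" "\<And>i. i \<in> I \<Longrightarrow> (\<Sum>j\<in>I. C i j * v j) = 0" "k \<in> I"
  shows "v k = 0"
proof (rule ccontr)
  assume "v k \<noteq> 0"
  then have "(\<Sum>i\<in>I. \<Sum>j\<in>I. v i * C i j * v j) > 0"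
    using assms unfolding pos_def_def by blast
  also have "(\<Sum>i\<in>I. \<Sum>j\<in>I. v i * C i j * v j) = (\<Sum>i\<in>I. v i * (\<Sum>j\<in>I. C i j * v j))"
    by (simp add: sum_distrib_left mult.assoc)
  also have "\<dots> = 0"
    using assms by simp
  finally show False by simp
qed

text \<open>A singular matrix has a nonzero kernel vector, on which the quadratic form would
  vanish.\<close>

lemma pos_def_det:
  assumes I: "finite I" and C: "pos_def I C"
  shows "set_det I C \<noteq> 0"
proof
  assume 0: "set_det I C = 0"
  obtain e where e: "bij_betw e {0..<card I} I"
    using ex_bij_betw_nat_finite[OF I] by blast
  let ?n = "card I"
  let ?A = "mat ?n ?n (\<lambda>(i, j). C (e i) (e j))"
  from 0 have "Determinant.det ?A = 0"
    by (simp add: set_det_eq_det[OF e])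
  then obtain v where v: "v \<in> carrier_vec ?n" "v \<noteq> 0\<^sub>v ?n" "?A *\<^sub>v v = 0\<^sub>v ?n"
    using det_0_iff_vec_prod_zero_field[of ?A ?n] by auto
  let ?g = "inv_into {0..<?n} e"
  have "vec_index v (?g k) = 0" if k: "k \<in> I" for k
  proof (rule pos_def_ker[OF I C _ k, where v = "\<lambda>k. vec_index v (?g k)"])
    fix i assume i: "i \<in> I"
    then have "i \<in> e ` {0..<?n}"
      using e by (simp add: bij_betw_def)
    then obtain a where a: "a < ?n" "i = e a"
      by auto
    have "(\<Sum>j\<in>I. C i j * vec_index v (?g j)) = (\<Sum>j = 0..<?n. C i (e j) * vec_index v (?g (e j)))"
      by (rule sum.reindex_bij_betw[OF e, symmetric])
    also have "\<dots> = (\<Sum>j = 0..<?n. C (e a) (e j) * vec_index v j)"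
      using e a by (intro sum.cong) (auto simp: bij_betw_inv_into_left)
    also have "\<dots> = vec_index (?A *\<^sub>v v) a"
      using a v(1) by (simp add: scalar_prod_def)
    also have "\<dots> = 0"
      using v a by simp
    finally show "(\<Sum>j\<in>I. C i j * vec_index v (?g j)) = 0" .
  qed
  moreover have "?g (e a) = a" "e a \<in> I" if "a < ?n" for a
    using e that by (auto simp: bij_betw_inv_into_left bij_betw_def)
  ultimately have "v = 0\<^sub>v ?n"
    using v(1) by (intro eq_vecI) (auto, metis)
  with v show False by simp
qed

lemma pos_def_inverse:
  assumes I: "finite I" and C: "pos_def I C"
  obtains B where "\<And>i j. i \<in> I \<Longrightarrow> j \<in> I \<Longrightarrow> (\<Sum>k\<in>I. C i k * B k j) = (if i = j then 1 else 0)"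
proof -
  obtain e where e: "bij_betw e {0..<card I} I"
    using ex_bij_betw_nat_finite[OF I] by blast
  let ?n = "card I"
  let ?A = "mat ?n ?n (\<lambda>(i, j). C (e i) (e j))"
  let ?g = "inv_into {0..<?n} e"
  have "Determinant.det ?A \<noteq> 0"
    using pos_def_det[OF I C] by (simp add: set_det_eq_det[OF e])
  then have "?A \<in> Units (ring_mat TYPE(real) ?n ())"
    by (intro det_non_zero_imp_unit) auto
  then obtain A' where A': "A' \<in> carrier_mat ?n ?n" "?A * A' = 1\<^sub>m ?n"
    by (auto simp: Units_def ring_mat_def)
  show ?thesis
  proof (rule that[of "\<lambda>k j. A' $$ (?g k, ?g j)"])
    fix i j assume ij: "i \<in> I" "j \<in> I"
    then have "i \<in> e ` {0..<?n}" "j \<in> e ` {0..<?n}"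
      using e by (simp_all add: bij_betw_def)
    then obtain a b where ab: "a < ?n" "i = e a" "b < ?n" "j = e b"
      by auto
    have g: "?g (e a) = a" if "a < ?n" for a
      using e that by (auto simp: bij_betw_inv_into_left)
    have "(\<Sum>k\<in>I. C i k * A' $$ (?g k, ?g j)) = (\<Sum>k = 0..<?n. C i (e k) * A' $$ (?g (e k), ?g j))"
      by (rule sum.reindex_bij_betw[OF e, symmetric])
    also have "\<dots> = (\<Sum>k = 0..<?n. C (e a) (e k) * A' $$ (k, b))"
      using ab g by (intro sum.cong) auto
    also have "\<dots> = (?A * A') $$ (a, b)"
      using ab A'(1) by (simp add: scalar_prod_def)
    also have "\<dots> = (if i = j then 1 else 0)"
      using ab A'(2) e by (auto simp: bij_betw_def inj_on_def)
    finally show "(\<Sum>k\<in>I. C i k * A' $$ (?g k, ?g j)) = (if i = j then 1 else 0)" .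
  qed
qed

text \<open>Any right inverse computes the one chosen by \<open>SOME\<close>: the difference of two
  right inverses lies column by column in the kernel of C, which is trivial.\<close>

lemma set_inverse_eqI:
  assumes I: "finite I" and C: "pos_def I C"
    and B: "\<And>i j. i \<in> I \<Longrightarrow> j \<in> I \<Longrightarrow> (\<Sum>k\<in>I. C i k * B k j) = (if i = j then 1 else 0)"
    and ij: "i \<in> I" "j \<in> I"
  shows "set_inverse I C i j = B i j"
proof -
  have "\<exists>B. \<forall>i\<in>I. \<forall>j\<in>I. (\<Sum>k\<in>I. C i k * B k j) = (if i = j then 1 else 0)"
    using B by blast
  then have S: "\<forall>i\<in>I. \<forall>j\<in>I. (\<Sum>k\<in>I. C i k * set_inverse I C k j) = (if i = j then 1 else 0)"
    unfolding set_inverse_def by (rule someI_ex)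
  have "set_inverse I C i j - B i j = 0"
    by (rule pos_def_ker[OF I C _ ij(1), where v = "\<lambda>k. set_inverse I C k j - B k j"])
       (use S B ij in \<open>auto simp: right_diff_distrib sum_subtractf\<close>)
  then show ?thesis by simp
qed

section \<open>Covariance of the pair and its determinant\<close>

definition pair_cov :: "('i \<Rightarrow> 'i \<Rightarrow> real) \<Rightarrow> real \<Rightarrow> 'i + 'i \<Rightarrow> 'i + 'i \<Rightarrow> real" where
  "pair_cov K t i j = (case i of
      Inl x \<Rightarrow> (case j of Inl y \<Rightarrow> K x y | Inr y \<Rightarrow> t * K x y)
    | Inr x \<Rightarrow> (case j of Inl y \<Rightarrow> t * K x y | Inr y \<Rightarrow> K x y))"

text \<open>The matrix has blocks K, tK, tK, K. They commute, so the determinant is that of K K -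
  (tK)(tK) = (1 - t^2) K K.\<close>

lemma det_pair_cov:
  assumes D: "finite D"
  shows "set_det (D <+> D) (pair_cov K t) = (1 - t\<^sup>2) ^ card D * (set_det D K)\<^sup>2"
proof -
  obtain e where e: "bij_betw e {0..<card D} D"
    using ex_bij_betw_nat_finite[OF D] by blast
  let ?n = "card D"
  \<comment> \<open>All \<open>Inl\<close> coordinates come before all \<open>Inr\<close> ones,
    which makes the block structure visible.\<close>
  define e2 where "e2 i = (if i < ?n then Inl (e i) else Inr (e (i - ?n)))" for i
  have e2: "bij_betw e2 {0..<?n + ?n} (D <+> D)"
  proof (rule bij_betw_imageI)
    have inj: "a = b" if "a < ?n" "b < ?n" "e a = e b" for a b
      using e that by (simp add: bij_betw_def inj_on_def)
    show "inj_on e2 {0..<?n + ?n}"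
    proof (rule inj_onI)
      fix a b assume *: "a \<in> {0..<?n + ?n}" "b \<in> {0..<?n + ?n}" "e2 a = e2 b"
      show "a = b"
      proof (cases "a < ?n \<longleftrightarrow> b < ?n")
        case False
        then show ?thesis using *(3) by (auto simp: e2_def)
      next
        case True
        have "a - ?n = b - ?n" if "\<not> a < ?n"
          using * that True by (intro inj) (auto simp: e2_def)
        then show ?thesis using * True inj[of a b] by (cases "a < ?n") (auto simp: e2_def)
      qed
    qed
    have im: "e ` {0..<?n} = D" using e by (auto simp: bij_betw_def)
    show "e2 ` {0..<?n + ?n} = D <+> D"
    proof (intro equalityI subsetI)
      fix z assume "z \<in> e2 ` {0..<?n + ?n}"
      then obtain a where a: "a < ?n + ?n" "z = e2 a" by auto
      have "e a \<in> D" if "a < ?n" using im that by auto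
      moreover have "e (a - ?n) \<in> D" if "\<not> a < ?n" using im that a by auto
      ultimately show "z \<in> D <+> D" using a by (auto simp: e2_def)
    next
      fix z assume "z \<in> D <+> D"
      then consider x where "x \<in> D" "z = Inl x" | x where "x \<in> D" "z = Inr x" by auto
      then show "z \<in> e2 ` {0..<?n + ?n}"
      proof cases
        case 1
        from 1(1) have "x \<in> e ` {0..<?n}" by (simp add: im)
        then obtain a where "a < ?n" "x = e a" by auto
        then show ?thesis using 1 by (intro image_eqI[of _ _ a]) (auto simp: e2_def)
      next
        case 2
        from 2(1) have "x \<in> e ` {0..<?n}" by (simp add: im)
        then obtain a where "a < ?n" "x = e a" by auto
        then show ?thesis using 2 by (intro image_eqI[of _ _ "a + ?n"]) (auto simp: e2_def)
      qed
    qed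
  qed
  let ?K = "mat ?n ?n (\<lambda>(i, j). K (e i) (e j))"
  let ?C = "mat (?n + ?n) (?n + ?n) (\<lambda>(i, j). pair_cov K t (e2 i) (e2 j))"
  have C: "?C = four_block_mat ?K (t \<cdot>\<^sub>m ?K) (t \<cdot>\<^sub>m ?K) ?K"
    by (rule eq_matI) (auto simp: e2_def pair_cov_def)
  have K: "?K \<in> carrier_mat ?n ?n" by simp
  have tK: "(t \<cdot>\<^sub>m ?K) * X = t \<cdot>\<^sub>m (?K * X)" "?K * (t \<cdot>\<^sub>m ?K) = t \<cdot>\<^sub>m (?K * ?K)"
    if "X \<in> carrier_mat ?n ?n" for X
    using mult_smult_assoc_mat[OF K that] mult_smult_distrib[OF K K] by auto
  have "Determinant.det ?C = Determinant.det (?K * ?K - (t \<cdot>\<^sub>m ?K) * (t \<cdot>\<^sub>m ?K))"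
    unfolding C by (rule det_four_block_mat[of _ ?n]) (simp_all only: K smult_carrier_mat tK(1)[OF K] tK(2)[OF K])
  also have "(t \<cdot>\<^sub>m ?K) * (t \<cdot>\<^sub>m ?K) = t \<cdot>\<^sub>m (t \<cdot>\<^sub>m (?K * ?K))"
    by (simp only: tK(1)[OF smult_carrier_mat[OF K]] tK(2)[OF K])
  also have "?K * ?K - t \<cdot>\<^sub>m (t \<cdot>\<^sub>m (?K * ?K)) = (1 - t\<^sup>2) \<cdot>\<^sub>m (?K * ?K)"
    by (rule eq_matI) (simp_all add: power2_eq_square algebra_simps del: index_mult_mat(1))
  also have "Determinant.det \<dots> = (1 - t\<^sup>2) ^ ?n * (Determinant.det ?K)\<^sup>2"
    by (simp add: det_mult[OF K K] power2_eq_square)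
  finally show ?thesis
    unfolding set_det_eq_det[OF e2] set_det_eq_det[OF e] .
qed


section \<open>Lebesgue integrals over coordinate spaces\<close>

abbreviation leb :: "'i set \<Rightarrow> ('i \<Rightarrow> real) measure" where
  "leb I \<equiv> Pi\<^sub>M I (\<lambda>_. lborel)"

interpretation lborel_prod: product_sigma_finite "\<lambda>_::'i. lborel :: real measure"
  by unfold_locales

lemma sigma_finite_leb: "finite I \<Longrightarrow> sigma_finite_measure (leb I)"
  by (rule lborel_prod.sigma_finite)

lemma pair_sigma_finite_leb: "finite I \<Longrightarrow> finite J \<Longrightarrow> pair_sigma_finite (leb I) (leb J)"
  by (simp add: pair_sigma_finite_def sigma_finite_leb)

section \<open>Integrability under Gaussian bounds\<close>

lemma integrable_exp_neg_sq:
  assumes "0 < (c::real)"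
  shows "integrable lborel (\<lambda>x::real. exp (- c * x\<^sup>2))"
proof -
  define s where "s = 1 / sqrt (2 * c)"
  have s: "s > 0" "2 * s\<^sup>2 = 1 / c"
    using assms by (simp_all add: s_def field_simps)
  have "integrable lborel (\<lambda>x. sqrt (2 * pi * s\<^sup>2) * normal_density 0 s x)"
    using s by (intro integrable_mult_right integrable_normal_density) simp
  also have "(\<lambda>x. sqrt (2 * pi * s\<^sup>2) * normal_density 0 s x) = (\<lambda>x. exp (- c * x\<^sup>2))"
    using s assms by (auto simp: normal_density_def fun_eq_iff)
  finally show ?thesis .
qed

lemma integrable_leb_gauss:
  assumes "finite I" "0 < c"
  shows "integrable (leb I) (\<lambda>u. exp (- c * (\<Sum>i\<in>I. (u i)\<^sup>2)))"
proof -
  have "integrable (leb I) (\<lambda>u. \<Prod>i\<in>I. exp (- c * (u i)\<^sup>2))"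
    by (rule lborel_prod.product_integrable_prod) (use assms integrable_exp_neg_sq in auto)
  also have "(\<lambda>u. \<Prod>i\<in>I. exp (- c * (u i)\<^sup>2)) = (\<lambda>u. exp (- c * (\<Sum>i\<in>I. (u i)\<^sup>2)))"
    using assms(1) by (simp add: exp_sum[symmetric] sum_distrib_left)
  finally show ?thesis .
qed

lemma integrable_leb_bound:
  assumes "finite I" "0 < c" "h \<in> borel_measurable (leb I)"
    and "\<And>u. u \<in> space (leb I) \<Longrightarrow> \<bar>h u\<bar> \<le> C * exp (- c * (\<Sum>i\<in>I. (u i)\<^sup>2))"
  shows "integrable (leb I) h"
proof (rule Bochner_Integration.integrable_bound)
  show "integrable (leb I) (\<lambda>u. C * exp (- c * (\<Sum>i\<in>I. (u i)\<^sup>2)))"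
    by (intro integrable_mult_right integrable_leb_gauss assms)
  show "AE u in leb I. norm (h u) \<le> norm (C * exp (- c * (\<Sum>i\<in>I. (u i)\<^sup>2)))"
  proof (rule AE_I2)
    fix u assume "u \<in> space (leb I)"
    from assms(4)[OF this] show "norm (h u) \<le> norm (C * exp (- c * (\<Sum>i\<in>I. (u i)\<^sup>2)))"
      by simp
  qed
qed fact

lemma measurable_coord: "i \<in> I \<Longrightarrow> (\<lambda>u. u i) \<in> borel_measurable (leb I)"
  using measurable_component_singleton[of i I "\<lambda>_. lborel"] by simp

section \<open>Affine substitution and disjoint sums of index sets\<close>

text \<open>A product measure is determined by its values on boxes, where the claim is one
  substitution on the real line per coordinate.\<close>

lemma leb_affine:
  assumes I: "finite I" and r: "0 < r"
  shows "leb I = density (distr (leb I) (leb I) (\<lambda>u. \<lambda>i\<in>I. b i + r * u i)) (\<lambda>_. ennreal (r ^ card I))"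
    (is "_ = density ?D _")
proof (rule lborel_prod.PiM_eqI[OF I, symmetric])
  have T: "(\<lambda>u. \<lambda>i\<in>I. b i + r * u i) \<in> measurable (leb I) (leb I)"
    by (intro measurable_restrict) (simp add: measurable_coord)
  interpret F: finite_product_sigma_finite "\<lambda>_::'a. lborel :: real measure" I
    by standard fact
  fix A :: "'a \<Rightarrow> real set" assume A: "\<And>i. i \<in> I \<Longrightarrow> A i \<in> sets lborel"
  have AI: "Pi\<^sub>E I A \<in> sets (leb I)"
    using A I by (intro sets_PiM_I_finite) auto
  have pre: "(\<lambda>u. \<lambda>i\<in>I. b i + r * u i) -` Pi\<^sub>E I A \<inter> space (leb I)
      = Pi\<^sub>E I (\<lambda>i. (\<lambda>x. b i + r * x) -` A i)"
    by (auto simp: space_PiM PiE_iff)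
  have meas: "(\<lambda>x. b i + r * x) -` A i \<in> sets borel" if "i \<in> I" for i
    using A[OF that] measurable_sets[of "\<lambda>x. b i + r * x" borel borel "A i"] by simp
  have one: "emeasure lborel (A i) = ennreal r * emeasure lborel ((\<lambda>x. b i + r * x) -` A i)"
    if "i \<in> I" for i
  proof -
    have "emeasure lborel (A i) = (\<integral>\<^sup>+x. indicator (A i) x \<partial>lborel)"
      using A[OF that] by simp
    also have "\<dots> = ennreal r * (\<integral>\<^sup>+x. indicator (A i) (b i + r * x) \<partial>lborel)"
      using A[OF that] r by (subst nn_integral_real_affine[of _ r "b i"]) auto
    also have "(\<integral>\<^sup>+x. indicator (A i) (b i + r * x) \<partial>lborel)
        = (\<integral>\<^sup>+x. indicator ((\<lambda>x. b i + r * x) -` A i) x \<partial>lborel)"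
      by (intro nn_integral_cong) (auto simp: indicator_def)
    also have "\<dots> = emeasure lborel ((\<lambda>x. b i + r * x) -` A i)"
      using meas[OF that] by simp
    finally show ?thesis .
  qed
  have "emeasure (density ?D (\<lambda>_. ennreal (r ^ card I))) (Pi\<^sub>E I A)
      = ennreal (r ^ card I) * emeasure ?D (Pi\<^sub>E I A)"
    using AI by (subst emeasure_density_const) auto
  also have "emeasure ?D (Pi\<^sub>E I A) = (\<Prod>i\<in>I. emeasure lborel ((\<lambda>x. b i + r * x) -` A i))"
    using AI T by (subst emeasure_distr) (auto simp: pre intro!: F.measure_times meas)
  also have "ennreal (r ^ card I) * \<dots> = (\<Prod>i\<in>I. emeasure lborel (A i))"
    using r by (simp add: one prod.distrib ennreal_power)
  finally show "emeasure (density ?D (\<lambda>_. ennreal (r ^ card I))) (Pi\<^sub>E I A)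
      = (\<Prod>i\<in>I. emeasure lborel (A i))" .
qed simp

lemma integral_leb_affine:
  fixes h :: "('i \<Rightarrow> real) \<Rightarrow> real"
  assumes I: "finite I" and r: "0 < r" and h[measurable]: "h \<in> borel_measurable (leb I)"
  shows "integral\<^sup>L (leb I) h = r ^ card I * (LINT u|leb I. h (\<lambda>i\<in>I. b i + r * u i))"
proof -
  have [measurable]: "(\<lambda>u. \<lambda>i\<in>I. b i + r * u i) \<in> measurable (leb I) (leb I)"
    by (intro measurable_restrict) (simp add: measurable_coord)
  have "integral\<^sup>L (leb I) h = integral\<^sup>L (density (distr (leb I) (leb I)
      (\<lambda>u. \<lambda>i\<in>I. b i + r * u i)) (\<lambda>_. ennreal (r ^ card I))) h"
    using leb_affine[OF I r, of b] by simp
  also have "\<dots> = (LINT u|distr (leb I) (leb I) (\<lambda>u. \<lambda>i\<in>I. b i + r * u i). r ^ card I * h u)"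
    using r by (subst integral_density) auto
  also have "\<dots> = (LINT u|leb I. r ^ card I * h (\<lambda>i\<in>I. b i + r * u i))"
    by (subst integral_distr) auto
  finally show ?thesis by simp
qed

lemma measurable_case_sum_leb:
  "(\<lambda>(u, v). case_sum u v) \<in> measurable (leb I \<Otimes>\<^sub>M leb J) (leb (I <+> J))"
proof -
  have "(\<lambda>p. \<lambda>k\<in>I <+> J. case_sum (fst p) (snd p) k) \<in> measurable (leb I \<Otimes>\<^sub>M leb J) (leb (I <+> J))"
  proof (rule measurable_restrict)
    fix k assume "k \<in> I <+> J"
    then show "(\<lambda>p. case_sum (fst p) (snd p) k) \<in> measurable (leb I \<Otimes>\<^sub>M leb J) lborel"
      by (auto intro: measurable_compose[OF measurable_fst] measurable_compose[OF measurable_snd]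
          measurable_coord)
  qed
  then show ?thesis
    by (rule measurable_cong[THEN iffD1, rotated])
      (auto simp: space_pair_measure space_PiM PiE_def extensional_def fun_eq_iff split: sum.split)
qed

text \<open>Boxes over \<open>I <+> J\<close> are products of a box over I and a box over J. This
  lets integrals over the coordinates of the pair be iterated.\<close>

lemma distr_case_sum_leb:
  assumes I: "finite I" and J: "finite J"
  shows "distr (leb I \<Otimes>\<^sub>M leb J) (leb (I <+> J)) (\<lambda>(u, v). case_sum u v) = leb (I <+> J)"
proof (rule lborel_prod.PiM_eqI)
  show "finite (I <+> J)" using I J by simp
  interpret FI: finite_product_sigma_finite "\<lambda>_::'a. lborel :: real measure" I by standard fact
  interpret FJ: finite_product_sigma_finite "\<lambda>_::'b. lborel :: real measure" J by standard fact
  fix A :: "'a + 'b \<Rightarrow> real set" assume A: "\<And>k. k \<in> I <+> J \<Longrightarrow> A k \<in> sets lborel"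
  have "case_sum u v \<in> Pi\<^sub>E (I <+> J) A \<longleftrightarrow> u \<in> Pi\<^sub>E I (A \<circ> Inl) \<and> v \<in> Pi\<^sub>E J (A \<circ> Inr)" for u v
    unfolding PiE_iff extensional_def Ball_def by (simp add: split_sum_all) blast
  then have pre: "(\<lambda>(u, v). case_sum u v) -` Pi\<^sub>E (I <+> J) A \<inter> space (leb I \<Otimes>\<^sub>M leb J)
      = Pi\<^sub>E I (A \<circ> Inl) \<times> Pi\<^sub>E J (A \<circ> Inr)"
    by (auto simp: space_pair_measure space_PiM PiE_iff)
  have A1: "\<And>i. i \<in> I \<Longrightarrow> (A \<circ> Inl) i \<in> sets lborel" "\<And>j. j \<in> J \<Longrightarrow> (A \<circ> Inr) j \<in> sets lborel"
    using A[OF InlI] A[OF InrI] by simp_all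
  have AI: "Pi\<^sub>E I (A \<circ> Inl) \<in> sets (leb I)" "Pi\<^sub>E J (A \<circ> Inr) \<in> sets (leb J)"
    using A1 I J by (blast intro: sets_PiM_I_finite)+
  have AIJ: "Pi\<^sub>E (I <+> J) A \<in> sets (leb (I <+> J))"
    using A I J by (intro sets_PiM_I_finite) auto
  have "emeasure (distr (leb I \<Otimes>\<^sub>M leb J) (leb (I <+> J)) (\<lambda>(u, v). case_sum u v)) (Pi\<^sub>E (I <+> J) A)
      = emeasure (leb I) (Pi\<^sub>E I (A \<circ> Inl)) * emeasure (leb J) (Pi\<^sub>E J (A \<circ> Inr))"
    by (subst emeasure_distr) (simp_all only: AIJ pre FJ.emeasure_pair_measure_Times[OF AI] measurable_case_sum_leb)
  also have "\<dots> = (\<Prod>k\<in>I <+> J. emeasure lborel (A k))"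
    using I J by (simp add: FI.measure_times[OF A1(1)] FJ.measure_times[OF A1(2)] prod.Plus)
  finally show "emeasure (distr (leb I \<Otimes>\<^sub>M leb J) (leb (I <+> J)) (\<lambda>(u, v). case_sum u v))
      (Pi\<^sub>E (I <+> J) A) = (\<Prod>k\<in>I <+> J. emeasure lborel (A k))" .
qed simp

lemma integrable_leb_Plus:
  fixes h :: "('i + 'j \<Rightarrow> real) \<Rightarrow> real"
  assumes "finite I" "finite J" "integrable (leb (I <+> J)) h"
  shows "integrable (leb I \<Otimes>\<^sub>M leb J) (\<lambda>(u, v). h (case_sum u v))"
proof -
  have "integrable (distr (leb I \<Otimes>\<^sub>M leb J) (leb (I <+> J)) (\<lambda>(u, v). case_sum u v)) h"
    using assms by (simp add: distr_case_sum_leb)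
  then show ?thesis
    using integrable_distr[OF measurable_case_sum_leb] by (simp only: case_prod_unfold)
qed

lemma integral_leb_Plus:
  fixes h :: "('i + 'j \<Rightarrow> real) \<Rightarrow> real"
  assumes "finite I" "finite J" "integrable (leb (I <+> J)) h"
  shows "integral\<^sup>L (leb (I <+> J)) h = (LINT u|leb I. LINT v|leb J. h (case_sum u v))"
proof -
  interpret pair_sigma_finite "leb I" "leb J"
    using assms by (intro pair_sigma_finite_leb)
  have h: "h \<in> borel_measurable (leb (I <+> J))"
    using assms(3) by (rule borel_measurable_integrable)
  have "integral\<^sup>L (leb (I <+> J)) h = (LINT p|(leb I \<Otimes>\<^sub>M leb J). h (case p of (u, v) \<Rightarrow> case_sum u v))"
    using integral_distr[OF measurable_case_sum_leb h] unfolding distr_case_sum_leb[OF assms(1,2)] .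
  also have "\<dots> = (LINT u|leb I. LINT v|leb J. h (case_sum u v))"
    using integral_fst'[OF integrable_leb_Plus[OF assms]] by (simp only: case_prod_unfold fst_conv snd_conv)
  finally show ?thesis .
qed

section \<open>One-dimensional integration by parts; differentiation under the integral\<close>

text \<open>The source of all discrete derivatives: the fundamental theorem on each side of l leaves
  the jump of the step function times g at l, since g vanishes at both ends.\<close>

lemma integral_jump_deriv:
  fixes g g' :: "real \<Rightarrow> real"
  assumes g: "\<And>s. (g has_real_derivative g' s) (at s)"
    and g': "continuous_on UNIV g'" "integrable lborel g'"
    and lim: "(g \<longlongrightarrow> 0) at_bot" "(g \<longlongrightarrow> 0) at_top"
  shows "(LINT s|lborel. (if s > l then a else b) * g' s) = - ((a - b) * g l)"
proof -
  have vd: "(g has_vector_derivative g' x) (at x)" for x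
    using g unfolding has_real_derivative_iff_has_vector_derivative .
  have cont: "isCont g x" for x
    using g by (rule DERIV_isCont)
  have c': "isCont g' x" for x
    using g'(1) by (simp add: continuous_on_eq_continuous_at)
  have i: "set_integrable lborel A g'" if "A \<in> sets borel" for A
    using that g'(2) unfolding set_integrable_def by (intro integrable_mult_indicator) simp_all
  have side: "(g \<longlongrightarrow> g l) (at_left l)" "(g \<longlongrightarrow> g l) (at_right l)"
    using cont[of l] by (simp_all add: isCont_def filterlim_at_split)
  have "(LBINT x=-\<infinity>..ereal l. g' x) = g l - 0"
    by (rule interval_integral_FTC_integrable[where F = g])
      (simp_all add: vd c' i lim side ereal_tendsto_simps)
  then have L: "(LINT x:{..<l}|lborel. g' x) = g l"
    by (simp add: interval_lebesgue_integral_def)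
  have "(LBINT x=ereal l..\<infinity>. g' x) = 0 - g l"
    by (rule interval_integral_FTC_integrable[where F = g])
      (simp_all add: vd c' i lim side ereal_tendsto_simps)
  then have R: "(LINT x:{l<..}|lborel. g' x) = - g l"
    by (simp add: interval_lebesgue_integral_def)
  have "(LINT s|lborel. (if s > l then a else b) * g' s)
      = (LINT s|lborel. a * (indicator {l<..} s * g' s) + b * (indicator {..<l} s * g' s))"
  proof (rule integral_cong_AE)
    have [measurable]: "g' \<in> borel_measurable borel" using g'(2) by simp
    show "(\<lambda>s. (if s > l then a else b) * g' s) \<in> borel_measurable lborel"
      "(\<lambda>s. a * (indicator {l<..} s * g' s) + b * (indicator {..<l} s * g' s)) \<in> borel_measurable lborel"
      by simp_all
    have "AE s in lborel. s \<noteq> l" by (rule AE_lborel_singleton)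
    then show "AE s in lborel. (if s > l then a else b) * g' s
        = a * (indicator {l<..} s * g' s) + b * (indicator {..<l} s * g' s)"
      by eventually_elim (auto simp: indicator_def)
  qed
  also have "\<dots> = a * (LINT x:{l<..}|lborel. g' x) + b * (LINT x:{..<l}|lborel. g' x)"
    using i[of "{l<..}"] i[of "{..<l}"]
    by (simp add: set_lebesgue_integral_def set_integrable_def)
  finally show ?thesis
    by (simp add: L R algebra_simps)
qed

lemma has_real_derivative_integral:
  fixes g g' :: "real \<Rightarrow> 'a \<Rightarrow> real"
  assumes int: "\<And>s. integrable M (g s)"
    and der: "\<And>s w. w \<in> space M \<Longrightarrow> ((\<lambda>s. g s w) has_real_derivative g' s w) (at s)"
    and bnd: "\<And>s w. w \<in> space M \<Longrightarrow> \<bar>g' s w\<bar> \<le> H w" and H: "integrable M H"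
    and meas: "\<And>s. g' s \<in> borel_measurable M"
  shows "((\<lambda>s. LINT w|M. g s w) has_real_derivative (LINT w|M. g' s w)) (at s)"
proof -
  have "((\<lambda>h. ((LINT w|M. g (s + h) w) - (LINT w|M. g s w)) / h) \<longlongrightarrow> (LINT w|M. g' s w)) (at 0)"
    unfolding tendsto_at_iff_sequentially comp_def
  proof (intro allI impI)
    fix X :: "nat \<Rightarrow> real" assume X: "\<forall>i. X i \<in> UNIV - {0}" "X \<longlonglongrightarrow> 0"
    have "(\<lambda>i. LINT w|M. (g (s + X i) w - g s w) / X i) \<longlonglongrightarrow> (LINT w|M. g' s w)"
    proof (rule integral_dominated_convergence[where w = H])
      show "g' s \<in> borel_measurable M" by fact
      show "(\<lambda>w. (g (s + X i) w - g s w) / X i) \<in> borel_measurable M" for i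
        using int[of "s + X i"] int[of s] by auto
      show "integrable M H" by fact
      show "AE w in M. (\<lambda>i. (g (s + X i) w - g s w) / X i) \<longlonglongrightarrow> g' s w"
      proof (rule AE_I2)
        fix w assume "w \<in> space M"
        from der[OF this, of s] have "((\<lambda>h. (g (s + h) w - g s w) / h) \<longlongrightarrow> g' s w) (at 0)"
          by (simp add: DERIV_def)
        then show "(\<lambda>i. (g (s + X i) w - g s w) / X i) \<longlonglongrightarrow> g' s w"
          using X unfolding tendsto_at_iff_sequentially comp_def by blast
      qed
      show "AE w in M. norm ((g (s + X i) w - g s w) / X i) \<le> H w" for i
      proof (rule AE_I2)
        fix w assume w: "w \<in> space M"
        \<comment> \<open>The mean value inequality turns the bound on the derivative into a bound
          on all difference quotients, as dominated convergence demands.\<close>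
        have "norm (g (s + X i) w - g s w) \<le> H w * norm (s + X i - s)"
          by (rule field_differentiable_bound[of UNIV "\<lambda>s. g s w" "\<lambda>s. g' s w"])
            (use der[OF w] bnd[OF w] in auto)
        then show "norm ((g (s + X i) w - g s w) / X i) \<le> H w"
          using X(1) by (simp add: field_simps abs_mult)
      qed
    qed
    also have "(\<lambda>i. LINT w|M. (g (s + X i) w - g s w) / X i)
        = (\<lambda>i. ((LINT w|M. g (s + X i) w) - (LINT w|M. g s w)) / X i)"
      using int by (simp add: Bochner_Integration.integral_diff)
    finally show "(\<lambda>i. ((LINT w|M. g (s + X i) w) - (LINT w|M. g s w)) / X i)
        \<longlonglongrightarrow> (LINT w|M. g' s w)" .
  qed
  then show ?thesis unfolding DERIV_def .
qed


section \<open>Gaussian densities with polynomial factors\<close>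

text \<open>
  Polynomials in the coordinates, \<open>t\<close> and \<open>1 / (1 - t\<^sup>2)\<close>. They are represented syntactically
  because the class is closed under all derivatives that occur below, so that one Gaussian bound
  per expression dominates them all.
\<close>

datatype 'i ex = Cst real | Crd 'i | Tim | Rec | Add "'i ex" "'i ex" | Mul "'i ex" "'i ex"

primrec ev :: "real \<Rightarrow> ('i \<Rightarrow> real) \<Rightarrow> 'i ex \<Rightarrow> real" where
  "ev t u (Cst a) = a"
| "ev t u (Crd i) = u i"
| "ev t u Tim = t"
| "ev t u Rec = 1 / (1 - t\<^sup>2)"
| "ev t u (Add a b) = ev t u a + ev t u b"
| "ev t u (Mul a b) = ev t u a * ev t u b"

primrec vars :: "'i ex \<Rightarrow> 'i set" where
  "vars (Cst a) = {}"
| "vars (Crd i) = {i}"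
| "vars Tim = {}"
| "vars Rec = {}"
| "vars (Add a b) = vars a \<union> vars b"
| "vars (Mul a b) = vars a \<union> vars b"

primrec dc :: "'i \<Rightarrow> 'i ex \<Rightarrow> 'i ex" where
  "dc i (Cst a) = Cst 0"
| "dc i (Crd j) = Cst (if i = j then 1 else 0)"
| "dc i Tim = Cst 0"
| "dc i Rec = Cst 0"
| "dc i (Add a b) = Add (dc i a) (dc i b)"
| "dc i (Mul a b) = Add (Mul (dc i a) b) (Mul a (dc i b))"

primrec dt :: "'i ex \<Rightarrow> 'i ex" where
  "dt (Cst a) = Cst 0"
| "dt (Crd j) = Cst 0"
| "dt Tim = Cst 1"
| "dt Rec = Mul (Mul (Cst 2) Tim) (Mul Rec Rec)"
| "dt (Add a b) = Add (dt a) (dt b)"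
| "dt (Mul a b) = Add (Mul (dt a) b) (Mul a (dt b))"

lemma ev_dc: "((\<lambda>s. ev t (u(i := s)) e) has_real_derivative ev t (u(i := x)) (dc i e)) (at x)"
  by (induction e) (auto intro!: derivative_eq_intros)

lemma ev_dt: "\<bar>t\<bar> < 1 \<Longrightarrow> ((\<lambda>t. ev t u e) has_real_derivative ev t u (dt e)) (at t)"
proof (induction e)
  case Rec
  then have "1 - t\<^sup>2 \<noteq> 0"
    using abs_square_less_1[of t] by simp
  then show ?case
    by (auto intro!: derivative_eq_intros simp: power2_eq_square)
qed (auto intro!: derivative_eq_intros)

text \<open>Symmetry of second derivatives by induction on expressions. The two sides differ as
  expressions, so equality can only be stated after evaluation.\<close>

lemma dc_comm: "ev t u (dc i (dc j e)) = ev t u (dc j (dc i e))"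
  by (induction e) (auto simp: algebra_simps)

lemma dt_dc: "ev t u (dt (dc i e)) = ev t u (dc i (dt e))"
  by (induction e) (auto simp: algebra_simps)

lemma vars_dc: "vars (dc i e) \<subseteq> vars e"
  by (induction e) auto

lemma vars_dt: "vars (dt e) \<subseteq> vars e"
  by (induction e) auto

lemma ev_cong: "(\<And>i. i \<in> vars e \<Longrightarrow> u i = v i) \<Longrightarrow> ev t u e = ev t v e"
  by (induction e) auto

lemma dc_not_in_vars: "i \<notin> vars e \<Longrightarrow> ev t u (dc i e) = 0"
  by (induction e) auto

text \<open>An identity between values at all points may be differentiated, although the expressions
  differ: derivatives are unique. The quantifier over u in the assumption is therefore
  essential.\<close>

lemma dc_linear:
  assumes "finite A" "\<And>u. ev t u e = (\<Sum>k\<in>A. w k * ev t u (e' k))"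
  shows "ev t u (dc i e) = (\<Sum>k\<in>A. w k * ev t u (dc i (e' k)))"
proof -
  have "((\<lambda>s. \<Sum>k\<in>A. w k * ev t (u(i := s)) (e' k)) has_real_derivative
      (\<Sum>k\<in>A. w k * ev t (u(i := u i)) (dc i (e' k)))) (at (u i))"
    by (intro DERIV_sum DERIV_cmult ev_dc)
  then show ?thesis
    using DERIV_unique[OF ev_dc[of t u i e "u i"]] by (simp add: assms(2))
qed

lemma ev_measurable:
  assumes "T \<in> borel_measurable M" "\<And>i. i \<in> vars e \<Longrightarrow> (\<lambda>w. X w i) \<in> borel_measurable M"
  shows "(\<lambda>w. ev (T w) (X w) e) \<in> borel_measurable M"
  using assms by (induction e) (auto intro!: borel_measurable_times borel_measurable_divide)

lemma abs_le_exp_sq: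
  assumes "0 < (\<epsilon>::real)"
  shows "\<bar>x\<bar> \<le> (1 + 1 / \<epsilon>) * exp (\<epsilon> * x\<^sup>2)"
proof -
  have "\<bar>x\<bar> \<le> 1 + x\<^sup>2"
    using zero_le_power2[of "\<bar>x\<bar> - 1"] by (simp add: power2_eq_square algebra_simps)
  \<comment> \<open>The constant is chosen so that multiplying out gives 1 + x^2 plus nonnegative
    terms.\<close>
  also have "\<dots> \<le> (1 + 1 / \<epsilon>) * (1 + \<epsilon> * x\<^sup>2)"
    using assms by (simp add: field_simps)
  also have "\<dots> \<le> (1 + 1 / \<epsilon>) * exp (\<epsilon> * x\<^sup>2)"
    using assms exp_ge_add_one_self[of "\<epsilon> * x\<^sup>2"] by (intro mult_left_mono) auto
  finally show ?thesis .
qed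

text \<open>A polynomial is beaten by every growing Gaussian. The bound is uniform on [0, s] with s
  < 1, where 1 / (1 - t^2) is at most its value at s.\<close>

lemma ev_bound:
  assumes "finite I" "vars e \<subseteq> I" "s < 1" "0 < \<epsilon>"
  shows "\<exists>C\<ge>0. \<forall>t\<in>{0..s}. \<forall>u. \<bar>ev t u e\<bar> \<le> C * exp (\<epsilon> * (\<Sum>i\<in>I. (u i)\<^sup>2))"
  using assms(2,4)
proof (induction e arbitrary: \<epsilon>)
  case (Cst a)
  have "\<bar>a\<bar> \<le> \<bar>a\<bar> * exp (\<epsilon> * (\<Sum>i\<in>I. (u i)\<^sup>2))" for u :: "'a \<Rightarrow> real"
    using Cst by (intro mult_right_mono[of 1 _ "\<bar>a\<bar>", simplified] mult_le_cancel_left1[THEN iffD2])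
      (simp add: sum_nonneg)
  then show ?case by (intro exI[of _ "\<bar>a\<bar>"]) auto
next
  case (Crd i)
  have "\<bar>u i\<bar> \<le> (1 + 1 / \<epsilon>) * exp (\<epsilon> * (\<Sum>i\<in>I. (u i)\<^sup>2))" for u
  proof -
    have "(u i)\<^sup>2 \<le> (\<Sum>i\<in>I. (u i)\<^sup>2)"
      using Crd assms(1) by (intro member_le_sum) auto
    then have "(1 + 1 / \<epsilon>) * exp (\<epsilon> * (u i)\<^sup>2) \<le> (1 + 1 / \<epsilon>) * exp (\<epsilon> * (\<Sum>i\<in>I. (u i)\<^sup>2))"
      using Crd by (intro mult_left_mono) auto
    with abs_le_exp_sq[OF Crd(2), of "u i"] show ?thesis by linarith
  qed
  then show ?case using Crd by (intro exI[of _ "1 + 1 / \<epsilon>"]) auto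
next
  case Tim
  have "t \<le> 1 * exp (\<epsilon> * (\<Sum>i\<in>I. (u i)\<^sup>2))" if "t \<in> {0..s}" for t and u :: "'a \<Rightarrow> real"
  proof -
    have "1 \<le> exp (\<epsilon> * (\<Sum>i\<in>I. (u i)\<^sup>2))" using Tim by (simp add: sum_nonneg)
    moreover have "t \<le> 1" using that assms(3) by simp
    ultimately show ?thesis by linarith
  qed
  then show ?case by (intro exI[of _ 1]) auto
next
  case Rec
  have "1 / (1 - t\<^sup>2) \<le> 1 / (1 - s\<^sup>2) * exp (\<epsilon> * (\<Sum>i\<in>I. (u i)\<^sup>2)) \<and> 0 \<le> 1 / (1 - t\<^sup>2)"
    if "t \<in> {0..s}" for t and u :: "'a \<Rightarrow> real"
  proof -
    have "t\<^sup>2 \<le> s\<^sup>2" "s\<^sup>2 < 1"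
      using that assms(3) abs_square_less_1[of s] by (auto intro!: power_mono)
    then have "1 / (1 - t\<^sup>2) \<le> 1 / (1 - s\<^sup>2)" "0 \<le> 1 / (1 - s\<^sup>2)" "0 \<le> 1 / (1 - t\<^sup>2)"
      by (auto simp: field_simps)
    moreover have "1 \<le> exp (\<epsilon> * (\<Sum>i\<in>I. (u i)\<^sup>2))" using Rec by (simp add: sum_nonneg)
    ultimately show ?thesis
      using mult_left_mono[of 1 "exp (\<epsilon> * (\<Sum>i\<in>I. (u i)\<^sup>2))" "1 / (1 - s\<^sup>2)"] by simp
  qed
  then show ?case by (intro exI[of _ "\<bar>1 / (1 - s\<^sup>2)\<bar>"])
      (auto intro: order_trans[OF _ mult_right_mono[OF abs_ge_self]])
next
  case (Add a b)
  obtain A where A: "A \<ge> 0" "\<And>t u. t \<in> {0..s} \<Longrightarrow> \<bar>ev t u a\<bar> \<le> A * exp (\<epsilon> * (\<Sum>i\<in>I. (u i)\<^sup>2))"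
    using Add.IH(1)[of "\<epsilon>"] Add.prems by auto
  obtain B where B: "B \<ge> 0" "\<And>t u. t \<in> {0..s} \<Longrightarrow> \<bar>ev t u b\<bar> \<le> B * exp (\<epsilon> * (\<Sum>i\<in>I. (u i)\<^sup>2))"
    using Add.IH(2)[of "\<epsilon>"] Add.prems by auto
  note AB = A(1) B(1) and * = A(2) B(2)
  have "\<bar>ev t u a + ev t u b\<bar> \<le> (A + B) * exp (\<epsilon> * (\<Sum>i\<in>I. (u i)\<^sup>2))" if "t \<in> {0..s}" for t u
    using *(1)[OF that, of u] *(2)[OF that, of u] unfolding distrib_right by linarith
  then show ?case using AB by (intro exI[of _ "A + B"]) auto
next
  case (Mul a b)
  \<comment> \<open>Each factor receives half of the exponent; this is why \<epsilon> is arbitrary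
    in the induction.\<close>
  obtain A where A: "A \<ge> 0" "\<And>t u. t \<in> {0..s} \<Longrightarrow> \<bar>ev t u a\<bar> \<le> A * exp (\<epsilon> / 2 * (\<Sum>i\<in>I. (u i)\<^sup>2))"
    using Mul.IH(1)[of "\<epsilon> / 2"] Mul.prems by auto
  obtain B where B: "B \<ge> 0" "\<And>t u. t \<in> {0..s} \<Longrightarrow> \<bar>ev t u b\<bar> \<le> B * exp (\<epsilon> / 2 * (\<Sum>i\<in>I. (u i)\<^sup>2))"
    using Mul.IH(2)[of "\<epsilon> / 2"] Mul.prems by auto
  note AB = A(1) B(1) and * = A(2) B(2)
  have "\<bar>ev t u a * ev t u b\<bar> \<le> (A * B) * exp (\<epsilon> * (\<Sum>i\<in>I. (u i)\<^sup>2))" if "t \<in> {0..s}" for t u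
  proof -
    have "\<bar>ev t u a * ev t u b\<bar> \<le> (A * exp (\<epsilon> / 2 * (\<Sum>i\<in>I. (u i)\<^sup>2))) * (B * exp (\<epsilon> / 2 * (\<Sum>i\<in>I. (u i)\<^sup>2)))"
      unfolding abs_mult using AB by (intro mult_mono * that) auto
    also have "\<dots> = (A * B) * exp (\<epsilon> / 2 * (\<Sum>i\<in>I. (u i)\<^sup>2) + \<epsilon> / 2 * (\<Sum>i\<in>I. (u i)\<^sup>2))"
      by (simp only: exp_add mult_ac)
    also have "\<epsilon> / 2 * (\<Sum>i\<in>I. (u i)\<^sup>2) + \<epsilon> / 2 * (\<Sum>i\<in>I. (u i)\<^sup>2) = \<epsilon> * (\<Sum>i\<in>I. (u i)\<^sup>2)"
      by simp
    finally show ?thesis .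
  qed
  then show ?case using AB by (intro exI[of _ "A * B"]) auto
qed

section \<open>Functions of the excursion set\<close>

lemma excursion_set_cong: "(\<And>i. i \<in> I \<Longrightarrow> u i = v i) \<Longrightarrow> excursion_set I l u = excursion_set I l v"
  by (auto simp: excursion_set_def)

text \<open>Such a function is a finite combination, over the subsets E of I, of products of
  half-line indicators.\<close>

lemma excursion_measurable:
  fixes \<Theta> :: "'i set \<Rightarrow> real"
  assumes I: "finite I" and X: "\<And>i. i \<in> I \<Longrightarrow> (\<lambda>w. X w i) \<in> borel_measurable M"
  shows "(\<lambda>w. \<Theta> (excursion_set I l (X w))) \<in> borel_measurable M"
proof -
  have "\<Theta> (excursion_set I l u) =
      (\<Sum>E\<in>Pow I. \<Theta> E * (\<Prod>i\<in>I. if i \<in> E then indicator {l<..} (u i) else indicator {..l} (u i)))" for u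
  proof -
    have "(\<Prod>i\<in>I. if i \<in> E then indicator {l<..} (u i) else indicator {..l} (u i))
        = (if E = excursion_set I l u then 1 else (0::real))" if "E \<subseteq> I" for E
    proof (cases "E = excursion_set I l u")
      case False
      then have "\<not> (\<forall>i\<in>I. i \<in> E \<longleftrightarrow> u i > l)"
        using that by (auto simp: excursion_set_def)
      then obtain i where "i \<in> I" "i \<in> E \<longleftrightarrow> \<not> u i > l"
        by auto
      then have "(\<Prod>i\<in>I. if i \<in> E then indicator {l<..} (u i) else indicator {..l} (u i)) = (0::real)"
        by (intro prod_zero[OF I] bexI[of _ i]) (auto simp: indicator_def)
      then show ?thesis
        using False by simp
    qed (auto simp: excursion_set_def intro!: prod.neutral)
    then have "(\<Sum>E\<in>Pow I. \<Theta> E * (\<Prod>i\<in>I. if i \<in> E then indicator {l<..} (u i) else indicator {..l} (u i)))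
        = (\<Sum>E\<in>Pow I. if E = excursion_set I l u then \<Theta> E else 0)"
      by (intro sum.cong) auto
    also have "\<dots> = \<Theta> (excursion_set I l u)"
      using I by (subst sum.delta) (auto simp: excursion_set_def)
    finally show ?thesis by simp
  qed
  moreover have "(\<lambda>w. \<Sum>E\<in>Pow I. \<Theta> E * (\<Prod>i\<in>I. if i \<in> E then indicator {l<..} (X w i)
      else indicator {..l} (X w i))) \<in> borel_measurable M"
  proof (intro borel_measurable_sum borel_measurable_times borel_measurable_const borel_measurable_prod)
    fix E i assume "i \<in> I"
    from X[OF this] show "(\<lambda>w. if i \<in> E then indicator {l<..} (X w i)
      else indicator {..l} (X w i) :: real) \<in> borel_measurable M"
      by (cases "i \<in> E") (simp_all add: measurable_compose)
  qed
  ultimately show ?thesis by simp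
qed

lemma excursion_bounded:
  fixes \<Theta> :: "'i set \<Rightarrow> real"
  assumes "finite I"
  shows "\<exists>C\<ge>0. \<forall>u. \<bar>\<Theta> (excursion_set I l u)\<bar> \<le> C"
proof (intro exI[of _ "\<Sum>E\<in>Pow I. \<bar>\<Theta> E\<bar>"] conjI allI)
  show "\<bar>\<Theta> (excursion_set I l u)\<bar> \<le> (\<Sum>E\<in>Pow I. \<bar>\<Theta> E\<bar>)" for u
    using assms by (intro member_le_sum) (auto simp: excursion_set_def)
qed (simp add: sum_nonneg)

text \<open>The points that remain after integrating by parts: coordinates outside A are frozen at
  the level l.\<close>

definition fill :: "'i set \<Rightarrow> real \<Rightarrow> ('i \<Rightarrow> real) \<Rightarrow> 'i \<Rightarrow> real" where
  "fill A l v i = (if i \<in> A then v i else l)"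

section \<open>Gaussian weights with polynomial factors\<close>

text \<open>The weight is \<kappa>(t) exp(Q), where R is the logarithmic derivative of \<kappa> and
  c a decay rate uniform in t. There are three instances: \<open>g0\<close>, the density of f;
  \<open>gt\<close>, the density of the pair; \<open>gr\<close>, the kernel behind the semigroup
  property.\<close>

locale gauss =
  fixes I :: "'i set" and Q R :: "'i ex" and \<kappa> :: "real \<Rightarrow> real" and c :: real
  assumes fin: "finite I" and vars_Q: "vars Q \<subseteq> I" and vars_R: "vars R = {}" and c_pos: "0 < c"
    and Q_bound: "\<And>t u. 0 \<le> t \<Longrightarrow> t < 1 \<Longrightarrow> ev t u Q \<le> - c * (\<Sum>i\<in>I. (u i)\<^sup>2)"
    and \<kappa>_deriv: "\<And>t u. \<bar>t\<bar> < 1 \<Longrightarrow> (\<kappa> has_real_derivative \<kappa> t * ev t u R) (at t)"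
begin

definition G :: "'i ex \<Rightarrow> real \<Rightarrow> ('i \<Rightarrow> real) \<Rightarrow> real" where
  "G e t u = ev t u e * (\<kappa> t * exp (ev t u Q))"

text \<open>The partial derivative conjugated by the weight: it acts on the polynomial factor alone.
  For a density, \<open>foldr D zs (Cst 1)\<close> is therefore the derivative along zs divided by
  the density, a Hermite polynomial up to the sign (-1)^(length zs). \<open>DT\<close> is the
  analogue in time.\<close>

definition D :: "'i \<Rightarrow> 'i ex \<Rightarrow> 'i ex" where
  "D i e = Add (dc i e) (Mul e (dc i Q))"

definition DT :: "'i ex \<Rightarrow> 'i ex" where
  "DT e = Add (dt e) (Mul e (Add (dt Q) R))"

lemma G_D: "((\<lambda>s. G e t (u(i := s))) has_real_derivative G (D i e) t (u(i := x))) (at x)"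
  unfolding G_def D_def by (auto intro!: derivative_eq_intros ev_dc simp: algebra_simps)

lemma coord_deriv_G: "coord_deriv i (G e t) = G (D i e) t"
proof
  fix u show "coord_deriv i (G e t) u = G (D i e) t u"
    using DERIV_imp_deriv[OF G_D[of e t u i "u i"]] by (simp add: coord_deriv_def)
qed

lemma foldr_coord_deriv_G: "foldr coord_deriv xs (G e t) = G (foldr D xs e) t"
  by (induction xs) (simp_all add: coord_deriv_G)

lemma G_DT: "\<bar>t\<bar> < 1 \<Longrightarrow> ((\<lambda>t. G e t u) has_real_derivative G (DT e) t u) (at t)"
  unfolding G_def DT_def
  by (auto intro!: derivative_eq_intros ev_dt \<kappa>_deriv simp: algebra_simps)

lemma D_comm: "ev t u (D i (D j e)) = ev t u (D j (D i e))"
  unfolding D_def by (simp add: algebra_simps dc_comm[of t u i j])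

text \<open>Time and space derivatives commute because R contains no coordinates.\<close>

lemma DT_D: "ev t u (DT (D i e)) = ev t u (D i (DT e))"
  unfolding D_def DT_def by (simp add: algebra_simps dt_dc dc_not_in_vars vars_R)

lemma D_linear:
  assumes "finite A" "\<And>u. ev t u e = (\<Sum>k\<in>A. w k * ev t u (e' k))"
  shows "ev t u (D i e) = (\<Sum>k\<in>A. w k * ev t u (D i (e' k)))"
  unfolding D_def by (simp add: dc_linear[OF assms] assms(2) sum.distrib sum_distrib_right
      distrib_left mult.assoc)

lemma Ds_linear:
  assumes "finite A" "\<And>u. ev t u e = (\<Sum>k\<in>A. w k * ev t u (e' k))"
  shows "ev t u (foldr D xs e) = (\<Sum>k\<in>A. w k * ev t u (foldr D xs (e' k)))"
  by (induction xs arbitrary: u) (simp_all add: assms(2) D_linear[OF assms(1)])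

lemma Ds_cong: "(\<And>u. ev t u e = ev t u e') \<Longrightarrow> ev t u (foldr D xs e) = ev t u (foldr D xs e')"
  using Ds_linear[of "{()}" t e "\<lambda>_. 1" "\<lambda>_. e'"] by simp

lemma D_Ds: "ev t u (foldr D xs (D i e)) = ev t u (D i (foldr D xs e))"
proof (induction xs arbitrary: u)
  case (Cons x xs)
  have "ev t u (D x (foldr D xs (D i e))) = ev t u (D x (D i (foldr D xs e)))"
    using Ds_cong[of t "foldr D xs (D i e)" "D i (foldr D xs e)" u "[x]"] Cons by simp
  then show ?case by (simp add: D_comm)
qed simp

lemma DT_Ds: "ev t u (DT (foldr D xs e)) = ev t u (foldr D xs (DT e))"
proof (induction xs arbitrary: u)
  case (Cons x xs)
  have "ev t u (D x (DT (foldr D xs e))) = ev t u (D x (foldr D xs (DT e)))"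
    using Ds_cong[of t "DT (foldr D xs e)" "foldr D xs (DT e)" u "[x]"] Cons by simp
  then show ?case by (simp add: DT_D)
qed simp

text \<open>The order of differentiation is immaterial. This absorbs the arbitrary order in
  \<open>mixed_deriv\<close> and allows derivatives to be regrouped later.\<close>

lemma Ds_mset: "mset xs = mset ys \<Longrightarrow> ev t u (foldr D xs e) = ev t u (foldr D ys e)"
proof (induction xs arbitrary: ys u)
  case (Cons x xs)
  then have "x \<in> set ys" by (metis list.set_intros(1) mset_eq_setD)
  then obtain as bs where ys: "ys = as @ x # bs" by (meson split_list)
  with Cons.prems have "mset xs = mset (as @ bs)" by simp
  then have "\<And>u. ev t u (foldr D xs e) = ev t u (foldr D (as @ bs) e)"
    by (rule Cons.IH)
  then have "ev t u (D x (foldr D xs e)) = ev t u (D x (foldr D (as @ bs) e))"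
    using Ds_cong[of t "foldr D xs e" "foldr D (as @ bs) e" u "[x]"] by simp
  also have "\<dots> = ev t u (foldr D as (D x (foldr D bs e)))"
    by (simp add: D_Ds)
  finally show ?case by (simp add: ys)
qed simp

lemma vars_D: "vars (D i e) \<subseteq> vars e \<union> I"
  unfolding D_def using vars_dc[of i e] vars_dc[of i Q] vars_Q by auto

lemma vars_Ds: "vars e \<subseteq> I \<Longrightarrow> vars (foldr D xs e) \<subseteq> I"
proof (induction xs)
  case (Cons x xs)
  then show ?case using vars_D[of x "foldr D xs e"] by auto
qed simp

lemma vars_DT: "vars e \<subseteq> I \<Longrightarrow> vars (DT e) \<subseteq> I"
  unfolding DT_def using vars_dt[of e] vars_dt[of Q] vars_Q vars_R by auto

lemma G_cong: "vars e \<subseteq> I \<Longrightarrow> (\<And>i. i \<in> I \<Longrightarrow> u i = v i) \<Longrightarrow> G e t u = G e t v"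
  unfolding G_def using ev_cong[of e u v t] ev_cong[of Q u v t] vars_Q by (simp add: subset_iff)

lemma \<kappa>_cont: "continuous_on {-1<..<1} \<kappa>"
proof (intro continuous_at_imp_continuous_on ballI)
  show "isCont \<kappa> t" if "t \<in> {-1<..<1}" for t
    using DERIV_isCont[OF \<kappa>_deriv[of t "\<lambda>_. 0"]] that by (simp add: abs_less_iff)
qed

lemma G_measurable_pair:
  assumes "vars e \<subseteq> I" "T \<in> borel_measurable M" "\<And>w. w \<in> space M \<Longrightarrow> \<bar>T w\<bar> < 1"
    and "\<And>i. i \<in> I \<Longrightarrow> (\<lambda>w. X w i) \<in> borel_measurable M"
  shows "(\<lambda>w. G e (T w) (X w)) \<in> borel_measurable M"
proof -
  have "(\<lambda>w. \<kappa> (T w)) \<in> borel_measurable M"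
  proof -
    \<comment> \<open>Outside (-1, 1) nothing is known about \<kappa>, so it is cut off before
      measurability is derived from continuity.\<close>
    have "(\<lambda>t. indicator {-1<..<1} t *\<^sub>R \<kappa> t) \<in> borel_measurable borel"
      by (rule borel_measurable_continuous_on_indicator) (use \<kappa>_cont in auto)
    from measurable_compose[OF assms(2) this]
    have "(\<lambda>w. indicator {-1<..<1} (T w) *\<^sub>R \<kappa> (T w)) \<in> borel_measurable M" .
    moreover have "indicator {-1<..<1} (T w) *\<^sub>R \<kappa> (T w) = \<kappa> (T w)" if "w \<in> space M" for w
      using assms(3)[OF that] by (auto simp: indicator_def abs_less_iff)
    ultimately show ?thesis
      by (rule measurable_cong[THEN iffD1, rotated])
  qed
  moreover have "(\<lambda>w. ev (T w) (X w) e) \<in> borel_measurable M" "(\<lambda>w. ev (T w) (X w) Q) \<in> borel_measurable M"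
    using assms vars_Q by (auto intro!: ev_measurable)
  ultimately show ?thesis
    unfolding G_def by simp
qed

lemma G_measurable:
  assumes "vars e \<subseteq> I" "\<And>i. i \<in> I \<Longrightarrow> (\<lambda>w. X w i) \<in> borel_measurable M"
  shows "(\<lambda>w. G e t (X w)) \<in> borel_measurable M"
proof -
  have "(\<lambda>w. ev t (X w) e) \<in> borel_measurable M" "(\<lambda>w. ev t (X w) Q) \<in> borel_measurable M"
    using assms vars_Q by (auto intro!: ev_measurable)
  then show ?thesis
    unfolding G_def by simp
qed

text \<open>Half of the decay rate c pays for the polynomial factor, the other half remains.\<close>

lemma G_bound:
  assumes "vars e \<subseteq> I" "s < 1"
  shows "\<exists>C\<ge>0. \<forall>t\<in>{0..s}. \<forall>u. \<bar>G e t u\<bar> \<le> C * exp (- (c / 2) * (\<Sum>i\<in>I. (u i)\<^sup>2))"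
proof -
  obtain A where A: "A \<ge> 0" "\<And>t u. t \<in> {0..s} \<Longrightarrow> \<bar>ev t u e\<bar> \<le> A * exp (c / 2 * (\<Sum>i\<in>I. (u i)\<^sup>2))"
    using ev_bound[OF fin assms, of "c / 2"] c_pos by auto
  have "bounded (\<kappa> ` {0..s})"
    using assms(2) by (intro compact_imp_bounded compact_continuous_image
        continuous_on_subset[OF \<kappa>_cont]) auto
  then obtain B where B: "B > 0" "\<And>t. t \<in> {0..s} \<Longrightarrow> \<bar>\<kappa> t\<bar> \<le> B"
    unfolding bounded_pos by auto
  have "\<bar>G e t u\<bar> \<le> (A * B) * exp (- (c / 2) * (\<Sum>i\<in>I. (u i)\<^sup>2))" if t: "t \<in> {0..s}" for t u
  proof -
    have "\<bar>G e t u\<bar> = \<bar>ev t u e\<bar> * (\<bar>\<kappa> t\<bar> * exp (ev t u Q))"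
      by (simp add: G_def abs_mult)
    also have "\<dots> \<le> (A * exp (c / 2 * (\<Sum>i\<in>I. (u i)\<^sup>2))) * (B * exp (- c * (\<Sum>i\<in>I. (u i)\<^sup>2)))"
      using A(1) B(1) t assms(2) by (intro mult_mono A(2) B(2)) (auto intro: Q_bound[simplified])
    also have "\<dots> = (A * B) * exp (c / 2 * (\<Sum>i\<in>I. (u i)\<^sup>2) + - c * (\<Sum>i\<in>I. (u i)\<^sup>2))"
      by (simp only: exp_add mult_ac)
    also have "c / 2 * (\<Sum>i\<in>I. (u i)\<^sup>2) + - c * (\<Sum>i\<in>I. (u i)\<^sup>2) = - (c / 2) * (\<Sum>i\<in>I. (u i)\<^sup>2)"
      by simp
    finally show ?thesis .
  qed
  then show ?thesis using A(1) B(1) by (intro exI[of _ "A * B"]) auto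
qed

section \<open>Integration by parts against functions of the excursion set\<close>

text \<open>Freezing coordinates only adds to the sum of squares, so the Gaussian bound in the free
  coordinates survives.\<close>

lemma integrable_G_fill:
  fixes \<Theta> :: "'i set \<Rightarrow> real"
  assumes "vars e \<subseteq> I" "0 \<le> t" "t < 1" "A \<subseteq> I"
  shows "integrable (leb A) (\<lambda>v. \<Theta> (excursion_set I l (fill A l v)) * G e t (fill A l v))"
proof -
  obtain C where C: "C \<ge> 0" "\<And>u. \<bar>G e t u\<bar> \<le> C * exp (- (c / 2) * (\<Sum>i\<in>I. (u i)\<^sup>2))"
    using G_bound[OF assms(1,3)] assms(2) by auto
  obtain B where B: "B \<ge> 0" "\<And>u. \<bar>\<Theta> (excursion_set I l u)\<bar> \<le> B"
    using excursion_bounded[OF fin, of \<Theta> l] by auto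
  have f: "finite A" using assms(4) fin finite_subset by blast
  have m: "(\<lambda>w. fill A l w i) \<in> borel_measurable (leb A)" for i
    unfolding fill_def by (cases "i \<in> A") (auto intro: measurable_coord)
  show ?thesis
  proof (rule integrable_leb_bound[OF f, of "c / 2" _ "B * C"])
    show "(\<lambda>v. \<Theta> (excursion_set I l (fill A l v)) * G e t (fill A l v)) \<in> borel_measurable (leb A)"
      by (intro borel_measurable_times excursion_measurable G_measurable fin m assms)
    fix v :: "'i \<Rightarrow> real"
    have "(\<Sum>i\<in>A. (v i)\<^sup>2) = (\<Sum>i\<in>A. (fill A l v i)\<^sup>2)"
      by (simp add: fill_def)
    also have "\<dots> \<le> (\<Sum>i\<in>I. (fill A l v i)\<^sup>2)"
      using assms(4) fin by (intro sum_mono2) auto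
    finally have "C * exp (- (c / 2) * (\<Sum>i\<in>I. (fill A l v i)\<^sup>2)) \<le> C * exp (- (c / 2) * (\<Sum>i\<in>A. (v i)\<^sup>2))"
      using C(1) c_pos by (intro mult_left_mono) auto
    then have "\<bar>G e t (fill A l v)\<bar> \<le> C * exp (- (c / 2) * (\<Sum>i\<in>A. (v i)\<^sup>2))"
      using C(2)[of "fill A l v"] by linarith
    then have "\<bar>\<Theta> (excursion_set I l (fill A l v))\<bar> * \<bar>G e t (fill A l v)\<bar>
        \<le> B * (C * exp (- (c / 2) * (\<Sum>i\<in>A. (v i)\<^sup>2)))"
      by (intro mult_mono B) (use B in auto)
    then show "\<bar>\<Theta> (excursion_set I l (fill A l v)) * G e t (fill A l v)\<bar>
        \<le> B * C * exp (- (c / 2) * (\<Sum>i\<in>A. (v i)\<^sup>2))"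
      by (simp add: abs_mult mult.assoc)
  qed (use c_pos in simp)
qed

lemma integrable_G:
  fixes \<Theta> :: "'i set \<Rightarrow> real"
  assumes "vars e \<subseteq> I" "0 \<le> t" "t < 1"
  shows "integrable (leb I) (\<lambda>u. \<Theta> (excursion_set I l u) * G e t u)"
proof -
  have "\<Theta> (excursion_set I l (fill I l u)) * G e t (fill I l u) = \<Theta> (excursion_set I l u) * G e t u" for u
    using excursion_set_cong[of I "fill I l u" u l] G_cong[OF assms(1), of "fill I l u" u t]
    by (simp add: fill_def)
  then show ?thesis using integrable_G_fill[OF assms order_refl, of \<Theta> l] by simp
qed

text \<open>Fubini isolates the coordinate i, where \<open>integral_jump_deriv\<close> applies: as
  it crosses l, the excursion set changes from E without i to E with i, and the boundary term sits
  at the level l.\<close>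

lemma G_ibp_step:
  fixes \<Theta> :: "'i set \<Rightarrow> real"
  assumes e: "vars e \<subseteq> I" and t: "0 \<le> t" "t < 1" and A: "A \<subseteq> I" "i \<in> A"
  shows "(LINT v|leb A. \<Theta> (excursion_set I l (fill A l v)) * G (D i e) t (fill A l v))
    = - (LINT v|leb (A - {i}). discrete_deriv i \<Theta> (excursion_set I l (fill (A - {i}) l v))
          * G e t (fill (A - {i}) l v))"
proof -
  let ?A = "A - {i}"
  have De: "vars (D i e) \<subseteq> I" using vars_D[of i e] e by auto
  have fA: "finite ?A" using A fin finite_subset by blast
  have ins: "insert i ?A = A" using A by auto
  have "(LINT v|leb A. \<Theta> (excursion_set I l (fill A l v)) * G (D i e) t (fill A l v))
      = (LINT v|leb ?A. LINT s|lborel. \<Theta> (excursion_set I l (fill A l (v(i := s))))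
          * G (D i e) t (fill A l (v(i := s))))"
    using lborel_prod.product_integral_insert[OF fA, of i
        "\<lambda>v. \<Theta> (excursion_set I l (fill A l v)) * G (D i e) t (fill A l v)"]
      integrable_G_fill[OF De t A(1)] unfolding ins by simp
  also have "\<dots> = (LINT v|leb ?A. - (discrete_deriv i \<Theta> (excursion_set I l (fill ?A l v))
      * G e t (fill ?A l v)))"
  proof (intro Bochner_Integration.integral_cong refl)
    fix v :: "'i \<Rightarrow> real"
    define w where "w = fill ?A l v"
    let ?E = "excursion_set I l w"
    have upd: "fill A l (v(i := s)) = w(i := s)" for s
      using A(2) by (auto simp: fill_def w_def fun_eq_iff)
    have E: "excursion_set I l (w(i := s)) = (if s > l then insert i ?E else ?E - {i})" for s
      using A by (auto simp: excursion_set_def w_def fill_def)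
    obtain C where C: "C \<ge> 0" "\<And>u. \<bar>G e t u\<bar> \<le> C * exp (- (c / 2) * (\<Sum>i\<in>I. (u i)\<^sup>2))"
      using G_bound[OF e t(2)] t by auto
    obtain C' where C': "C' \<ge> 0" "\<And>u. \<bar>G (D i e) t u\<bar> \<le> C' * exp (- (c / 2) * (\<Sum>i\<in>I. (u i)\<^sup>2))"
      using G_bound[OF De t(2)] t by auto
    have sq: "exp (- (c / 2) * (\<Sum>j\<in>I. ((w(i := s)) j)\<^sup>2)) \<le> exp (- (c / 2) * s\<^sup>2)" for s
    proof -
      have "((w(i := s)) i)\<^sup>2 \<le> (\<Sum>j\<in>I. ((w(i := s)) j)\<^sup>2)"
        using A fin by (intro member_le_sum) auto
      then show ?thesis using c_pos by simp
    qed
    have Cs: "\<bar>G e t (w(i := s))\<bar> \<le> C * exp (- (c / 2) * s\<^sup>2)" for s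
      using C(2)[of "w(i := s)"] mult_left_mono[OF sq[of s] C(1)] by linarith
    have Cs': "\<bar>G (D i e) t (w(i := s))\<bar> \<le> C' * exp (- (c / 2) * s\<^sup>2)" for s
      using C'(2)[of "w(i := s)"] mult_left_mono[OF sq[of s] C'(1)] by linarith
    have cont: "continuous_on UNIV (\<lambda>s. G (D i e) t (w(i := s)))"
      using G_D by (intro continuous_at_imp_continuous_on ballI) (blast intro: DERIV_isCont)
    have lim0: "((\<lambda>s. C * exp (- (c / 2) * s\<^sup>2)) \<longlongrightarrow> 0) at_bot" "((\<lambda>s. C * exp (- (c / 2) * s\<^sup>2)) \<longlongrightarrow> 0) at_top"
    proof -
      have sq_lim: "filterlim (\<lambda>s::real. - (c / 2) * s\<^sup>2) at_bot F" if "filterlim (\<lambda>s::real. s\<^sup>2) at_top F" for F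
        using filterlim_tendsto_neg_mult_at_bot[OF tendsto_const[of "- (c / 2)"] _ that] c_pos by simp
      have top: "filterlim (\<lambda>s::real. s\<^sup>2) at_top at_top"
        by (intro filterlim_pow_at_top filterlim_ident) auto
      have "filterlim (\<lambda>s::real. (- s)\<^sup>2) at_top at_bot"
        by (rule filterlim_compose[OF top filterlim_uminus_at_top_at_bot])
      then have bot: "filterlim (\<lambda>s::real. s\<^sup>2) at_top at_bot" by simp
      show "((\<lambda>s. C * exp (- (c / 2) * s\<^sup>2)) \<longlongrightarrow> 0) at_bot"
        by (rule tendsto_mult_right_zero, rule filterlim_compose[OF exp_at_bot sq_lim[OF bot]])
      show "((\<lambda>s. C * exp (- (c / 2) * s\<^sup>2)) \<longlongrightarrow> 0) at_top"
        by (rule tendsto_mult_right_zero, rule filterlim_compose[OF exp_at_bot sq_lim[OF top]])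
    qed
    have "(LINT s|lborel. (if s > l then \<Theta> (insert i ?E) else \<Theta> (?E - {i})) * G (D i e) t (w(i := s)))
        = - ((\<Theta> (insert i ?E) - \<Theta> (?E - {i})) * G e t (w(i := l)))"
    proof (rule integral_jump_deriv)
      show "((\<lambda>s. G e t (w(i := s))) has_real_derivative G (D i e) t (w(i := s))) (at s)" for s
        by (rule G_D)
      show "continuous_on UNIV (\<lambda>s. G (D i e) t (w(i := s)))" by fact
      show "integrable lborel (\<lambda>s. G (D i e) t (w(i := s)))"
      proof (rule Bochner_Integration.integrable_bound)
        show "integrable lborel (\<lambda>s. C' * exp (- (c / 2) * s\<^sup>2))"
          using c_pos by (intro integrable_mult_right integrable_exp_neg_sq) simp
        show "(\<lambda>s. G (D i e) t (w(i := s))) \<in> borel_measurable lborel"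
          using borel_measurable_continuous_onI[OF cont] by simp
        show "AE s in lborel. norm (G (D i e) t (w(i := s))) \<le> norm (C' * exp (- (c / 2) * s\<^sup>2))"
          using Cs' C'(1) by (intro AE_I2) (simp add: abs_mult)
      qed
      show "((\<lambda>s. G e t (w(i := s))) \<longlongrightarrow> 0) at_bot"
        by (rule Lim_null_comparison[OF _ lim0(1)]) (use Cs in auto)
      show "((\<lambda>s. G e t (w(i := s))) \<longlongrightarrow> 0) at_top"
        by (rule Lim_null_comparison[OF _ lim0(2)]) (use Cs in auto)
    qed
    moreover have "w(i := l) = w" by (auto simp: w_def fill_def fun_eq_iff)
    ultimately show "(LINT s|lborel. \<Theta> (excursion_set I l (fill A l (v(i := s)))) * G (D i e) t (fill A l (v(i := s))))
        = - (discrete_deriv i \<Theta> (excursion_set I l (fill ?A l v)) * G e t (fill ?A l v))"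
      unfolding upd E w_def[symmetric] discrete_deriv_def by (simp add: if_distrib[of \<Theta>])
  qed
  finally show ?thesis by simp
qed

text \<open>Each step freezes its coordinate at l, so a coordinate can be used only once. Further
  derivatives in the same coordinate stay inside e and later form the Hermite factor.\<close>

lemma G_ibp:
  fixes \<Theta> :: "'i set \<Rightarrow> real"
  assumes t: "0 \<le> t" "t < 1" and xs: "distinct xs" "set xs \<subseteq> I" and e: "vars e \<subseteq> I"
  shows "(LINT u|leb I. \<Theta> (excursion_set I l u) * G (foldr D xs e) t u)
    = (-1) ^ length xs * (LINT v|leb (I - set xs). foldr discrete_deriv xs \<Theta>
          (excursion_set I l (fill (I - set xs) l v)) * G e t (fill (I - set xs) l v))"
  using xs e
proof (induction xs arbitrary: e)
  case Nil
  have "\<Theta> (excursion_set I l (fill I l u)) * G e t (fill I l u) = \<Theta> (excursion_set I l u) * G e t u" for u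
    using excursion_set_cong[of I "fill I l u" u l] G_cong[OF Nil(3), of "fill I l u" u t]
    by (simp add: fill_def)
  then show ?case by simp
next
  case (Cons i xs)
  have De: "vars (D i e) \<subseteq> I" using vars_D[of i e] Cons.prems by auto
  \<comment> \<open>\<open>D i\<close> is moved innermost, so that the induction hypothesis consumes
    xs first and the last step removes i.\<close>
  have "G (foldr D (i # xs) e) t u = G (foldr D xs (D i e)) t u" for u
    by (simp add: G_def D_Ds)
  then have "(LINT u|leb I. \<Theta> (excursion_set I l u) * G (foldr D (i # xs) e) t u)
      = (-1) ^ length xs * (LINT v|leb (I - set xs). foldr discrete_deriv xs \<Theta>
          (excursion_set I l (fill (I - set xs) l v)) * G (D i e) t (fill (I - set xs) l v))"
    using Cons.IH[OF _ _ De] Cons.prems by simp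
  also have "\<dots> = (-1) ^ length (i # xs) * (LINT v|leb (I - set xs - {i}). foldr discrete_deriv (i # xs) \<Theta>
          (excursion_set I l (fill (I - set xs - {i}) l v)) * G e t (fill (I - set xs - {i}) l v))"
    using Cons.prems by (subst G_ibp_step[OF Cons.prems(3) t]) auto
  also have "I - set xs - {i} = I - set (i # xs)" by auto
  finally show ?case .
qed

text \<open>Integration by parts against the constant 1, whose discrete derivative is 0. Moments and
  Gram matrices are computed from this.\<close>

lemma integral_G_D:
  assumes "vars e \<subseteq> I" "0 \<le> t" "t < 1" "i \<in> I"
  shows "(LINT u|leb I. G (D i e) t u) = 0"
  using G_ibp[OF assms(2,3), of "[i]" e "\<lambda>_. 1" 0] assms by (simp add: discrete_deriv_def)

end


section \<open>The density of a correlated pair\<close>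

text \<open>Expressions have only binary addition, so a finite sum follows some enumeration of A;
  its value does not depend on the choice.\<close>

definition esum :: "'a set \<Rightarrow> ('a \<Rightarrow> 'i ex) \<Rightarrow> 'i ex" where
  "esum A f = foldr (\<lambda>x. Add (f x)) (SOME xs. set xs = A \<and> distinct xs) (Cst 0)"

lemma esum_list:
  assumes "finite A"
  obtains xs where "set xs = A" "distinct xs" "esum A f = foldr (\<lambda>x. Add (f x)) xs (Cst 0)"
  using someI_ex[OF finite_distinct_list[OF assms]] unfolding esum_def by blast

lemma ev_esum: "finite A \<Longrightarrow> ev t u (esum A f) = (\<Sum>a\<in>A. ev t u (f a))"
proof -
  assume "finite A"
  then obtain xs where xs: "set xs = A" "distinct xs" "esum A f = foldr (\<lambda>x. Add (f x)) xs (Cst 0)"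
    by (rule esum_list)
  have "ev t u (foldr (\<lambda>x. Add (f x)) xs (Cst 0)) = (\<Sum>a\<leftarrow>xs. ev t u (f a))"
    by (induction xs) auto
  then show ?thesis using xs by (simp add: sum_list_distinct_conv_sum_set)
qed

lemma ev_dc_esum: "finite A \<Longrightarrow> ev t u (dc i (esum A f)) = (\<Sum>a\<in>A. ev t u (dc i (f a)))"
  using dc_linear[of A t "esum A f" "\<lambda>_. 1" f u i] by (simp add: ev_esum)

lemma ev_dt_esum: "finite A \<Longrightarrow> ev t u (dt (esum A f)) = (\<Sum>a\<in>A. ev t u (dt (f a)))"
proof -
  assume "finite A"
  then obtain xs where xs: "set xs = A" "distinct xs" "esum A f = foldr (\<lambda>x. Add (f x)) xs (Cst 0)"
    by (rule esum_list)
  have "ev t u (dt (foldr (\<lambda>x. Add (f x)) xs (Cst 0))) = (\<Sum>a\<leftarrow>xs. ev t u (dt (f a)))"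
    by (induction xs) auto
  then show ?thesis using xs by (simp add: sum_list_distinct_conv_sum_set)
qed

lemma vars_esum: "finite A \<Longrightarrow> vars (esum A f) = (\<Union>a\<in>A. vars (f a))"
proof -
  assume "finite A"
  then obtain xs where xs: "set xs = A" "distinct xs" "esum A f = foldr (\<lambda>x. Add (f x)) xs (Cst 0)"
    by (rule esum_list)
  have "vars (foldr (\<lambda>x. Add (f x)) xs (Cst 0)) = (\<Union>a\<in>set xs. vars (f a))"
    by (induction xs) auto
  then show ?thesis using xs by simp
qed

section \<open>Quadratic forms of K and of its inverse\<close>

locale gcov =
  fixes S :: "'i set" and K :: "'i \<Rightarrow> 'i \<Rightarrow> real"
  assumes finS: "finite S" and pdK: "pos_def S K"
    and total: "integral\<^sup>L (leb S) (gaussian_density S K) = 1"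
begin

definition B where "B = set_inverse S K"

lemma KB: "i \<in> S \<Longrightarrow> j \<in> S \<Longrightarrow> (\<Sum>k\<in>S. K i k * B k j) = (if i = j then 1 else 0)"
proof -
  obtain B' where B': "\<And>i j. i \<in> S \<Longrightarrow> j \<in> S \<Longrightarrow> (\<Sum>k\<in>S. K i k * B' k j) = (if i = j then 1 else 0)"
    using pos_def_inverse[OF finS pdK] by blast
  assume "i \<in> S" "j \<in> S"
  then have "(\<Sum>k\<in>S. K i k * B k j) = (\<Sum>k\<in>S. K i k * B' k j)"
    unfolding B_def using set_inverse_eqI[OF finS pdK B'] by (intro sum.cong) auto
  with B' \<open>i \<in> S\<close> \<open>j \<in> S\<close> show ?thesis by simp
qed

lemma K_sym: "i \<in> S \<Longrightarrow> j \<in> S \<Longrightarrow> K i j = K j i"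
  using pdK by (simp add: pos_def_def)

text \<open>\<open>bil\<close> is the form of the inverse of K, \<open>Bv\<close> the inverse
  applied to a vector, and \<open>bilK\<close> the form of K itself. \<open>bilK_Bv\<close> converts
  between them.\<close>

definition bil :: "('i \<Rightarrow> real) \<Rightarrow> ('i \<Rightarrow> real) \<Rightarrow> real" where
  "bil u v = (\<Sum>i\<in>S. \<Sum>j\<in>S. u i * B i j * v j)"

definition Bv :: "('i \<Rightarrow> real) \<Rightarrow> 'i \<Rightarrow> real" where
  "Bv u i = (\<Sum>j\<in>S. B i j * u j)"

definition bilK :: "('i \<Rightarrow> real) \<Rightarrow> ('i \<Rightarrow> real) \<Rightarrow> real" where
  "bilK u v = (\<Sum>i\<in>S. \<Sum>j\<in>S. u i * K i j * v j)"

lemma K_Bv: "i \<in> S \<Longrightarrow> (\<Sum>j\<in>S. K i j * Bv u j) = u i"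
proof -
  assume i: "i \<in> S"
  have "(\<Sum>j\<in>S. K i j * Bv u j) = (\<Sum>k\<in>S. \<Sum>j\<in>S. K i j * B j k * u k)"
    unfolding Bv_def by (simp add: sum_distrib_left mult.assoc) (rule sum.swap)
  also have "\<dots> = (\<Sum>k\<in>S. (if i = k then 1 else 0) * u k)"
    using i by (intro sum.cong refl) (simp add: sum_distrib_right[symmetric] KB)
  also have "\<dots> = u i" using i finS by (simp add: if_distrib if_distribR cong: if_cong)
  finally show ?thesis .
qed

text \<open>Evaluate the symmetric form \<open>bilK\<close> at columns i and j of B, cancelling K
  against either column.\<close>

lemma B_sym: "i \<in> S \<Longrightarrow> j \<in> S \<Longrightarrow> B i j = B j i"
proof -
  assume ij: "i \<in> S" "j \<in> S"
  let ?d = "\<lambda>j k::'i. if k = j then 1 else 0 :: real"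
  have Bd: "Bv (?d j) k = B k j" if "j \<in> S" for k j
    using that finS by (simp add: Bv_def if_distrib cong: if_cong)
  have "bilK (Bv (?d i)) (Bv (?d j)) = (\<Sum>k\<in>S. Bv (?d i) k * ?d j k)"
    unfolding bilK_def by (intro sum.cong refl) (simp add: mult.assoc sum_distrib_left[symmetric] K_Bv)
  then have 1: "bilK (Bv (?d i)) (Bv (?d j)) = B j i"
    using ij finS by (simp add: Bd if_distrib cong: if_cong)
  have "bilK (Bv (?d i)) (Bv (?d j)) = (\<Sum>k\<in>S. \<Sum>m\<in>S. Bv (?d i) m * K m k * Bv (?d j) k)"
    unfolding bilK_def by (rule sum.swap)
  also have "\<dots> = (\<Sum>k\<in>S. Bv (?d j) k * (\<Sum>m\<in>S. K k m * Bv (?d i) m))"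
    by (auto intro!: sum.cong simp: sum_distrib_left K_sym)
  also have "\<dots> = (\<Sum>k\<in>S. Bv (?d j) k * ?d i k)"
    by (intro sum.cong refl) (simp add: K_Bv)
  finally show ?thesis
    using 1 ij finS by (simp add: Bd if_distrib cong: if_cong)
qed

lemma BK: "i \<in> S \<Longrightarrow> j \<in> S \<Longrightarrow> (\<Sum>k\<in>S. B i k * K k j) = (if i = j then 1 else 0)"
proof -
  assume ij: "i \<in> S" "j \<in> S"
  then have "(\<Sum>k\<in>S. B i k * K k j) = (\<Sum>k\<in>S. K j k * B k i)"
    by (intro sum.cong refl) (simp add: B_sym[of i] K_sym[of j])
  then show ?thesis using KB[OF ij(2,1)] by simp
qed

lemma bil_Bv: "bil u v = (\<Sum>i\<in>S. u i * Bv v i)"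
  by (simp add: bil_def Bv_def sum_distrib_left mult.assoc)

lemma bil_sym: "bil u v = bil v u"
  unfolding bil_def by (subst sum.swap) (auto intro!: sum.cong simp: B_sym)

lemma bilK_Bv: "bilK (Bv u) (Bv v) = bil u v"
proof -
  have "bilK (Bv u) (Bv v) = (\<Sum>k\<in>S. Bv u k * v k)"
    unfolding bilK_def by (intro sum.cong refl) (simp add: mult.assoc sum_distrib_left[symmetric] K_Bv)
  also have "\<dots> = bil v u" by (simp add: bil_Bv mult.commute)
  finally show ?thesis by (simp only: bil_sym[of u v])
qed

lemma bilK_lin_left: "bilK (\<lambda>i. a * u i + b * v i) w = a * bilK u w + b * bilK v w"
  unfolding bilK_def by (simp add: sum_distrib_left sum.distrib[symmetric] algebra_simps)

lemma bilK_lin_right: "bilK w (\<lambda>i. a * u i + b * v i) = a * bilK w u + b * bilK w v"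
  unfolding bilK_def by (simp add: sum_distrib_left sum.distrib[symmetric] algebra_simps)

lemma bilK_nonneg: "0 \<le> bilK u u"
  using pdK unfolding pos_def_def bilK_def
  by (cases "\<exists>i\<in>S. u i \<noteq> 0") (auto intro: less_imp_le)

lemma bil_nonneg: "0 \<le> bil u u"
  using bilK_nonneg[of "Bv u"] by (simp add: bilK_Bv)

lemma bil_add_left: "bil (\<lambda>i. a * u i + b * v i) w = a * bil u w + b * bil v w"
  by (simp add: bil_Bv sum.distrib sum_distrib_left distrib_right mult.assoc)

lemma bil_add_right: "bil w (\<lambda>i. a * u i + b * v i) = a * bil w u + b * bil w v"
  using bil_add_left[of a u b v w] by (simp add: bil_sym)

lemma bil_comb: "bil (\<lambda>i. a * u i + b * v i) (\<lambda>i. a * u i + b * v i)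
    = a\<^sup>2 * bil u u + 2 * a * b * bil u v + b\<^sup>2 * bil v v"
  by (simp add: bil_add_left bil_add_right bil_sym[of v u] power2_eq_square algebra_simps)

lemma bil_le: "2 * bil u v \<le> bil u u + bil v v"
  using bil_nonneg[of "\<lambda>i. 1 * u i + (-1) * v i"] by (simp only: bil_comb) simp

text \<open>Cauchy--Schwarz for \<^term>\<open>bilK\<close>, applied to the \<open>x\<close>-th column of \<^term>\<open>B\<close>.\<close>

lemma K_coercive: "\<exists>\<beta>>0. \<forall>x\<in>S. \<forall>v. \<beta> * (v x)\<^sup>2 \<le> bilK v v"
proof -
  define M where "M = (\<Sum>x\<in>S. \<bar>B x x\<bar>) + 1"
  have M: "M > 0" unfolding M_def by (intro add_nonneg_pos sum_nonneg) auto
  have "(1 / M) * (v x)\<^sup>2 \<le> bilK v v" if x: "x \<in> S" for x v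
  proof -
    let ?d = "\<lambda>k::'i. if k = x then 1 else 0 :: real"
    have "B x x \<le> \<bar>B x x\<bar>" by simp
    also have "\<dots> \<le> (\<Sum>x\<in>S. \<bar>B x x\<bar>)" using x finS by (intro member_le_sum) auto
    finally have Bxx: "B x x \<le> M" by (simp add: M_def)
    have Bd: "Bv ?d k = B k x" for k
      using x finS by (simp add: Bv_def if_distrib cong: if_cong)
    have 1: "bilK (Bv ?d) (Bv ?d) = B x x"
      unfolding bilK_Bv bil_Bv using x finS by (simp add: Bd if_distribR if_distrib cong: if_cong)
    have "bilK v (Bv ?d) = (\<Sum>k\<in>S. v k * ?d k)"
      unfolding bilK_def by (intro sum.cong refl) (simp add: mult.assoc sum_distrib_left[symmetric] K_Bv)
    then have 2: "bilK v (Bv ?d) = v x" using x finS by (simp add: if_distrib cong: if_cong)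
    have 3: "bilK (Bv ?d) v = v x"
      using 2 unfolding bilK_def by (subst sum.swap) (auto intro!: sum.cong simp: K_sym mult_ac elim!: trans[rotated])
    \<comment> \<open>The minimiser in s of - 2 s v_x + s^2 M, where M bounds the diagonal entry of
      B.\<close>
    let ?s = "v x / M"
    have "0 \<le> bilK (\<lambda>i. 1 * v i + (- ?s) * Bv ?d i) (\<lambda>i. 1 * v i + (- ?s) * Bv ?d i)" by (rule bilK_nonneg)
    also have "\<dots> = bilK v v - 2 * (v x)\<^sup>2 / M + (v x)\<^sup>2 * B x x / M\<^sup>2"
      unfolding bilK_lin_left bilK_lin_right 1 2 3 by (simp add: power2_eq_square algebra_simps)
    also have "(v x)\<^sup>2 * B x x / M\<^sup>2 \<le> (v x)\<^sup>2 * M / M\<^sup>2"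
      using Bxx by (intro divide_right_mono mult_left_mono) auto
    also have "(v x)\<^sup>2 * M / M\<^sup>2 = (v x)\<^sup>2 / M" using M by (simp add: power2_eq_square)
    finally show ?thesis by simp
  qed
  then show ?thesis using M by (intro exI[of _ "1 / M"]) auto
qed

text \<open>The argument of \<open>K_coercive\<close> with the roles of K and B exchanged bounds one
  coordinate; adding over S costs a factor \<open>card S\<close>.\<close>

lemma B_coercive: "\<exists>\<beta>>0. \<forall>u. \<beta> * (\<Sum>i\<in>S. (u i)\<^sup>2) \<le> bil u u"
proof -
  define M where "M = (\<Sum>x\<in>S. \<bar>K x x\<bar>) + 1"
  have M: "M > 0" unfolding M_def by (intro add_nonneg_pos sum_nonneg) auto
  have one: "(u x)\<^sup>2 / M \<le> bil u u" if x: "x \<in> S" for x u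
  proof -
    have "K x x \<le> \<bar>K x x\<bar>" by simp
    also have "\<dots> \<le> (\<Sum>x\<in>S. \<bar>K x x\<bar>)" using x finS by (intro member_le_sum) auto
    finally have Kxx: "K x x \<le> M" by (simp add: M_def)
    have kb: "Bv (\<lambda>k. K k x) i = (if i = x then 1 else 0)" if "i \<in> S" for i
      unfolding Bv_def using BK[OF that x] by simp
    have 1: "bil u (\<lambda>k. K k x) = u x"
      unfolding bil_Bv using x finS by (simp add: kb if_distrib cong: if_cong sum.cong)
    have 2: "bil (\<lambda>k. K k x) (\<lambda>k. K k x) = K x x"
      unfolding bil_Bv using x finS by (simp add: kb if_distrib cong: if_cong sum.cong)
    let ?s = "u x / M"
    have "0 \<le> bil (\<lambda>i. 1 * u i + (- ?s) * K i x) (\<lambda>i. 1 * u i + (- ?s) * K i x)" by (rule bil_nonneg)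
    also have "\<dots> = bil u u - 2 * (u x)\<^sup>2 / M + (u x)\<^sup>2 * K x x / M\<^sup>2"
      unfolding bil_comb 1 2 by (simp add: power2_eq_square)
    also have "(u x)\<^sup>2 * K x x / M\<^sup>2 \<le> (u x)\<^sup>2 * M / M\<^sup>2"
      using Kxx by (intro divide_right_mono mult_left_mono) auto
    also have "(u x)\<^sup>2 * M / M\<^sup>2 = (u x)\<^sup>2 / M" using M by (simp add: power2_eq_square)
    finally show ?thesis by simp
  qed
  \<comment> \<open>The summand 1 keeps the constant meaningful when S is empty.\<close>
  let ?b = "1 / (M * (1 + card S))"
  have "?b * (\<Sum>i\<in>S. (u i)\<^sup>2) \<le> bil u u" for u
  proof -
    have "(\<Sum>i\<in>S. (u i)\<^sup>2 / M) \<le> card S * bil u u"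
      using sum_bounded_above[of S "\<lambda>i. (u i)\<^sup>2 / M" "bil u u"] one by simp
    also have "\<dots> \<le> (1 + card S) * bil u u" using bil_nonneg[of u] by (intro mult_right_mono) auto
    finally have "(\<Sum>i\<in>S. (u i)\<^sup>2) / M \<le> (1 + card S) * bil u u" by (simp add: sum_divide_distrib)
    then have "(\<Sum>i\<in>S. (u i)\<^sup>2) / M / (1 + card S) \<le> bil u u"
      by (subst pos_divide_le_eq) (simp_all add: mult.commute)
    then show ?thesis by simp
  qed
  moreover have "?b > 0" using M by simp
  ultimately show ?thesis by blast
qed

definition \<beta> where "\<beta> = (SOME b. b > 0 \<and> (\<forall>u. b * (\<Sum>i\<in>S. (u i)\<^sup>2) \<le> bil u u))"

lemma \<beta>_pos: "\<beta> > 0" and \<beta>_le: "\<beta> * (\<Sum>i\<in>S. (u i)\<^sup>2) \<le> bil u u"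
  using someI_ex[OF B_coercive] unfolding \<beta>_def by auto

definition \<kappa>0 where "\<kappa>0 = 1 / sqrt ((2 * pi) ^ card S * set_det S K)"

lemma density_eq: "gaussian_density S K u = \<kappa>0 * exp (- bil u u / 2)"
  by (simp add: gaussian_density_def \<kappa>0_def bil_def B_def)

text \<open>\<open>pos_def_det\<close> leaves the sign open. The square root of a nonpositive number
  is nonpositive and 1 / 0 = 0, so with the wrong sign the density would be nonpositive, against
  total mass 1.\<close>

lemma det_pos: "set_det S K > 0"
proof (rule ccontr)
  assume "\<not> set_det S K > 0"
  then have "(2 * pi) ^ card S * set_det S K \<le> 0"
    by (intro mult_nonneg_nonpos) auto
  then have "\<kappa>0 \<le> 0" by (simp add: \<kappa>0_def)
  then have "integral\<^sup>L (leb S) (\<lambda>u. - gaussian_density S K u) \<ge> 0"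
    by (intro integral_nonneg_AE AE_I2) (simp add: density_eq mult_nonpos_nonneg)
  then show False using total by simp
qed

lemma \<kappa>0_pos: "\<kappa>0 > 0"
  using det_pos by (simp add: \<kappa>0_def)

text \<open>The form \<open>bil\<close> as an expression. The renamings p and q place its arguments
  in either half of the pair.\<close>

definition bx :: "('i \<Rightarrow> 'k) \<Rightarrow> ('i \<Rightarrow> 'k) \<Rightarrow> 'k ex" where
  "bx p q = esum S (\<lambda>i. esum S (\<lambda>j. Mul (Cst (B i j)) (Mul (Crd (p i)) (Crd (q j)))))"

lemma ev_bx: "ev t u (bx p q) = bil (\<lambda>i. u (p i)) (\<lambda>i. u (q i))"
  unfolding bx_def bil_def using finS by (simp add: ev_esum mult_ac)

lemma ev_dt_bx: "ev t u (dt (bx p q)) = 0"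
  unfolding bx_def using finS by (simp add: ev_dt_esum)

lemma ev_dc_bx: "ev t u (dc k (bx p q)) = (\<Sum>i\<in>S. if k = p i then Bv (\<lambda>i. u (q i)) i else 0)
    + (\<Sum>i\<in>S. if k = q i then Bv (\<lambda>i. u (p i)) i else 0)"
proof -
  have "ev t u (dc k (bx p q)) = (\<Sum>i\<in>S. \<Sum>j\<in>S. (if k = p i then B i j * u (q j) else 0))
      + (\<Sum>i\<in>S. \<Sum>j\<in>S. (if k = q j then B i j * u (p i) else 0))"
    unfolding bx_def using finS
    by (simp add: ev_dc_esum sum.distrib[symmetric] distrib_left) (intro sum.cong refl; simp)
  also have "(\<Sum>i\<in>S. \<Sum>j\<in>S. (if k = q j then B i j * u (p i) else 0))
      = (\<Sum>j\<in>S. \<Sum>i\<in>S. (if k = q j then B j i * u (p i) else 0))"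
    by (subst sum.swap) (auto intro!: sum.cong simp: B_sym)
  finally show ?thesis
    by (simp add: Bv_def if_distrib cong: if_cong)
      (intro arg_cong2[where f = "(+)"] sum.cong refl; simp)
qed

lemma vars_bx: "vars (bx p q) \<subseteq> p ` S \<union> q ` S"
  unfolding bx_def using finS by (auto simp: vars_esum)

section \<open>The density of f and the density of the pair\<close>

definition Q0 :: "'i ex" where
  "Q0 = Mul (Cst (- (1 / 2))) (bx id id)"

sublocale g0: gauss S Q0 "Cst 0" "\<lambda>_. \<kappa>0" "\<beta> / 2"
proof
  show "ev t u Q0 \<le> - (\<beta> / 2) * (\<Sum>i\<in>S. (u i)\<^sup>2)" for t u
    using \<beta>_le[of u] by (simp add: Q0_def ev_bx)
  show "vars Q0 \<subseteq> S" using vars_bx[of id id] by (auto simp: Q0_def)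
qed (use finS \<beta>_pos in auto)

lemma g0_density: "g0.G e t u = ev t u e * gaussian_density S K u"
  unfolding g0.G_def density_eq by (simp add: Q0_def ev_bx)

text \<open>The exponent of the density of \<open>(f, f\<^sup>t)\<close>; \<open>\<kappa>t\<close>
  is its normalising factor and \<open>Rt\<close> the logarithmic derivative of that factor.
  \<open>density_pair\<close> confirms this.\<close>

definition Qt :: "('i + 'i) ex" where
  "Qt = Mul (Mul (Cst (- (1 / 2))) Rec)
     (Add (Add (bx Inl Inl) (bx Inr Inr)) (Mul (Mul (Cst (-2)) Tim) (bx Inl Inr)))"

definition Rt :: "('i + 'i) ex" where
  "Rt = Mul (Mul (Cst (real (card S))) Tim) Rec"

definition \<kappa>t :: "real \<Rightarrow> real" where
  "\<kappa>t t = \<kappa>0\<^sup>2 * (1 - t\<^sup>2) powr (- (real (card S) / 2))"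

lemma sum_Plus_sq: "(\<Sum>i\<in>S <+> S. (u i)\<^sup>2) = (\<Sum>i\<in>S. (u (Inl i) :: real)\<^sup>2) + (\<Sum>i\<in>S. (u (Inr i))\<^sup>2)"
  using finS by (simp add: sum.Plus)

lemma ev_Qt: "ev t u Qt = - (1 / 2) * (1 / (1 - t\<^sup>2)) * (bil (u \<circ> Inl) (u \<circ> Inl) + bil (u \<circ> Inr) (u \<circ> Inr)
    + - 2 * t * bil (u \<circ> Inl) (u \<circ> Inr))"
  by (simp only: Qt_def ev.simps ev_bx comp_def)

sublocale gt: gauss "S <+> S" Qt Rt \<kappa>t "\<beta> / 4"
proof
  show "finite (S <+> S)" "0 < \<beta> / 4" "vars Rt = {}" using finS \<beta>_pos by (auto simp: Rt_def)
  show "vars Qt \<subseteq> S <+> S"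
    using vars_bx[of "Inl :: 'i \<Rightarrow> 'i + 'i" Inl] vars_bx[of "Inl :: 'i \<Rightarrow> 'i + 'i" Inr]
      vars_bx[of "Inr :: 'i \<Rightarrow> 'i + 'i" Inr]
    by (auto simp: Qt_def)
  fix t :: real
  show "(\<kappa>t has_real_derivative \<kappa>t t * ev t u Rt) (at t)" if "\<bar>t\<bar> < 1" for u
  proof -
    have p: "1 - t\<^sup>2 > 0" using that abs_square_less_1[of t] by simp
    have "((\<lambda>t. 1 - t\<^sup>2) has_real_derivative - (2 * t)) (at t)"
      by (auto intro!: derivative_eq_intros)
    note d = DERIV_cmult[OF DERIV_fun_powr[OF this p, of "- (real (card S) / 2)"], of "\<kappa>0\<^sup>2"]
    have e: "(1 - t\<^sup>2) powr (- (real (card S) / 2) - of_nat 1) = (1 - t\<^sup>2) powr (- (real (card S) / 2)) * (1 / (1 - t\<^sup>2))"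
      using p by (simp add: powr_diff)
    have "(\<kappa>t has_real_derivative \<kappa>0\<^sup>2 * (- (real (card S) / 2)
        * ((1 - t\<^sup>2) powr (- (real (card S) / 2)) * (1 / (1 - t\<^sup>2))) * (- (2 * t)))) (at t)"
      using d unfolding e \<kappa>t_def[symmetric] .
    moreover have 2: "k * (- (n / 2) * (p * i) * (- (2 * t))) = k * p * (n * t * i)" for k p i n :: real
      by (simp add: field_simps)
    have "\<kappa>0\<^sup>2 * (- (real (card S) / 2)
        * ((1 - t\<^sup>2) powr (- (real (card S) / 2)) * (1 / (1 - t\<^sup>2))) * (- (2 * t))) = \<kappa>t t * ev t u Rt"
      unfolding \<kappa>t_def Rt_def ev.simps by (rule 2)
    ultimately show ?thesis by metis
  qed
  fix u :: "'i + 'i \<Rightarrow> real"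
  assume t: "0 \<le> t" "t < 1"
  let ?U = "bil (u \<circ> Inl) (u \<circ> Inl)" and ?V = "bil (u \<circ> Inr) (u \<circ> Inr)" and ?W = "bil (u \<circ> Inl) (u \<circ> Inr)"
  \<comment> \<open>Bounding the mixed term leaves (1 - t)(U + V) / (2 (1 - t^2)) = (U + V) / (2 (1
    + t)), which is at least (U + V) / 4 for t < 1. Hence the decay rate \<beta> / 4, uniform up to
    t = 1.\<close>
  have "2 * t * ?W \<le> t * (?U + ?V)"
    using mult_left_mono[OF bil_le[of "u \<circ> Inl" "u \<circ> Inr"] t(1)] by simp
  then have "(1 - t) * (?U + ?V) \<le> ?U + ?V - 2 * t * ?W" by (simp add: algebra_simps)
  then have i1: "(1 - t) * (?U + ?V) / (2 * (1 - t\<^sup>2)) \<le> (?U + ?V - 2 * t * ?W) / (2 * (1 - t\<^sup>2))"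
    using t abs_square_less_1[of t] by (intro divide_right_mono) auto
  have "\<beta> * (\<Sum>i\<in>S <+> S. (u i)\<^sup>2) \<le> ?U + ?V"
    using \<beta>_le[of "u \<circ> Inl"] \<beta>_le[of "u \<circ> Inr"] by (simp add: sum_Plus_sq distrib_left comp_def)
  then have "\<beta> * (\<Sum>i\<in>S <+> S. (u i)\<^sup>2) / 4 \<le> (?U + ?V) / 4"
    by (rule divide_right_mono) simp
  also have "(?U + ?V) / 4 \<le> (?U + ?V) / (2 * (1 + t))"
    using t bil_nonneg[of "u \<circ> Inl"] bil_nonneg[of "u \<circ> Inr"] by (intro divide_left_mono) auto
  also have "(?U + ?V) / (2 * (1 + t)) = (1 - t) * (?U + ?V) / (2 * (1 - t\<^sup>2))"
  proof -
    have "1 - t\<^sup>2 = (1 - t) * (1 + t)" by (simp add: power2_eq_square algebra_simps)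
    then show ?thesis using t by simp
  qed
  also note i1
  also have "(?U + ?V - 2 * t * ?W) / (2 * (1 - t\<^sup>2)) = - ev t u Qt"
    unfolding ev_Qt by (simp del: right_diff_distrib_numeral)
  finally have "\<beta> * (\<Sum>i\<in>S <+> S. (u i)\<^sup>2) / 4 \<le> - ev t u Qt" .
  then show "ev t u Qt \<le> - (\<beta> / 4) * (\<Sum>i\<in>S <+> S. (u i)\<^sup>2)"
    by simp
qed

section \<open>The heat equation\<close>

lemma dc_Qt_Inl: "a \<in> S \<Longrightarrow> ev t u (dc (Inl a) Qt)
    = - (1 / (1 - t\<^sup>2)) * (Bv (u \<circ> Inl) a - t * Bv (u \<circ> Inr) a)"
proof -
  assume "a \<in> S"
  then have 1: "ev t u (dc (Inl a) Qt) = (- (1 / 2)) * (1 / (1 - t\<^sup>2)) *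
      (2 * Bv (u \<circ> Inl) a + - 2 * t * Bv (u \<circ> Inr) a)"
    unfolding Qt_def dc.simps ev.simps ev_dc_bx using finS by (simp add: comp_def)
  have 2: "- (1 / 2) * r * (2 * x + - 2 * t * y) = - r * (x - t * y)" for r x y :: real
    by (simp add: algebra_simps)
  show ?thesis unfolding 1 by (rule 2)
qed

lemma dc_Qt_Inr: "a \<in> S \<Longrightarrow> ev t u (dc (Inr a) Qt)
    = - (1 / (1 - t\<^sup>2)) * (Bv (u \<circ> Inr) a - t * Bv (u \<circ> Inl) a)"
proof -
  assume "a \<in> S"
  then have 1: "ev t u (dc (Inr a) Qt) = (- (1 / 2)) * (1 / (1 - t\<^sup>2)) *
      (2 * Bv (u \<circ> Inr) a + - 2 * t * Bv (u \<circ> Inl) a)"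
    unfolding Qt_def dc.simps ev.simps ev_dc_bx using finS by (simp add: comp_def)
  have 2: "- (1 / 2) * r * (2 * x + - 2 * t * y) = - r * (x - t * y)" for r x y :: real
    by (simp add: algebra_simps)
  show ?thesis unfolding 1 by (rule 2)
qed

lemma Bv_upd: "a \<in> S \<Longrightarrow> ((\<lambda>s. Bv (u(a := s)) b) has_real_derivative B b a) (at x)"
proof -
  assume a: "a \<in> S"
  have "((\<lambda>s. \<Sum>j\<in>S. B b j * (u(a := s)) j) has_real_derivative (\<Sum>j\<in>S. B b j * (if j = a then 1 else 0))) (at x)"
    by (intro DERIV_sum DERIV_cmult) (auto intro!: derivative_eq_intros)
  then show ?thesis using a finS by (simp add: Bv_def if_distrib cong: if_cong)
qed

lemma dc_dc_Qt: "a \<in> S \<Longrightarrow> b \<in> S \<Longrightarrow> ev t u (dc (Inl a) (dc (Inr b) Qt)) = t * B a b / (1 - t\<^sup>2)"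
proof -
  assume ab: "a \<in> S" "b \<in> S"
  have 1: "(u(Inl a := s)) \<circ> Inr = u \<circ> Inr" "(u(Inl a := s)) \<circ> Inl = (u \<circ> Inl)(a := s)" for s
    by (auto simp: fun_eq_iff)
  have "((\<lambda>s. - (1 / (1 - t\<^sup>2)) * (Bv (u \<circ> Inr) b - t * Bv ((u \<circ> Inl)(a := s)) b)) has_real_derivative
      - (1 / (1 - t\<^sup>2)) * (0 - t * B b a)) (at (u (Inl a)))"
    by (intro DERIV_diff DERIV_const DERIV_cmult Bv_upd ab)
  moreover have "((\<lambda>s. ev t (u(Inl a := s)) (dc (Inr b) Qt)) has_real_derivative
      ev t u (dc (Inl a) (dc (Inr b) Qt))) (at (u (Inl a)))"
    using ev_dc[of t u "Inl a" "dc (Inr b) Qt" "u (Inl a)"] by simp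
  ultimately have "ev t u (dc (Inl a) (dc (Inr b) Qt)) = - (1 / (1 - t\<^sup>2)) * (0 - t * B b a)"
    unfolding dc_Qt_Inr[OF ab(2)] 1 by (rule DERIV_unique[rotated])
  then show ?thesis using B_sym ab by simp
qed

lemma sum_KB: "(\<Sum>a\<in>S. \<Sum>b\<in>S. K a b * B a b) = real (card S)"
proof -
  have "(\<Sum>a\<in>S. \<Sum>b\<in>S. K a b * B a b) = (\<Sum>a\<in>S. \<Sum>b\<in>S. K a b * B b a)"
    by (auto intro!: sum.cong simp: B_sym)
  also have "\<dots> = (\<Sum>a\<in>S. 1)" by (intro sum.cong refl) (simp add: KB)
  finally show ?thesis by simp
qed

text \<open>Both sides are divided by the density. Second derivatives of the exponent contribute the
  trace of K B, that is \<open>card S\<close>, which matches the derivative of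
  \<open>\<kappa>t\<close>. The products of gradients, contracted with K, become values of
  \<open>bil\<close> and match the time derivative of the exponent.\<close>

lemma heat:
  assumes t: "\<bar>t\<bar> < 1"
  shows "ev t u (gt.DT (Cst 1)) = (\<Sum>(a, b)\<in>S \<times> S. K a b * ev t u (foldr gt.D [Inl a, Inr b] (Cst 1)))"
proof -
  define r where "r = 1 / (1 - t\<^sup>2)"
  have p: "1 - t\<^sup>2 \<noteq> 0" using t abs_square_less_1[of t] by simp
  then have r: "r * (1 - t\<^sup>2) = 1" by (simp add: r_def)
  let ?u = "u \<circ> Inl" and ?v = "u \<circ> Inr"
  have "(\<Sum>(a, b)\<in>S \<times> S. K a b * ev t u (foldr gt.D [Inl a, Inr b] (Cst 1)))
      = (\<Sum>a\<in>S. \<Sum>b\<in>S. K a b * (r\<^sup>2 * ((Bv ?u a - t * Bv ?v a) * (Bv ?v b - t * Bv ?u b)) + t * r * B a b))"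
    unfolding sum.cartesian_product[symmetric]
  proof (intro sum.cong refl arg_cong2[where f = times])
    fix a b assume ab: "a \<in> S" "b \<in> S"
    have "ev t u (foldr gt.D [Inl a, Inr b] (Cst 1))
        = ev t u (dc (Inl a) (dc (Inr b) Qt)) + ev t u (dc (Inr b) Qt) * ev t u (dc (Inl a) Qt)"
      by (simp add: gt.D_def)
    then show "ev t u (foldr gt.D [Inl a, Inr b] (Cst 1))
        = r\<^sup>2 * ((Bv ?u a - t * Bv ?v a) * (Bv ?v b - t * Bv ?u b)) + t * r * B a b"
      unfolding dc_dc_Qt[OF ab] dc_Qt_Inl[OF ab(1)] dc_Qt_Inr[OF ab(2)] r_def[symmetric]
      by (simp add: r_def power2_eq_square)
  qed
  also have "\<dots> = r\<^sup>2 * (bilK (Bv ?u) (Bv ?v) - t * bilK (Bv ?u) (Bv ?u) - t * bilK (Bv ?v) (Bv ?v)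
      + t\<^sup>2 * bilK (Bv ?v) (Bv ?u)) + t * r * (\<Sum>a\<in>S. \<Sum>b\<in>S. K a b * B a b)"
    unfolding bilK_def
    by (simp add: sum_distrib_left sum_subtractf[symmetric] sum.distrib[symmetric] power2_eq_square algebra_simps)
  also have "\<dots> = r\<^sup>2 * ((1 + t\<^sup>2) * bil ?u ?v - t * bil ?u ?u - t * bil ?v ?v) + t * r * real (card S)"
    unfolding bilK_Bv sum_KB bil_sym[of ?v ?u] by (simp add: algebra_simps)
  finally have R: "(\<Sum>(a, b)\<in>S \<times> S. K a b * ev t u (foldr gt.D [Inl a, Inr b] (Cst 1))) = \<dots>" .
  have "ev t u (gt.DT (Cst 1)) = - t * r\<^sup>2 * (bil ?u ?u + bil ?v ?v - 2 * t * bil ?u ?v) + r * bil ?u ?v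
      + t * r * real (card S)"
  proof -
    have "ev t u (dt Qt) = - (1 / 2) * (2 * t * (r * r)) * (bil ?u ?u + bil ?v ?v + - 2 * t * bil ?u ?v)
        + - (1 / 2) * r * (- 2 * bil ?u ?v)"
      by (simp only: Qt_def dt.simps ev.simps ev_dt_bx ev_bx comp_def r_def[symmetric]) simp
    moreover have "ev t u Rt = real (card S) * t * r"
      by (simp only: Rt_def ev.simps r_def[symmetric])
    ultimately show ?thesis
      unfolding gt.DT_def by (simp add: power2_eq_square algebra_simps comp_def)
  qed
  \<comment> \<open>Brings the term of order r to order r^2, so that both sides can be compared
    without division.\<close>
  also have "r * bil ?u ?v = r\<^sup>2 * (1 - t\<^sup>2) * bil ?u ?v"
    using r by (simp add: power2_eq_square mult.assoc)
  finally show ?thesis unfolding R by (simp add: power2_eq_square algebra_simps comp_def)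
qed

text \<open>The coefficients K a b are constant, so the heat equation may be differentiated further
  along zs.\<close>

lemma heat_Ds:
  assumes t: "\<bar>t\<bar> < 1"
  shows "gt.G (gt.DT (foldr gt.D zs (Cst 1))) t u
    = (\<Sum>a\<in>S. \<Sum>b\<in>S. K a b * gt.G (foldr gt.D (Inl a # Inr b # zs) (Cst 1)) t u)"
proof -
  have "ev t u (gt.DT (foldr gt.D zs (Cst 1))) = ev t u (foldr gt.D zs (gt.DT (Cst 1)))"
    by (rule gt.DT_Ds)
  also have "\<dots> = (\<Sum>k\<in>S \<times> S. K (fst k) (snd k) * ev t u (foldr gt.D zs (foldr gt.D [Inl (fst k), Inr (snd k)] (Cst 1))))"
    using finS heat[OF t] by (intro gt.Ds_linear) (auto simp: case_prod_unfold)
  also have "\<dots> = (\<Sum>a\<in>S. \<Sum>b\<in>S. K a b * ev t u (foldr gt.D (zs @ [Inl a, Inr b]) (Cst 1)))"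
    by (simp add: sum.cartesian_product case_prod_unfold)
  also have "\<dots> = (\<Sum>a\<in>S. \<Sum>b\<in>S. K a b * ev t u (foldr gt.D (Inl a # Inr b # zs) (Cst 1)))"
    by (intro sum.cong refl arg_cong2[where f = times] gt.Ds_mset) simp
  finally show ?thesis
    unfolding gt.G_def by (simp add: sum_distrib_right mult.assoc)
qed

end


section \<open>Absolutely monotone functions\<close>

text \<open>A primitive is continuous and hence integrable on compact intervals, which carries the
  induction. T stays below 1 since nothing is assumed about h near 1.\<close>

lemma set_integrable_iterated_integral:
  assumes "\<And>T. 0 \<le> T \<Longrightarrow> T < 1 \<Longrightarrow> set_integrable lborel {0..T} h" "0 \<le> T" "T < 1"
  shows "set_integrable lborel {0..T} (iterated_integral j h)"
  using assms(2,3)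
proof (induction j arbitrary: T)
  case 0
  then show ?case using assms(1) by (simp add: eta_contract_eq[symmetric] cong: set_integrable_cong)
next
  case (Suc j)
  then have i: "set_integrable lborel {0..T} (iterated_integral j h)" by simp
  then have "iterated_integral j h integrable_on {0..T}"
    by (rule set_borel_integral_eq_integral)
  then have "continuous_on {0..T} (\<lambda>t. integral {0..t} (iterated_integral j h))"
    by (rule indefinite_integral_continuous_1)
  moreover have "integral {0..t} (iterated_integral j h) = iterated_integral (Suc j) h t" if "t \<in> {0..T}" for t
    using set_borel_integral_eq_integral(2)[OF set_integrable_subset[OF i]] that by auto
  ultimately have "continuous_on {0..T} (iterated_integral (Suc j) h)"
    by (rule continuous_on_cong[THEN iffD1, OF refl, rotated]) simp
  then show ?case
    by (rule borel_integrable_atLeastAtMost')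
qed

lemma iterated_integral_cong:
  assumes "\<And>t. 0 \<le> t \<Longrightarrow> t < 1 \<Longrightarrow> g t = h t" "0 \<le> t" "t < 1"
  shows "iterated_integral j g t = iterated_integral j h t"
  using assms(2,3)
proof (induction j arbitrary: t)
  case (Suc j)
  then show ?case by (simp, intro set_lebesgue_integral_cong) auto
qed (use assms(1) in simp)

text \<open>Holds for arbitrary functions: if one is measurable so is the other, and otherwise both
  integrals are 0 by convention.\<close>

lemma integral_eq_off_point:
  fixes f g :: "real \<Rightarrow> real"
  assumes "\<And>x. x \<noteq> a \<Longrightarrow> f x = g x"
  shows "integral\<^sup>L lborel f = integral\<^sup>L lborel g"
proof -
  have meas: "q \<in> borel_measurable lborel"
    if "p \<in> borel_measurable lborel" "\<And>x. x \<noteq> a \<Longrightarrow> p x = q x" for p q :: "real \<Rightarrow> real"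
  proof -
    have "(\<lambda>x. if x = a then q a else p x) \<in> borel_measurable lborel"
      using that(1) by measurable
    also have "(\<lambda>x. if x = a then q a else p x) = q" using that(2) by auto
    finally show ?thesis .
  qed
  show ?thesis
  proof (cases "f \<in> borel_measurable lborel")
    case True
    with meas[OF True] assms have "g \<in> borel_measurable lborel" by blast
    with True show ?thesis
      using AE_lborel_singleton[of a] assms by (intro integral_cong_AE) auto
  next
    case False
    with meas[of g f] assms have "g \<notin> borel_measurable lborel" by auto
    with False show ?thesis by (metis borel_measurable_integrable not_integrable_integral_eq)
  qed
qed

lemma set_integral_Icc_Ico:
  fixes q :: "real \<Rightarrow> real"
  shows "(LINT t:{a..b}|lborel. q t) = (LINT t:{a..<b}|lborel. q t)"
  unfolding set_lebesgue_integral_def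
  by (rule integral_eq_off_point[of b]) (auto simp: indicator_def)

text \<open>Intended for intensities that are identified for t < 1 only: the value 1 is met by the
  outermost variable alone, on a null set.\<close>

lemma iterated_integral_cong_1:
  assumes "\<And>t. 0 \<le> t \<Longrightarrow> t < 1 \<Longrightarrow> g t = h t"
  shows "iterated_integral (Suc j) g 1 = iterated_integral (Suc j) h 1"
  by (simp only: iterated_integral.simps set_integral_Icc_Ico)
    (intro set_lebesgue_integral_cong, auto intro: iterated_integral_cong[OF assms])

lemma iterated_integral_bound:
  assumes h: "\<And>T. 0 \<le> T \<Longrightarrow> T < 1 \<Longrightarrow> set_integrable lborel {0..T} h"
    and g: "\<And>T. 0 \<le> T \<Longrightarrow> T < 1 \<Longrightarrow> set_integrable lborel {0..T} g"
    and le: "\<And>t. 0 \<le> t \<Longrightarrow> t < 1 \<Longrightarrow> \<bar>h t\<bar> \<le> C * g t" and t: "0 \<le> t" "t < 1"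
  shows "\<bar>iterated_integral j h t\<bar> \<le> C * iterated_integral j g t"
  using t
proof (induction j arbitrary: t)
  case 0
  then show ?case using le by simp
next
  case (Suc j)
  note ih = set_integrable_iterated_integral[OF h Suc.prems, where j = j]
    and ig = set_integrable_iterated_integral[OF g Suc.prems, where j = j]
  have "\<bar>LINT s:{0..t}|lborel. iterated_integral j h s\<bar> \<le> (LINT s:{0..t}|lborel. \<bar>iterated_integral j h s\<bar>)"
    using set_integral_norm_bound[OF ih] by simp
  also have "\<dots> \<le> (LINT s:{0..t}|lborel. C * iterated_integral j g s)"
    by (rule set_integral_mono) (use ih ig Suc in \<open>auto intro: set_integrable_abs\<close>)
  finally show ?case by simp
qed

lemma set_integral_finite_sum:
  fixes h :: "'b \<Rightarrow> 'a \<Rightarrow> real"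
  assumes "\<And>a. a \<in> A \<Longrightarrow> set_integrable M X (h a)"
  shows "(LINT x:X|M. (\<Sum>a\<in>A. h a x)) = (\<Sum>a\<in>A. LINT x:X|M. h a x)"
  using assms unfolding set_lebesgue_integral_def set_integrable_def scaleR_sum_right
  by (intro Bochner_Integration.integral_sum) auto

lemma iterated_integral_lincomb:
  assumes A: "finite A"
    and h: "\<And>a T. a \<in> A \<Longrightarrow> 0 \<le> T \<Longrightarrow> T < 1 \<Longrightarrow> set_integrable lborel {0..T} (h a)"
    and t: "0 \<le> t" "t < 1"
  shows "iterated_integral j (\<lambda>t. \<Sum>a\<in>A. w a * h a t) t = (\<Sum>a\<in>A. w a * iterated_integral j (h a) t)"
  using t
proof (induction j arbitrary: t)
  case (Suc j)
  have i: "set_integrable lborel {0..t} (\<lambda>s. w a * iterated_integral j (h a) s)" if "a \<in> A" for a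
    using set_integrable_iterated_integral[OF h Suc.prems, where j = j] that by simp
  have "(LINT s:{0..t}|lborel. iterated_integral j (\<lambda>t. \<Sum>a\<in>A. w a * h a t) s)
      = (LINT s:{0..t}|lborel. (\<Sum>a\<in>A. w a * iterated_integral j (h a) s))"
    using Suc by (intro set_lebesgue_integral_cong) auto
  also have "\<dots> = (\<Sum>a\<in>A. LINT s:{0..t}|lborel. w a * iterated_integral j (h a) s)"
    by (rule set_integral_finite_sum) (rule i)
  finally show ?case by simp
qed simp

section \<open>Taylor remainders and Bernstein's theorem\<close>

text \<open>
  The hypotheses say that \<open>f 0\<close> is absolutely monotone on \<open>[0, 1)\<close> with derivatives \<open>f m\<close> and
  left limit \<open>E\<close> at 1. That its Taylor series at 0 sums to \<open>E\<close> is Bernstein's theorem.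
\<close>

locale abs_monotone =
  fixes f :: "nat \<Rightarrow> real \<Rightarrow> real" and E :: real
  assumes nonneg: "\<And>m t. 0 \<le> t \<Longrightarrow> t < 1 \<Longrightarrow> 0 \<le> f m t"
    and integ: "\<And>m t. 0 \<le> t \<Longrightarrow> t < 1 \<Longrightarrow> set_integrable lborel {0..t} (f m)"
    and ftc: "\<And>m t. 0 \<le> t \<Longrightarrow> t < 1 \<Longrightarrow> f m t = f m 0 + (LINT s:{0..t}|lborel. f (Suc m) s)"
    and limit: "(\<lambda>k. f 0 (1 - 1 / real (Suc k))) \<longlonglongrightarrow> E"
begin

lemma set_integral_monom:
  "0 \<le> (t::real) \<Longrightarrow> (LINT s:{0..t}|lborel. c * s ^ i / fact i) = c * t ^ Suc i / fact (Suc i)"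
proof -
  assume t: "0 \<le> t"
  have "(LINT s:{0..t}|lborel. c * s ^ i / fact i) = (LINT s|lborel. c / fact i * (s ^ i * indicator {0..t} s))"
    unfolding set_lebesgue_integral_def by (intro Bochner_Integration.integral_cong) auto
  also have "\<dots> = c / fact i * ((t ^ Suc i - 0 ^ Suc i) / Suc i)"
    using integral_power[OF t, of i] by simp
  finally show ?thesis by simp
qed

text \<open>Integrating the derivative of order k + j back j times removes one Taylor term per
  integration. k varies in the induction because the step passes to the next derivative.\<close>

lemma taylor:
  assumes "0 \<le> t" "t < 1"
  shows "iterated_integral j (f (k + j)) t = f k t - (\<Sum>i<j. f (k + i) 0 * t ^ i / fact i)"
  using assms
proof (induction j arbitrary: k t)
  case (Suc j)
  have i: "set_integrable lborel {0..t} (\<lambda>s. f (Suc k + i) 0 * s ^ i / fact i)" for i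
    by (intro borel_integrable_atLeastAtMost' continuous_intros) auto
  have "iterated_integral (Suc j) (f (k + Suc j)) t
      = (LINT s:{0..t}|lborel. f (Suc k) s - (\<Sum>i<j. f (Suc k + i) 0 * s ^ i / fact i))"
    using Suc.IH[of _ "Suc k"] Suc.prems by (simp, intro set_lebesgue_integral_cong) auto
  also have "\<dots> = (LINT s:{0..t}|lborel. f (Suc k) s) - (LINT s:{0..t}|lborel. (\<Sum>i<j. f (Suc k + i) 0 * s ^ i / fact i))"
    by (rule set_integral_diff(2)) (use integ[OF Suc.prems] in \<open>auto intro!: borel_integrable_atLeastAtMost' continuous_intros\<close>)
  also have "(LINT s:{0..t}|lborel. (\<Sum>i<j. f (Suc k + i) 0 * s ^ i / fact i))
      = (\<Sum>i<j. LINT s:{0..t}|lborel. f (Suc k + i) 0 * s ^ i / fact i)"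
    by (rule set_integral_finite_sum) (rule i)
  also have "\<dots> = (\<Sum>i<j. f (k + Suc i) 0 * t ^ Suc i / fact (Suc i))"
    using Suc.prems by (intro sum.cong refl) (simp only: set_integral_monom add_Suc add_Suc_right)
  also have "(LINT s:{0..t}|lborel. f (Suc k) s) = f k t - f k 0"
    using ftc[OF Suc.prems, of k] by simp
  finally show ?case
    by (subst sum.lessThan_Suc_shift) simp
qed simp

lemma mono: "0 \<le> t \<Longrightarrow> t \<le> s \<Longrightarrow> s < 1 \<Longrightarrow> f m t \<le> f m s"
proof -
  assume ts: "0 \<le> t" "t \<le> s" "s < 1"
  have "(LINT x:{0..t}|lborel. f (Suc m) x) \<le> (LINT x:{0..s}|lborel. f (Suc m) x)"
    unfolding set_lebesgue_integral_def
  proof (rule integral_mono)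
    show "integrable lborel (\<lambda>x. indicator {0..t} x *\<^sub>R f (Suc m) x)"
      "integrable lborel (\<lambda>x. indicator {0..s} x *\<^sub>R f (Suc m) x)"
      using integ[of t "Suc m"] integ[of s "Suc m"] ts by (auto simp: set_integrable_def)
  qed (use ts nonneg in \<open>auto simp: indicator_def\<close>)
  then show ?thesis using ftc[of t m] ftc[of s m] ts by simp
qed

lemma iterated_nonneg: "0 \<le> t \<Longrightarrow> t < 1 \<Longrightarrow> 0 \<le> iterated_integral j (f m) t"
  using iterated_integral_bound[of "\<lambda>_. 0" "f m" 1 t j] integ nonneg by (fastforce simp: set_integrable_def)

text \<open>The heart of Bernstein's theorem. The function f m is increasing, so contracting the
  argument by t / s decreases it, and each of the j integrations contributes a further factor t / s
  by substitution.\<close>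

lemma iterated_scaling:
  assumes "0 < t" "t \<le> s" "s < 1"
  shows "iterated_integral j (f m) t \<le> (t / s) ^ j * iterated_integral j (f m) s"
  using assms
proof (induction j arbitrary: t s)
  case 0
  then show ?case using mono by simp
next
  case (Suc j)
  let ?g = "iterated_integral j (f m)" and ?c = "t / s"
  have c: "0 < ?c" "?c \<le> 1" using Suc.prems by auto
  have i_s: "set_integrable lborel {0..s} ?g"
    using Suc.prems integ by (intro set_integrable_iterated_integral) auto
  have it: "set_integrable lborel {0..t} ?g"
    using Suc.prems integ by (intro set_integrable_iterated_integral) auto
  have ind: "indicator {0..t} (0 + ?c * x) = (indicator {0..s} x :: real)" for x
    using Suc.prems by (auto simp: indicator_def field_simps zero_le_mult_iff)
  have it': "integrable lborel (\<lambda>x. indicator {0..s} x *\<^sub>R ?g (?c * x))"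
    using lborel_integrable_real_affine[OF it[unfolded set_integrable_def], of ?c 0] c Suc.prems unfolding ind by simp
  have "iterated_integral (Suc j) (f m) t = (LINT x|lborel. indicator {0..t} x *\<^sub>R ?g x)"
    by (simp add: set_lebesgue_integral_def)
  also have "\<dots> = ?c * (LINT x|lborel. indicator {0..s} x *\<^sub>R ?g (?c * x))"
    using lborel_integral_real_affine[of ?c "\<lambda>x. indicator {0..t} x *\<^sub>R ?g x" 0] c Suc.prems unfolding ind by simp
  finally have 1: "iterated_integral (Suc j) (f m) t = ?c * (LINT x|lborel. indicator {0..s} x *\<^sub>R ?g (?c * x))" .
  have "(LINT x|lborel. indicator {0..s} x *\<^sub>R ?g (?c * x))
      \<le> (LINT x|lborel. ?c ^ j * (indicator {0..s} x *\<^sub>R ?g x))"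
  proof (rule integral_mono_AE[OF it'])
    show "integrable lborel (\<lambda>x. ?c ^ j * (indicator {0..s} x *\<^sub>R ?g x))"
      using i_s by (simp add: set_integrable_def)
    have "indicator {0..s} x *\<^sub>R ?g (?c * x) \<le> ?c ^ j * (indicator {0..s} x *\<^sub>R ?g x)" if "x \<noteq> 0" for x
    proof (cases "x \<in> {0..s}")
      case True
      with that have "0 < ?c * x" "?c * x \<le> x" "x < 1" "?c * x / x = ?c"
        using c Suc.prems mult_right_mono[of ?c 1 x] by auto
      with Suc.IH[of "?c * x" x] True show ?thesis by simp
    qed simp
    then show "AE x in lborel. indicator {0..s} x *\<^sub>R ?g (?c * x) \<le> ?c ^ j * (indicator {0..s} x *\<^sub>R ?g x)"
      using AE_lborel_singleton[of 0] by (auto elim: eventually_mono)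
  qed
  also have "(LINT x|lborel. ?c ^ j * (indicator {0..s} x *\<^sub>R ?g x)) = ?c ^ j * iterated_integral (Suc j) (f m) s"
    by (simp add: set_lebesgue_integral_def)
  finally have "?c * (LINT x|lborel. indicator {0..s} x *\<^sub>R ?g (?c * x))
      \<le> ?c * (?c ^ j * iterated_integral (Suc j) (f m) s)"
    by (rule mult_left_mono) (use c in simp)
  then show ?case unfolding 1 by (simp only: power_Suc mult.assoc)
qed

definition a :: "nat \<Rightarrow> real" where "a k = f k 0 / fact k"

lemma a_nonneg: "0 \<le> a k"
  using nonneg[of 0 k] by (simp add: a_def)

lemma le_E: "0 \<le> t \<Longrightarrow> t < 1 \<Longrightarrow> f 0 t \<le> E"
proof (rule tendsto_lowerbound[OF limit])
  assume t: "0 \<le> t" "t < 1"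
  have "(\<lambda>k. 1 - 1 / real (Suc k)) \<longlonglongrightarrow> 1 - 0"
    by (intro tendsto_diff tendsto_const LIMSEQ_Suc lim_1_over_n)
  then have "\<forall>\<^sub>F k in sequentially. t < 1 - 1 / real (Suc k)"
    using t by (intro order_tendstoD) auto
  then show "\<forall>\<^sub>F k in sequentially. f 0 t \<le> f 0 (1 - 1 / real (Suc k))"
    by eventually_elim (use t in \<open>auto intro!: mono\<close>)
qed simp

lemma partial_sum: "0 \<le> t \<Longrightarrow> t < 1 \<Longrightarrow> (\<Sum>i<n. a i * t ^ i) = f 0 t - iterated_integral n (f n) t"
  using taylor[of t n 0] by (simp add: a_def)

text \<open>Nonnegative remainders bound every partial sum by E, on letting t tend to 1. Conversely
  the remainder at a fixed t tends to 0, by comparison with a larger point s at which it is at most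
  E.\<close>

lemma sums_E: "(\<lambda>n. \<Sum>k<n. a k) \<longlonglongrightarrow> E"
proof -
  have upper: "(\<Sum>k<n. a k) \<le> E" for n
  proof (rule tendsto_upperbound)
    show "((\<lambda>t. \<Sum>k<n. a k * t ^ k) \<longlongrightarrow> (\<Sum>k<n. a k)) (at_left 1)"
      by (auto intro!: tendsto_eq_intros)
    have "\<forall>\<^sub>F t in at_left (1::real). t \<in> {0<..<1}"
      by (rule eventually_at_left_real) simp
    then show "\<forall>\<^sub>F t in at_left 1. (\<Sum>k<n. a k * t ^ k) \<le> E"
    proof eventually_elim
      case (elim t)
      then show ?case using partial_sum[of t n] iterated_nonneg[of t n n] le_E[of t] by simp
    qed
  qed simp
  have "summable a"
    by (rule summableI_nonneg_bounded[of _ E]) (use a_nonneg upper in auto)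
  then have conv: "(\<lambda>n. \<Sum>k<n. a k) \<longlonglongrightarrow> suminf a" by (rule summable_LIMSEQ)
  have "suminf a \<le> E"
    by (rule LIMSEQ_le_const2[OF conv]) (use upper in blast)
  moreover have "f 0 t \<le> suminf a" if t: "0 < t" "t < 1" for t
  proof -
    \<comment> \<open>Any point strictly between t and 1 makes (t / s)^n tend to 0.\<close>
    define s where "s = (1 + t) / 2"
    have s: "t < s" "s < 1" using t by (auto simp: s_def)
    have "f 0 t \<le> suminf a + (t / s) ^ n * E" for n
    proof -
      have "f 0 t = (\<Sum>i<n. a i * t ^ i) + iterated_integral n (f n) t"
        using partial_sum[of t n] t by simp
      also have "(\<Sum>i<n. a i * t ^ i) \<le> (\<Sum>i<n. a i)"
        using t a_nonneg by (intro sum_mono mult_left_le) (auto intro: power_le_one)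
      also have "(\<Sum>i<n. a i) \<le> suminf a"
        using \<open>summable a\<close> a_nonneg by (intro sum_le_suminf) auto
      also have "iterated_integral n (f n) t \<le> (t / s) ^ n * iterated_integral n (f n) s"
        using t s by (intro iterated_scaling) auto
      also have "(t / s) ^ n * iterated_integral n (f n) s \<le> (t / s) ^ n * E"
      proof (intro mult_left_mono)
        have "0 \<le> (\<Sum>i<n. a i * s ^ i)" using t s a_nonneg by (intro sum_nonneg) auto
        then show "iterated_integral n (f n) s \<le> E"
          using partial_sum[of s n] le_E[of s] t s by simp
      qed (use t s in auto)
      finally show ?thesis by simp
    qed
    moreover have "(\<lambda>n. suminf a + (t / s) ^ n * E) \<longlonglongrightarrow> suminf a + 0 * E"
      using t s by (intro tendsto_intros LIMSEQ_realpow_zero) auto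
    ultimately have "f 0 t \<le> suminf a + 0 * E"
      by (intro LIMSEQ_le_const[of "\<lambda>n. suminf a + (t / s) ^ n * E"]) auto
    then show ?thesis by simp
  qed
  then have "E \<le> suminf a"
    by (intro LIMSEQ_le_const2[OF limit] exI[of _ 1]) auto
  ultimately show ?thesis using conv by simp
qed

text \<open>\<open>taylor\<close> gives the value for every endpoint below 1. The integrand is
  nonnegative, so monotone convergence along 1 - 1 / (k + 1) reaches 1 and yields integrability as
  well.\<close>

lemma integral_to_1:
  shows "set_integrable lborel {0..<1} (iterated_integral m (f (Suc m)))"
    and "iterated_integral (Suc m) (f (Suc m)) 1 = E - (\<Sum>k<Suc m. a k)"
proof -
  let ?g = "iterated_integral m (f (Suc m))"
  define X where "X k = 1 - 1 / real (Suc k)" for k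
  have X: "0 \<le> X k" "X k < 1" for k by (auto simp: X_def)
  have Xlim: "X \<longlonglongrightarrow> 1 - 0"
    unfolding X_def[abs_def] by (intro tendsto_diff tendsto_const LIMSEQ_Suc lim_1_over_n)
  have Xmono: "X i \<le> X j" if "i \<le> j" for i j
    using that by (simp add: X_def frac_le)
  have iX: "integrable lborel (\<lambda>t. indicator {0..X k} t *\<^sub>R ?g t)" for k
    using set_integrable_iterated_integral[of "f (Suc m)", OF integ X] unfolding set_integrable_def .
  have lim_ind: "(\<lambda>k. indicator {0..X k} t *\<^sub>R ?g t) \<longlonglongrightarrow> indicator {0..<1} t *\<^sub>R ?g t" for t
  proof (cases "t < 1")
    case True
    then have "\<forall>\<^sub>F k in sequentially. t < X k"
      using Xlim by (intro order_tendstoD) auto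
    then have "\<forall>\<^sub>F k in sequentially. indicator {0..X k} t *\<^sub>R ?g t = indicator {0..<1} t *\<^sub>R ?g t"
      by eventually_elim (use True in \<open>auto simp: indicator_def\<close>)
    then show ?thesis by (rule tendsto_eventually)
  next
    case False
    have "indicator {0..X k} t = (0::real)" for k
      using X(2)[of k] False by (auto simp: indicator_def)
    then show ?thesis using False by (simp add: indicator_def)
  qed
  have vals: "(LINT t|lborel. indicator {0..X k} t *\<^sub>R ?g t) = f 0 (X k) - (\<Sum>i<Suc m. a i * X k ^ i)" for k
    using partial_sum[OF X, of k "Suc m"] by (simp add: set_lebesgue_integral_def)
  have lim: "(\<lambda>k. LINT t|lborel. indicator {0..X k} t *\<^sub>R ?g t) \<longlonglongrightarrow> E - (\<Sum>i<Suc m. a i * (1 - 0) ^ i)"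
    unfolding vals using limit[folded X_def] Xlim by (intro tendsto_intros)
  have AEm: "AE t in lborel. mono (\<lambda>k. indicator {0..X k} t *\<^sub>R ?g t)"
  proof (intro AE_I2 monoI)
    fix t i j assume "i \<le> (j::nat)"
    have "0 \<le> ?g t" if "0 \<le> t" "t \<le> X j" using iterated_nonneg[of t] that X(2)[of j] by simp
    then show "indicator {0..X i} t *\<^sub>R ?g t \<le> indicator {0..X j} t *\<^sub>R ?g t"
      using Xmono[OF \<open>i \<le> j\<close>] by (auto simp: indicator_def)
  qed
  have um: "(\<lambda>t. indicator {0..<1} t *\<^sub>R ?g t) \<in> borel_measurable lborel"
    by (rule borel_measurable_LIMSEQ_real[OF lim_ind]) (use iX in blast)
  note mc = iX AEm AE_I2[OF lim_ind] lim um
  show 1: "set_integrable lborel {0..<1} ?g"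
    unfolding set_integrable_def by (rule integrable_monotone_convergence[OF mc])
  have "iterated_integral (Suc m) (f (Suc m)) 1 = (LINT t:{0..<1}|lborel. ?g t)"
    by (simp add: set_integral_Icc_Ico)
  also have "\<dots> = E - (\<Sum>i<Suc m. a i * (1 - 0) ^ i)"
    unfolding set_lebesgue_integral_def by (rule integral_monotone_convergence[OF mc])
  finally show "iterated_integral (Suc m) (f (Suc m)) 1 = E - (\<Sum>k<Suc m. a k)" by simp
qed

text \<open>The domination is what makes the separate summands integrable up to 1; only then may the
  finite sum be pulled through the outermost integral.\<close>

lemma lincomb_to_1:
  assumes A: "finite A"
    and h: "\<And>b T. b \<in> A \<Longrightarrow> 0 \<le> T \<Longrightarrow> T < 1 \<Longrightarrow> set_integrable lborel {0..T} (h b)"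
    and le: "\<And>b t. b \<in> A \<Longrightarrow> 0 \<le> t \<Longrightarrow> t < 1 \<Longrightarrow> \<bar>h b t\<bar> \<le> C * f (Suc m) t"
    and sum: "\<And>t. 0 \<le> t \<Longrightarrow> t < 1 \<Longrightarrow> f (Suc m) t = (\<Sum>b\<in>A. w b * h b t)"
  shows "(\<Sum>b\<in>A. w b * iterated_integral (Suc m) (h b) 1) = E - (\<Sum>k<Suc m. a k)"
proof -
  have int: "set_integrable lborel {0..<1} (iterated_integral m (h b))" if b: "b \<in> A" for b
    unfolding set_integrable_def
  proof (rule Bochner_Integration.integrable_bound)
    show "integrable lborel (\<lambda>t. C * (indicator {0..<1} t *\<^sub>R iterated_integral m (f (Suc m)) t))"
      using integral_to_1(1)[of m] by (simp add: set_integrable_def)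
    define X where "X k = 1 - 1 / real (Suc k)" for k
    have X: "0 \<le> X k" "X k < 1" for k by (auto simp: X_def)
    have Xlim: "X \<longlonglongrightarrow> 1 - 0"
      unfolding X_def[abs_def] by (intro tendsto_diff tendsto_const LIMSEQ_Suc lim_1_over_n)
    have "(\<lambda>k. indicator {0..X k} t *\<^sub>R iterated_integral m (h b) t) \<longlonglongrightarrow> indicator {0..<1} t *\<^sub>R iterated_integral m (h b) t" for t
    proof (cases "t < 1")
      case True
      then have "\<forall>\<^sub>F k in sequentially. t < X k"
        using Xlim by (intro order_tendstoD) auto
      then have "\<forall>\<^sub>F k in sequentially. indicator {0..X k} t *\<^sub>R iterated_integral m (h b) t = indicator {0..<1} t *\<^sub>R iterated_integral m (h b) t"
        by eventually_elim (use True in \<open>auto simp: indicator_def\<close>)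
      then show ?thesis by (rule tendsto_eventually)
    next
      case False
      have "indicator {0..X k} t = (0::real)" for k
        using X(2)[of k] False by (auto simp: indicator_def)
      then show ?thesis using False by (simp add: indicator_def)
    qed
    moreover have "(\<lambda>t. indicator {0..X k} t *\<^sub>R iterated_integral m (h b) t) \<in> borel_measurable lborel" for k
      using set_integrable_iterated_integral[OF h[OF b] X, where j = m] unfolding set_integrable_def
      by (rule borel_measurable_integrable)
    ultimately show "(\<lambda>t. indicator {0..<1} t *\<^sub>R iterated_integral m (h b) t) \<in> borel_measurable lborel"
      by (rule borel_measurable_LIMSEQ_real)
    show "AE t in lborel. norm (indicator {0..<1} t *\<^sub>R iterated_integral m (h b) t)
        \<le> norm (C * (indicator {0..<1} t *\<^sub>R iterated_integral m (f (Suc m)) t))"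
    proof (rule AE_I2)
      fix t
      show "norm (indicator {0..<1} t *\<^sub>R iterated_integral m (h b) t)
        \<le> norm (C * (indicator {0..<1} t *\<^sub>R iterated_integral m (f (Suc m)) t))"
        using iterated_integral_bound[OF h[OF b] integ le[OF b], of t m]
        by (cases "t \<in> {0..<1}") auto
    qed
  qed
  have "(\<Sum>b\<in>A. w b * iterated_integral (Suc m) (h b) 1)
      = (\<Sum>b\<in>A. LINT t:{0..<1}|lborel. w b * iterated_integral m (h b) t)"
    by (simp add: set_integral_Icc_Ico)
  also have "\<dots> = (LINT t:{0..<1}|lborel. (\<Sum>b\<in>A. w b * iterated_integral m (h b) t))"
    using int by (intro set_integral_finite_sum[symmetric]) auto
  also have "\<dots> = (LINT t:{0..<1}|lborel. iterated_integral m (f (Suc m)) t)"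
  proof (rule set_lebesgue_integral_cong)
    show "\<forall>t. t \<in> {0..<1} \<longrightarrow> (\<Sum>b\<in>A. w b * iterated_integral m (h b) t) = iterated_integral m (f (Suc m)) t"
    proof (intro allI impI)
      fix t :: real assume t: "t \<in> {0..<1}"
      have "iterated_integral m (f (Suc m)) t = iterated_integral m (\<lambda>t. \<Sum>b\<in>A. w b * h b t) t"
        using t sum by (intro iterated_integral_cong) auto
      also have "\<dots> = (\<Sum>b\<in>A. w b * iterated_integral m (h b) t)"
        using t by (intro iterated_integral_lincomb A h) auto
      finally show "(\<Sum>b\<in>A. w b * iterated_integral m (h b) t) = iterated_integral m (f (Suc m)) t" ..
    qed
  qed simp
  also have "\<dots> = iterated_integral (Suc m) (f (Suc m)) 1"
    by (simp add: set_integral_Icc_Ico)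
  finally show ?thesis by (simp only: integral_to_1(2))
qed

end


section \<open>Tensor powers of the covariance\<close>

context gauss
begin

text \<open>The Gaussian bound is uniform on [0, t], so Fubini applies on the product of that
  interval with the coordinate space, and the time derivative is integrated pointwise in u.\<close>

lemma G_time:
  fixes \<Theta> :: "'i set \<Rightarrow> real"
  assumes e: "vars e \<subseteq> I" and t: "0 \<le> t" "t < 1"
  shows "set_integrable lborel {0..t} (\<lambda>s. LINT u|leb I. \<Theta> (excursion_set I l u) * G e s u)"
    and "(LINT u|leb I. \<Theta> (excursion_set I l u) * G e t u) = (LINT u|leb I. \<Theta> (excursion_set I l u) * G e 0 u)
      + (LINT s:{0..t}|lborel. LINT u|leb I. \<Theta> (excursion_set I l u) * G (DT e) s u)"
proof -
  interpret sf: sigma_finite_measure "leb I" by (rule sigma_finite_leb[OF fin])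
  interpret P: pair_sigma_finite "leb I" lborel ..
  interpret P': pair_sigma_finite lborel "leb I" ..
  let ?f = "\<lambda>e u s. indicator {0..t} s * (\<Theta> (excursion_set I l u) * G e s u)"
  have int: "integrable (lborel \<Otimes>\<^sub>M leb I) (\<lambda>(s, u). ?f e u s)" if e: "vars e \<subseteq> I" for e
  proof -
    obtain C where C: "C \<ge> 0" "\<And>s u. s \<in> {0..t} \<Longrightarrow> \<bar>G e s u\<bar> \<le> C * exp (- (c / 2) * (\<Sum>i\<in>I. (u i)\<^sup>2))"
      using G_bound[OF e t(2)] by auto
    obtain A where A: "A \<ge> 0" "\<And>u. \<bar>\<Theta> (excursion_set I l u)\<bar> \<le> A"
      using excursion_bounded[OF fin, of \<Theta> l] by auto
    let ?h = "\<lambda>u. A * (C * exp (- (c / 2) * (\<Sum>i\<in>I. (u i)\<^sup>2)))"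
    have h: "integrable (leb I) ?h"
      using c_pos fin by (intro integrable_mult_right integrable_leb_gauss) auto
    have bnd: "\<bar>?f e u s\<bar> \<le> indicator {0..t} s * ?h u" for s u
    proof (cases "s \<in> {0..t}")
      case True
      have "\<bar>\<Theta> (excursion_set I l u)\<bar> * \<bar>G e s u\<bar> \<le> ?h u"
        using A(1) by (intro mult_mono A(2) C(2)[OF True]) auto
      then show ?thesis using True by (simp add: abs_mult)
    qed simp
    have coord: "(\<lambda>p. snd p i) \<in> borel_measurable (lborel \<Otimes>\<^sub>M leb I)" if "i \<in> I" for i
      using measurable_compose[OF measurable_snd measurable_coord[OF that]] .
    have meas: "(\<lambda>(s, u). ?f e u s) \<in> borel_measurable (lborel \<Otimes>\<^sub>M leb I)"
    proof -
      have "(\<lambda>p. \<Theta> (excursion_set I l (snd p))) \<in> borel_measurable (lborel \<Otimes>\<^sub>M leb I)"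
        by (rule excursion_measurable[OF fin coord])
      \<comment> \<open>Times outside [0, t] are sent to 0, because joint measurability is available
        for times in (-1, 1) only; the indicator factor hides the change.\<close>
      moreover have "(\<lambda>p. G e (if fst p \<in> {0..t} then fst p else 0) (snd p)) \<in> borel_measurable (lborel \<Otimes>\<^sub>M leb I)"
      proof (rule G_measurable_pair[OF e])
        show "(\<lambda>p. if fst p \<in> {0..t} then fst p else 0) \<in> borel_measurable (lborel \<Otimes>\<^sub>M leb I)"
          by measurable
      qed (use t coord in auto)
      moreover have "(\<lambda>p. indicator {0..t} (fst p) :: real) \<in> borel_measurable (lborel \<Otimes>\<^sub>M leb I)"
        by measurable
      ultimately have "(\<lambda>p. indicator {0..t} (fst p) * (\<Theta> (excursion_set I l (snd p))
          * G e (if fst p \<in> {0..t} then fst p else 0) (snd p))) \<in> borel_measurable (lborel \<Otimes>\<^sub>M leb I)"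
        by (intro borel_measurable_times)
      also have "(\<lambda>p. indicator {0..t} (fst p) * (\<Theta> (excursion_set I l (snd p))
          * G e (if fst p \<in> {0..t} then fst p else 0) (snd p))) = (\<lambda>(s, u). ?f e u s)"
        by (auto simp: indicator_def fun_eq_iff)
      finally show ?thesis .
    qed
    show ?thesis
    proof (rule P'.Fubini_integrable[OF meas])
      have sec: "integrable (leb I) (\<lambda>u. ?f e u s)" for s
      proof (rule Bochner_Integration.integrable_bound[OF h])
        show "(\<lambda>u. ?f e u s) \<in> borel_measurable (leb I)"
          using measurable_compose[OF measurable_Pair1' meas, of s] by simp
        show "AE u in leb I. norm (?f e u s) \<le> norm (?h u)"
        proof (rule AE_I2)
          fix u
          have "indicator {0..t} s * ?h u \<le> ?h u" "0 \<le> ?h u"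
            using A(1) C(1) by (auto simp: indicator_def)
          then show "norm (?f e u s) \<le> norm (?h u)" using bnd[of s u] by simp
        qed
      qed
      then show "AE s in lborel. integrable (leb I) (\<lambda>u. case (s, u) of (s, u) \<Rightarrow> ?f e u s)" by simp
      show "integrable lborel (\<lambda>s. LINT u|leb I. norm (case (s, u) of (s, u) \<Rightarrow> ?f e u s))"
      proof (rule Bochner_Integration.integrable_bound)
        show "integrable lborel (\<lambda>s. indicator {0..t} s * integral\<^sup>L (leb I) ?h)"
          using emeasure_lborel_Icc[OF t(1)] by (intro integrable_mult_left integrable_real_indicator) auto
        show "(\<lambda>s. LINT u|leb I. norm (case (s, u) of (s, u) \<Rightarrow> ?f e u s)) \<in> borel_measurable lborel"
          using meas by (intro sf.borel_measurable_lebesgue_integral) (simp add: case_prod_unfold)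
        show "AE s in lborel. norm (LINT u|leb I. norm (case (s, u) of (s, u) \<Rightarrow> ?f e u s))
            \<le> norm (indicator {0..t} s * integral\<^sup>L (leb I) ?h)"
        proof (rule AE_I2)
          fix s
          have "(LINT u|leb I. norm (?f e u s)) \<le> (LINT u|leb I. indicator {0..t} s * ?h u)"
            using sec[of s] h bnd by (intro integral_mono) auto
          then have "(LINT u|leb I. norm (?f e u s)) \<le> indicator {0..t} s * integral\<^sup>L (leb I) ?h"
            by simp
          moreover have "0 \<le> (LINT u|leb I. norm (?f e u s))" by (intro integral_nonneg_AE AE_I2) simp
          ultimately show "norm (LINT u|leb I. norm (case (s, u) of (s, u) \<Rightarrow> ?f e u s))
            \<le> norm (indicator {0..t} s * integral\<^sup>L (leb I) ?h)" by simp
        qed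
      qed
    qed
  qed
  have inner: "(LINT u|leb I. ?f e u s) = indicator {0..t} s *\<^sub>R (LINT u|leb I. \<Theta> (excursion_set I l u) * G e s u)" for e s
    by simp
  show "set_integrable lborel {0..t} (\<lambda>s. LINT u|leb I. \<Theta> (excursion_set I l u) * G e s u)"
    using P'.integrable_fst'[OF int[OF e]] unfolding set_integrable_def by simp
  have DT: "vars (DT e) \<subseteq> I" using e by (rule vars_DT)
  have ftc: "(LINT s|lborel. ?f (DT e) u s) = \<Theta> (excursion_set I l u) * (G e t u - G e 0 u)" for u
  proof -
    have d: "((\<lambda>s. G e s u) has_real_derivative G (DT e) s u) (at s)" "isCont (\<lambda>s. G (DT e) s u) s"
      if "s \<in> {0..t}" for s
      using that t G_DT[of s e u] DERIV_isCont[OF G_DT[of s "DT e" u]] by auto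
    have "(LINT s|lborel. indicator {0..t} s *\<^sub>R G (DT e) s u) = G e t u - G e 0 u"
    proof (rule integral_FTC_atLeastAtMost[OF t(1)])
      fix s assume "0 \<le> s" "s \<le> t"
      then show "((\<lambda>s. G e s u) has_vector_derivative G (DT e) s u) (at s within {0..t})"
        using d(1)[of s] by (auto simp: has_real_derivative_iff_has_vector_derivative
            intro: has_vector_derivative_at_within)
    next
      show "continuous_on {0..t} (\<lambda>s. G (DT e) s u)"
        using d(2) by (intro continuous_at_imp_continuous_on) auto
    qed
    moreover have "(\<lambda>s. ?f (DT e) u s) = (\<lambda>s. \<Theta> (excursion_set I l u) * (indicator {0..t} s *\<^sub>R G (DT e) s u))"
      by auto
    ultimately show ?thesis by simp
  qed
  have "(LINT s:{0..t}|lborel. LINT u|leb I. \<Theta> (excursion_set I l u) * G (DT e) s u)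
      = (LINT s|lborel. LINT u|leb I. ?f (DT e) u s)"
    unfolding set_lebesgue_integral_def by simp
  also have "\<dots> = (LINT u|leb I. LINT s|lborel. ?f (DT e) u s)"
    using P'.Fubini_integral[OF int[OF DT]] by simp
  also have "\<dots> = (LINT u|leb I. \<Theta> (excursion_set I l u) * G e t u - \<Theta> (excursion_set I l u) * G e 0 u)"
    by (simp add: ftc right_diff_distrib)
  also have "\<dots> = (LINT u|leb I. \<Theta> (excursion_set I l u) * G e t u) - (LINT u|leb I. \<Theta> (excursion_set I l u) * G e 0 u)"
    using t by (intro Bochner_Integration.integral_diff integrable_G e) auto
  finally show "(LINT u|leb I. \<Theta> (excursion_set I l u) * G e t u) = (LINT u|leb I. \<Theta> (excursion_set I l u) * G e 0 u)
      + (LINT s:{0..t}|lborel. LINT u|leb I. \<Theta> (excursion_set I l u) * G (DT e) s u)" by simp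
qed

end

section \<open>Contraction with tensor powers of K\<close>

context gcov
begin

text \<open>Contraction of g with the m-th tensor power of K. The recursion peels off one index
  pair, as the heat equation adds one; \<open>tens_eq\<close> gives the closed form.\<close>

fun tens :: "nat \<Rightarrow> ('i list \<Rightarrow> 'i list \<Rightarrow> real) \<Rightarrow> real" where
  "tens 0 g = g [] []"
| "tens (Suc m) g = (\<Sum>a\<in>S. \<Sum>b\<in>S. K a b * tens m (\<lambda>x y. g (a # x) (b # y)))"

definition lists_of :: "nat \<Rightarrow> 'i list set" where
  "lists_of m = {xs. set xs \<subseteq> S \<and> length xs = m}"

lemma finite_lists_of: "finite (lists_of m)"
  using finite_lists_length_eq[OF finS] by (simp add: lists_of_def)

lemma lists_of_0: "lists_of 0 = {[]}"
  by (auto simp: lists_of_def)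

lemma sum_lists_of_Suc: "(\<Sum>x\<in>lists_of (Suc m). h x) = (\<Sum>a\<in>S. \<Sum>x\<in>lists_of m. h (a # x))"
proof -
  have "bij_betw (\<lambda>(a, x). a # x) (S \<times> lists_of m) (lists_of (Suc m))"
    by (rule bij_betw_imageI) (auto simp: inj_on_def lists_of_def length_Suc_conv image_iff)
  from sum.reindex_bij_betw[OF this, of h] show ?thesis
    by (simp add: sum.cartesian_product case_prod_unfold)
qed

lemma tens_eq: "tens m g = (\<Sum>x\<in>lists_of m. \<Sum>y\<in>lists_of m. (\<Prod>i<m. K (x ! i) (y ! i)) * g x y)"
proof (induction m arbitrary: g)
  case (Suc m)
  have "(\<Sum>x\<in>lists_of (Suc m). \<Sum>y\<in>lists_of (Suc m). (\<Prod>i<Suc m. K (x ! i) (y ! i)) * g x y)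
      = (\<Sum>a\<in>S. \<Sum>x\<in>lists_of m. \<Sum>b\<in>S. \<Sum>y\<in>lists_of m. K a b * ((\<Prod>i<m. K (x ! i) (y ! i)) * g (a # x) (b # y)))"
    by (simp add: sum_lists_of_Suc prod.lessThan_Suc_shift mult.assoc del: prod.lessThan_Suc)
  also have "\<dots> = (\<Sum>a\<in>S. \<Sum>b\<in>S. \<Sum>x\<in>lists_of m. \<Sum>y\<in>lists_of m. K a b * ((\<Prod>i<m. K (x ! i) (y ! i)) * g (a # x) (b # y)))"
    by (intro sum.cong refl, rule sum.swap)
  finally show ?case by (simp add: Suc.IH sum_distrib_left)
qed (simp add: lists_of_0)

lemma tens_sum: "tens m (\<lambda>x y. \<Sum>k\<in>A. w k * g k x y) = (\<Sum>k\<in>A. w k * tens m (g k))"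
proof (induction m arbitrary: g)
  case (Suc m)
  have "tens (Suc m) (\<lambda>x y. \<Sum>k\<in>A. w k * g k x y)
      = (\<Sum>a\<in>S. \<Sum>b\<in>S. \<Sum>k\<in>A. w k * (K a b * tens m (\<lambda>x y. g k (a # x) (b # y))))"
    by (simp add: Suc.IH sum_distrib_left mult.left_commute)
  also have "\<dots> = (\<Sum>k\<in>A. \<Sum>a\<in>S. \<Sum>b\<in>S. w k * (K a b * tens m (\<lambda>x y. g k (a # x) (b # y))))"
    by (simp only: sum.swap[of _ A S])
  finally show ?case by (simp add: sum_distrib_left)
qed simp

lemma tens_integral:
  assumes "\<And>x y. x \<in> lists_of m \<Longrightarrow> y \<in> lists_of m \<Longrightarrow> integrable M (g x y)"
  shows "tens m (\<lambda>x y. LINT w|M. g x y w) = (LINT w|M. tens m (\<lambda>x y. g x y w))"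
    and "integrable M (\<lambda>w. tens m (\<lambda>x y. g x y w))"
  using assms by (simp_all add: tens_eq)

section \<open>Moments of the density\<close>

lemma integrable_moment: "integrable (leb S) (\<lambda>u. u a * u b * gaussian_density S K u)" if "a \<in> S" "b \<in> S"
  using g0.integrable_G[of "Mul (Crd a) (Crd b)" 0 "\<lambda>_. 1" 0] that by (simp add: g0_density)

lemma integrable_moment1: "integrable (leb S) (\<lambda>u. u a * gaussian_density S K u)" if "a \<in> S"
  using g0.integrable_G[of "Crd a" 0 "\<lambda>_. 1" 0] that by (simp add: g0_density)

lemma integrable_density: "integrable (leb S) (gaussian_density S K)"
  using g0.integrable_G[of "Cst 1" 0 "\<lambda>_. 1" 0] by (simp add: g0_density)

lemma dc_Q0: "i \<in> S \<Longrightarrow> ev t u (dc i Q0) = - Bv u i"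
  unfolding Q0_def dc.simps ev.simps ev_dc_bx using finS by simp

text \<open>The derivative in i of u_b times the density has integral 0. So B times the vector of
  moments M is the b-th unit vector, and M is the b-th column of K.\<close>

lemma second_moment:
  assumes ab: "a \<in> S" "b \<in> S"
  shows "(LINT u|leb S. u a * u b * gaussian_density S K u) = K a b"
proof -
  define M where "M k = (LINT u|leb S. u k * u b * gaussian_density S K u)" for k
  have BM: "Bv M i = (if i = b then 1 else 0)" if i: "i \<in> S" for i
  proof -
    have "0 = (LINT u|leb S. g0.G (g0.D i (Crd b)) 0 u)"
      using i ab by (intro g0.integral_G_D[symmetric]) auto
    also have "\<dots> = (LINT u|leb S. (if i = b then 1 else 0) * gaussian_density S K u
        - (\<Sum>k\<in>S. B i k * (u k * u b * gaussian_density S K u)))"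
      using i by (intro Bochner_Integration.integral_cong refl)
        (simp add: g0_density g0.D_def dc_Q0 Bv_def algebra_simps sum_distrib_left)
    also have "\<dots> = (if i = b then 1 else 0) - Bv M i"
      using integrable_density integrable_moment ab(2) total
      by (simp add: Bv_def M_def)
    finally show ?thesis by simp
  qed
  have "M a = (\<Sum>j\<in>S. K a j * Bv M j)" using ab by (simp add: K_Bv)
  also have "\<dots> = K a b" using ab finS by (simp add: BM if_distrib cong: if_cong sum.cong)
  finally show ?thesis by (simp add: M_def)
qed

lemma first_moment:
  assumes a: "a \<in> S"
  shows "(LINT u|leb S. u a * gaussian_density S K u) = 0"
proof -
  define M where "M k = (LINT u|leb S. u k * gaussian_density S K u)" for k
  have BM: "Bv M i = 0" if i: "i \<in> S" for i
  proof -
    have "0 = (LINT u|leb S. g0.G (g0.D i (Cst 1)) 0 u)"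
      using i by (intro g0.integral_G_D[symmetric]) auto
    also have "\<dots> = (LINT u|leb S. - (\<Sum>k\<in>S. B i k * (u k * gaussian_density S K u)))"
      using i by (intro Bochner_Integration.integral_cong refl)
        (simp add: g0_density g0.D_def dc_Q0 Bv_def sum_distrib_right mult.assoc)
    also have "\<dots> = - Bv M i"
      using integrable_moment1 by (simp add: Bv_def M_def)
    finally show ?thesis by simp
  qed
  have "M a = (\<Sum>j\<in>S. K a j * Bv M j)" using a by (simp add: K_Bv)
  then show ?thesis using BM by (simp add: M_def)
qed

definition b0 where "b0 = (SOME b. b > 0 \<and> (\<forall>x\<in>S. \<forall>v. b * (v x)\<^sup>2 \<le> bilK v v))"

lemma b0_pos: "b0 > 0" and b0_le: "x \<in> S \<Longrightarrow> b0 * (v x)\<^sup>2 \<le> bilK v v"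
  using someI_ex[OF K_coercive] unfolding b0_def by auto

text \<open>
  Positivity of the tensor power of \<^term>\<open>K\<close> is obtained by writing one factor as the second
  moment matrix of the Gaussian vector.
\<close>

lemma tens_lower: "x \<in> lists_of m \<Longrightarrow> b0 ^ m * (T x)\<^sup>2 \<le> tens m (\<lambda>x y. T x * T y)"
proof (induction m arbitrary: x T)
  case 0
  then show ?case by (simp add: lists_of_0 power2_eq_square)
next
  case (Suc m)
  then obtain z x' where x: "x = z # x'" "z \<in> S" "x' \<in> lists_of m"
    by (auto simp: lists_of_def length_Suc_conv)
  let ?\<phi> = "gaussian_density S K"
  let ?t = "\<lambda>a b. tens m (\<lambda>x y. T (a # x) * T (b # y))"
  have lin: "(LINT u|leb S. (\<Sum>a\<in>S. \<Sum>b\<in>S. u a * u b * c a b) * ?\<phi> u) = (\<Sum>a\<in>S. \<Sum>b\<in>S. K a b * c a b)"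
    "integrable (leb S) (\<lambda>u. (\<Sum>a\<in>S. \<Sum>b\<in>S. u a * u b * c a b) * ?\<phi> u)" for c
  proof -
    have eq: "(\<Sum>a\<in>S. \<Sum>b\<in>S. u a * u b * c a b) * ?\<phi> u = (\<Sum>a\<in>S. \<Sum>b\<in>S. c a b * (u a * u b * ?\<phi> u))" for u
      by (simp add: sum_distrib_right sum_distrib_left mult_ac)
    show "integrable (leb S) (\<lambda>u. (\<Sum>a\<in>S. \<Sum>b\<in>S. u a * u b * c a b) * ?\<phi> u)"
      unfolding eq by (intro Bochner_Integration.integrable_sum integrable_mult_right integrable_moment)
    have "(LINT u|leb S. (\<Sum>a\<in>S. \<Sum>b\<in>S. u a * u b * c a b) * ?\<phi> u)
        = (\<Sum>a\<in>S. \<Sum>b\<in>S. LINT u|leb S. c a b * (u a * u b * ?\<phi> u))"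
      unfolding eq by (simp add: integrable_moment Bochner_Integration.integral_sum)
    also have "\<dots> = (\<Sum>a\<in>S. \<Sum>b\<in>S. K a b * c a b)"
      by (intro sum.cong refl) (simp add: second_moment)
    finally show "(LINT u|leb S. (\<Sum>a\<in>S. \<Sum>b\<in>S. u a * u b * c a b) * ?\<phi> u) = (\<Sum>a\<in>S. \<Sum>b\<in>S. K a b * c a b)" .
  qed
  have expand: "tens m (\<lambda>x y. (\<Sum>a\<in>S. u a * T (a # x)) * (\<Sum>b\<in>S. u b * T (b # y)))
      = (\<Sum>a\<in>S. \<Sum>b\<in>S. u a * u b * ?t a b)" for u
  proof -
    have "(\<Sum>a\<in>S. u a * T (a # x)) * (\<Sum>b\<in>S. u b * T (b # y))
        = (\<Sum>a\<in>S. u a * (\<Sum>b\<in>S. u b * (T (a # x) * T (b # y))))" for x y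
      unfolding sum_product by (intro sum.cong refl) (simp add: sum_distrib_left mult_ac)
    then show ?thesis unfolding tens_sum by (simp only: tens_sum) (simp add: sum_distrib_left mult.assoc)
  qed
  have "b0 ^ Suc m * (T x)\<^sup>2 = b0 ^ m * (b0 * (T (z # x'))\<^sup>2)" by (simp add: x)
  also have "\<dots> \<le> b0 ^ m * bilK (\<lambda>a. T (a # x')) (\<lambda>a. T (a # x'))"
    using b0_pos b0_le[OF x(2), of "\<lambda>a. T (a # x')"] by (intro mult_left_mono) auto
  also have "\<dots> = (LINT u|leb S. (\<Sum>a\<in>S. \<Sum>b\<in>S. u a * u b * (b0 ^ m * (T (a # x') * T (b # x')))) * ?\<phi> u)"
    unfolding lin(1) by (simp add: bilK_def sum_distrib_left mult_ac)
  also have "\<dots> \<le> (LINT u|leb S. (\<Sum>a\<in>S. \<Sum>b\<in>S. u a * u b * ?t a b) * ?\<phi> u)"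
  proof (rule integral_mono[OF lin(2) lin(2)])
    fix u
    have "(\<Sum>a\<in>S. \<Sum>b\<in>S. u a * u b * (b0 ^ m * (T (a # x') * T (b # x')))) = b0 ^ m * (\<Sum>a\<in>S. u a * T (a # x'))\<^sup>2"
      by (simp add: power2_eq_square sum_product sum_distrib_left mult_ac)
    \<comment> \<open>For fixed u the induction hypothesis is applied to the contraction of T with u
      in its first index.\<close>
    also have "\<dots> \<le> tens m (\<lambda>x y. (\<Sum>a\<in>S. u a * T (a # x)) * (\<Sum>b\<in>S. u b * T (b # y)))"
      using Suc.IH[OF x(3), of "\<lambda>x. \<Sum>a\<in>S. u a * T (a # x)"] .
    also note expand
    finally show "(\<Sum>a\<in>S. \<Sum>b\<in>S. u a * u b * (b0 ^ m * (T (a # x') * T (b # x')))) * ?\<phi> u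
        \<le> (\<Sum>a\<in>S. \<Sum>b\<in>S. u a * u b * ?t a b) * ?\<phi> u"
      using \<kappa>0_pos by (intro mult_right_mono) (auto simp: density_eq)
  qed
  also have "\<dots> = tens (Suc m) (\<lambda>x y. T x * T y)"
    unfolding lin(1) by simp
  finally show ?case .
qed

end


section \<open>The interpolated second moment\<close>

lemma case_sum_upd: "case_sum w (u(b := z)) = (case_sum w u)(Inr b := z)" "case_sum (w(b := z)) u = (case_sum w u)(Inl b := z)"
  by (auto simp: fun_eq_iff split: sum.split)

locale gexc = gcov S K for S :: "'i set" and K +
  fixes \<Xi> :: "'i set \<Rightarrow> real" and l :: real
begin

definition F :: "('i \<Rightarrow> real) \<Rightarrow> real" where
  "F u = \<Xi> (excursion_set S l u)"

text \<open>The product F(u) F(v) as one function of an excursion set over \<open>S <+> S\<close>,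
  so that \<open>G_ibp\<close> applies to the pair directly.\<close>

definition \<Xi>2 :: "('i + 'i) set \<Rightarrow> real" where
  "\<Xi>2 E = \<Xi> (Inl -` E) * \<Xi> (Inr -` E)"

lemma \<Xi>2_exc: "\<Xi>2 (excursion_set (S <+> S) l v) = F (v \<circ> Inl) * F (v \<circ> Inr)"
proof -
  have "Inl -` excursion_set (S <+> S) l v = excursion_set S l (v \<circ> Inl)"
    "Inr -` excursion_set (S <+> S) l v = excursion_set S l (v \<circ> Inr)"
    by (auto simp: excursion_set_def)
  then show ?thesis by (simp add: \<Xi>2_def F_def)
qed

lemma F_measurable: "(\<And>i. i \<in> S \<Longrightarrow> (\<lambda>w. X w i) \<in> borel_measurable M) \<Longrightarrow> (\<lambda>w. F (X w)) \<in> borel_measurable M"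
  unfolding F_def by (rule excursion_measurable[OF finS])

lemma F_bounded: "\<exists>A\<ge>0. \<forall>u. \<bar>F u\<bar> \<le> A"
  unfolding F_def by (rule excursion_bounded[OF finS])

lemma F_cong: "(\<And>i. i \<in> S \<Longrightarrow> u i = v i) \<Longrightarrow> F u = F v"
  unfolding F_def by (simp cong: excursion_set_cong)

text \<open>F(u) F(v) integrated against the derivative of the pair density along zs. In this form,
  before integration by parts, time derivatives and reorderings are easy;
  \<open>pivotal_intensity_eq\<close> identifies \<open>P\<close> with the pivotal
  intensity.\<close>

definition p :: "('i + 'i) list \<Rightarrow> real \<Rightarrow> real" where
  "p zs t = (LINT v|leb (S <+> S). \<Xi>2 (excursion_set (S <+> S) l v) * gt.G (foldr gt.D zs (Cst 1)) t v)"

definition P :: "'i list \<Rightarrow> 'i list \<Rightarrow> real \<Rightarrow> real" where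
  "P x y = p (map Inl x @ map Inr y)"

definition Phi :: "nat \<Rightarrow> real \<Rightarrow> real" where
  "Phi m t = tens m (\<lambda>x y. P x y t)"

lemma vars_Ds1: "vars (foldr gt.D zs (Cst 1)) \<subseteq> S <+> S"
  by (rule gt.vars_Ds) simp

lemma p_integrable: "0 \<le> t \<Longrightarrow> t < 1 \<Longrightarrow> set_integrable lborel {0..t} (p zs)"
  unfolding p_def[abs_def] by (rule gt.G_time(1)[OF vars_Ds1])

lemma p_mset: "mset zs = mset zs' \<Longrightarrow> p zs t = p zs' t"
  unfolding p_def gt.G_def using gt.Ds_mset[of zs zs'] by simp

lemma p_ftc:
  assumes t: "0 \<le> t" "t < 1"
  shows "p zs t = p zs 0 + (LINT s:{0..t}|lborel. \<Sum>a\<in>S. \<Sum>b\<in>S. K a b * p (Inl a # Inr b # zs) s)"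
proof -
  have "(LINT s:{0..t}|lborel. LINT v|leb (S <+> S). \<Xi>2 (excursion_set (S <+> S) l v) * gt.G (gt.DT (foldr gt.D zs (Cst 1))) s v)
      = (LINT s:{0..t}|lborel. \<Sum>a\<in>S. \<Sum>b\<in>S. K a b * p (Inl a # Inr b # zs) s)"
  proof (rule set_lebesgue_integral_cong, simp, intro allI impI)
    fix s assume s: "s \<in> {0..t}"
    let ?q = "\<lambda>v. \<Xi>2 (excursion_set (S <+> S) l v)"
    have "(LINT v|leb (S <+> S). ?q v * gt.G (gt.DT (foldr gt.D zs (Cst 1))) s v)
        = (LINT v|leb (S <+> S). (\<Sum>a\<in>S. \<Sum>b\<in>S. K a b * (?q v * gt.G (foldr gt.D (Inl a # Inr b # zs) (Cst 1)) s v)))"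
      using s t by (subst heat_Ds) (auto simp: sum_distrib_left mult.left_commute)
    also have "\<dots> = (\<Sum>a\<in>S. \<Sum>b\<in>S. K a b * p (Inl a # Inr b # zs) s)"
    proof -
      have "integrable (leb (S <+> S)) (\<lambda>v. K a b * (?q v * gt.G (foldr gt.D (Inl a # Inr b # zs) (Cst 1)) s v))" for a b
        using s t by (intro integrable_mult_right gt.integrable_G vars_Ds1) auto
      then show ?thesis
        unfolding p_def by (subst Bochner_Integration.integral_sum, simp)+ simp
    qed
    finally show "(LINT v|leb (S <+> S). ?q v * gt.G (gt.DT (foldr gt.D zs (Cst 1))) s v)
        = (\<Sum>a\<in>S. \<Sum>b\<in>S. K a b * p (Inl a # Inr b # zs) s)" .
  qed
  with gt.G_time(2)[OF vars_Ds1 t, of \<Xi>2 l zs] show ?thesis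
    unfolding p_def by simp
qed

lemma P_integrable: "0 \<le> t \<Longrightarrow> t < 1 \<Longrightarrow> set_integrable lborel {0..t} (P x y)"
  unfolding P_def by (rule p_integrable)

lemma Phi_integrable: "0 \<le> t \<Longrightarrow> t < 1 \<Longrightarrow> set_integrable lborel {0..t} (Phi m)"
proof -
  assume t: "0 \<le> t" "t < 1"
  have "indicator {0..t} s *\<^sub>R Phi m s
      = (\<Sum>x\<in>lists_of m. \<Sum>y\<in>lists_of m. (\<Prod>i<m. K (x ! i) (y ! i)) * (indicator {0..t} s *\<^sub>R P x y s))" for s
    by (simp add: Phi_def tens_eq sum_distrib_left mult.left_commute)
  then show ?thesis
    using P_integrable[OF t] by (simp add: set_integrable_def)
qed

text \<open>The heat equation adds one pair (a, b) weighted by K a b, which is exactly the step from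
  \<open>tens m\<close> to \<open>tens (Suc m)\<close>. So \<open>Phi (Suc m)\<close> is the
  derivative of \<open>Phi m\<close>.\<close>

lemma Phi_ftc:
  assumes t: "0 \<le> t" "t < 1"
  shows "Phi m t = Phi m 0 + (LINT s:{0..t}|lborel. Phi (Suc m) s)"
proof -
  have i: "integrable lborel (\<lambda>s. indicator {0..t} s *\<^sub>R (\<Sum>a\<in>S. \<Sum>b\<in>S. K a b * P (a # x) (b # y) s))" for x y
    using P_integrable[OF t] by (simp add: set_integrable_def sum_distrib_left mult.left_commute)
  have "P x y t = P x y 0 + (LINT s:{0..t}|lborel. \<Sum>a\<in>S. \<Sum>b\<in>S. K a b * P (a # x) (b # y) s)" for x y
  proof -
    have "p (Inl a # Inr b # map Inl x @ map Inr y) s = P (a # x) (b # y) s" for a b s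
      unfolding P_def by (rule p_mset) simp
    then show ?thesis using p_ftc[OF t, of "map Inl x @ map Inr y"] by (simp add: P_def)
  qed
  \<comment> \<open>The sum over two truth values presents an addition as a finite sum, so that
    \<open>tens_sum\<close> gives additivity.\<close>
  then have "Phi m t = tens m (\<lambda>x y. \<Sum>k\<in>{False, True}. 1 * (if k then P x y 0
      else (LINT s|lborel. indicator {0..t} s *\<^sub>R (\<Sum>a\<in>S. \<Sum>b\<in>S. K a b * P (a # x) (b # y) s))))"
    unfolding Phi_def set_lebesgue_integral_def by (simp add: add.commute)
  also have "\<dots> = Phi m 0 + tens m (\<lambda>x y. LINT s|lborel. indicator {0..t} s *\<^sub>R (\<Sum>a\<in>S. \<Sum>b\<in>S. K a b * P (a # x) (b # y) s))"
    by (subst tens_sum) (simp add: Phi_def)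
  also have "tens m (\<lambda>x y. LINT s|lborel. indicator {0..t} s *\<^sub>R (\<Sum>a\<in>S. \<Sum>b\<in>S. K a b * P (a # x) (b # y) s))
      = (LINT s|lborel. tens m (\<lambda>x y. indicator {0..t} s *\<^sub>R (\<Sum>a\<in>S. \<Sum>b\<in>S. K a b * P (a # x) (b # y) s)))"
    by (rule tens_integral(1)) (rule i)
  also have "\<dots> = (LINT s|lborel. indicator {0..t} s *\<^sub>R Phi (Suc m) s)"
  proof (intro Bochner_Integration.integral_cong refl)
    fix s
    have "tens m (\<lambda>x y. indicator {0..t} s *\<^sub>R (\<Sum>a\<in>S. \<Sum>b\<in>S. K a b * P (a # x) (b # y) s))
        = tens m (\<lambda>x y. \<Sum>k\<in>S \<times> S. (indicator {0..t} s * K (fst k) (snd k)) * P (fst k # x) (snd k # y) s)"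
      by (simp add: sum.cartesian_product case_prod_unfold sum_distrib_left mult.assoc)
    also have "\<dots> = (\<Sum>k\<in>S \<times> S. (indicator {0..t} s * K (fst k) (snd k)) * tens m (\<lambda>x y. P (fst k # x) (snd k # y) s))"
      by (rule tens_sum)
    also have "\<dots> = indicator {0..t} s *\<^sub>R Phi (Suc m) s"
      by (simp add: Phi_def sum.cartesian_product case_prod_unfold sum_distrib_left mult.assoc)
    finally show "tens m (\<lambda>x y. indicator {0..t} s *\<^sub>R (\<Sum>a\<in>S. \<Sum>b\<in>S. K a b * P (a # x) (b # y) s))
        = indicator {0..t} s *\<^sub>R Phi (Suc m) s" .
  qed
  finally show ?thesis by (simp add: set_lebesgue_integral_def)
qed

end

section \<open>Kernels of the Ornstein--Uhlenbeck semigroup\<close>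

context gcov
begin

lemma integral_gauss_scaled:
  assumes "0 < r"
  shows "(LINT w|leb S. exp (- (r / 2) * bil (\<lambda>i. w i - m i) (\<lambda>i. w i - m i))) = r powr (- (real (card S) / 2)) / \<kappa>0"
proof -
  let ?h = "\<lambda>w. exp (- (r / 2) * bil (\<lambda>i. w i - m i) (\<lambda>i. w i - m i))"
  let ?c = "1 / sqrt r"
  have cong: "bil u u = bil v v" if "\<And>i. i \<in> S \<Longrightarrow> u i = v i" for u v
    using that unfolding bil_def by (intro sum.cong) auto
  have "?h \<in> borel_measurable (leb S)"
    unfolding bil_def by (intro borel_measurable_exp[THEN measurable_compose[rotated]] borel_measurable_times
      borel_measurable_sum borel_measurable_diff borel_measurable_const measurable_coord)
  then have "(LINT w|leb S. ?h w) = ?c ^ card S * (LINT w|leb S. ?h (\<lambda>i\<in>S. m i + ?c * w i))"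
    using assms by (intro integral_leb_affine finS) auto
  also have "(LINT w|leb S. ?h (\<lambda>i\<in>S. m i + ?c * w i)) = (LINT w|leb S. gaussian_density S K w / \<kappa>0)"
  proof (intro Bochner_Integration.integral_cong refl)
    fix w
    have "bil (\<lambda>i. (\<lambda>i\<in>S. m i + ?c * w i) i - m i) (\<lambda>i. (\<lambda>i\<in>S. m i + ?c * w i) i - m i)
        = bil (\<lambda>i. ?c * w i + 0 * w i) (\<lambda>i. ?c * w i + 0 * w i)"
      by (rule cong) simp
    also have "\<dots> = ?c\<^sup>2 * bil w w" unfolding bil_comb by simp
    also have "\<dots> = bil w w / r" using assms by (simp add: power_divide)
    finally show "?h (\<lambda>i\<in>S. m i + ?c * w i) = gaussian_density S K w / \<kappa>0"
      using \<kappa>0_pos assms by (simp add: density_eq)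
  qed
  also have "\<dots> = 1 / \<kappa>0" by (simp add: total)
  also have "?c ^ card S = r powr (- (real (card S) / 2))"
  proof -
    have "?c = r powr (- (1 / 2))"
      using assms by (simp add: powr_minus_divide powr_half_sqrt)
    then have "?c ^ card S = (r powr (- (1 / 2))) powr real (card S)"
      using assms by (simp only: powr_realpow powr_gt_zero less_imp_neq)
    also have "\<dots> = r powr (- (1 / 2) * real (card S))"
      by (rule powr_powr)
    finally show ?thesis by simp
  qed
  finally show ?thesis by simp
qed

context
  fixes s :: real
  assumes s: "0 \<le> s" "s < 1"
begin

text \<open>
  The kernel \<open>rr []\<close> is the square root of the density of \<open>f\<close> at \<open>w\<close>, times the density of
  \<open>f\<^sup>s\<close> at \<open>u\<close> given \<open>f = w\<close>. Integrating a product of two kernels over \<open>w\<close> thus yields the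
  density of \<open>(f, f\<^sup>t)\<close> for \<open>t = s\<^sup>2\<close>.
\<close>

definition Qr :: "('i + 'i) ex" where
  "Qr = Add (Mul (Cst (- (1 / 4))) (bx Inl Inl)) (Mul (Cst (- (1 / (2 * (1 - s\<^sup>2)))))
     (Add (bx Inr Inr) (Add (Mul (Cst (- 2 * s)) (bx Inl Inr)) (Mul (Cst (s\<^sup>2)) (bx Inl Inl)))))"

text \<open>\<kappa>0 to the power 3/2: a square root from the density of f and a full factor from
  the conditional density.\<close>

definition \<kappa>r :: real where
  "\<kappa>r = \<kappa>0\<^sup>2 * (1 - s\<^sup>2) powr (- (real (card S) / 2)) / sqrt \<kappa>0"

lemma s_sq: "0 < 1 - s\<^sup>2" "1 - s\<^sup>2 \<le> 1"
  using s abs_square_less_1[of s] by auto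

lemma ev_Qr: "ev t v Qr = - (1 / 4) * bil (v \<circ> Inl) (v \<circ> Inl) + - (1 / (2 * (1 - s\<^sup>2)))
    * (bil (v \<circ> Inr) (v \<circ> Inr) + (- 2 * s * bil (v \<circ> Inl) (v \<circ> Inr) + s\<^sup>2 * bil (v \<circ> Inl) (v \<circ> Inl)))"
  by (simp only: Qr_def ev.simps ev_bx comp_def)

interpretation gr: gauss "S <+> S" Qr "Cst 0" "\<lambda>_. \<kappa>r" "\<beta> / 16"
proof
  show "finite (S <+> S)" "0 < \<beta> / 16" "vars (Cst 0 :: ('i + 'i) ex) = {}" using finS \<beta>_pos by auto
  show "vars Qr \<subseteq> S <+> S"
    using vars_bx[of "Inl :: 'i \<Rightarrow> 'i + 'i" Inl] vars_bx[of "Inl :: 'i \<Rightarrow> 'i + 'i" Inr]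
      vars_bx[of "Inr :: 'i \<Rightarrow> 'i + 'i" Inr]
    by (auto simp: Qr_def)
  fix t :: real and v :: "'i + 'i \<Rightarrow> real"
  define w u where "w = v \<circ> Inl" and "u = v \<circ> Inr"
  let ?w = w and ?u = u
  \<comment> \<open>The form at u - s w. Writing u = (u - s w) + s w bounds the form at u by 2 y
    plus twice the form at w.\<close>
  let ?y = "bil ?u ?u + (- 2 * s * bil ?w ?u + s\<^sup>2 * bil ?w ?w)"
  have y: "?y = bil (\<lambda>i. 1 * ?u i + (- s) * ?w i) (\<lambda>i. 1 * ?u i + (- s) * ?w i)"
    unfolding bil_comb bil_sym[of u w] by simp
  have y0: "0 \<le> ?y" unfolding y by (rule bil_nonneg)
  have e0: "bil ?u ?u = bil (\<lambda>i. 1 * (1 * ?u i + (- s) * ?w i) + s * ?w i) (\<lambda>i. 1 * (1 * ?u i + (- s) * ?w i) + s * ?w i)"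
    by (intro arg_cong2[where f = bil] ext) simp_all
  have e1: "bil ?u ?u = ?y + 2 * s * bil (\<lambda>i. 1 * ?u i + (- s) * ?w i) ?w + s\<^sup>2 * bil ?w ?w"
    using bil_comb[of 1 "\<lambda>i. 1 * ?u i + (- s) * ?w i" s ?w] unfolding e0[symmetric] y[symmetric] by simp
  have e2: "2 * s * bil (\<lambda>i. 1 * ?u i + (- s) * ?w i) ?w = 2 * bil (\<lambda>i. 1 * ?u i + (- s) * ?w i) (\<lambda>i. s * ?w i + 0 * ?w i)"
    unfolding bil_add_right[of _ s ?w 0 ?w] by simp
  have e3: "2 * bil (\<lambda>i. 1 * ?u i + (- s) * ?w i) (\<lambda>i. s * ?w i + 0 * ?w i)
      \<le> ?y + bil (\<lambda>i. s * ?w i + 0 * ?w i) (\<lambda>i. s * ?w i + 0 * ?w i)"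
    unfolding y by (rule bil_le)
  have e4: "bil (\<lambda>i. s * ?w i + 0 * ?w i) (\<lambda>i. s * ?w i + 0 * ?w i) = s\<^sup>2 * bil ?w ?w"
    unfolding bil_comb[of s ?w 0 ?w] by simp
  have "bil ?u ?u \<le> 2 * ?y + 2 * (s\<^sup>2 * bil ?w ?w)"
  proof -
    have "x \<le> 2 * z + 2 * c" if "x = z + a + c" "a = b" "b \<le> z + e" "e = c" for x z a b c e :: real
      using that by linarith
    from this[OF e1 e2 e3 e4] show ?thesis .
  qed
  moreover have "s\<^sup>2 * bil ?w ?w \<le> 1 * bil ?w ?w"
    using s_sq bil_nonneg[of ?w] by (intro mult_right_mono) auto
  ultimately have le: "bil ?u ?u \<le> 2 * ?y + 2 * bil ?w ?w" by simp
  \<comment> \<open>The factor 1/8 is smaller than it could be. It is chosen so that -W/4 - y/8 is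
    at most -(U + W)/16 by the bound just shown; hence the rate \<beta> / 16.\<close>
  have "(1 / 8) * ?y \<le> 1 / (2 * (1 - s\<^sup>2)) * ?y"
    using y0 s_sq by (intro mult_right_mono) (auto simp: field_simps)
  then have "ev t v Qr \<le> - (1 / 4) * bil ?w ?w - (1 / 8) * ?y"
    unfolding ev_Qr w_def[symmetric] u_def[symmetric] by linarith
  also have "\<dots> \<le> - (1 / 16) * (bil ?u ?u + bil ?w ?w)"
  proof -
    have "- (1 / 4) * c - (1 / 8) * z \<le> - (1 / 16) * (x + c)" if "x \<le> 2 * z + 2 * c" "0 \<le> c" for x z c :: real
    proof -
      have "x + c \<le> 2 * z + 4 * c" using that by linarith
      then have "(x + c) / 16 \<le> (2 * z + 4 * c) / 16" by (rule divide_right_mono) simp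
      then show ?thesis by (simp add: field_simps)
    qed
    from this[OF le bil_nonneg] show ?thesis .
  qed
  also have "\<dots> \<le> - (\<beta> / 16) * (\<Sum>i\<in>S <+> S. (v i)\<^sup>2)"
    using \<beta>_le[of ?u] \<beta>_le[of ?w] by (simp add: sum_Plus_sq distrib_left w_def u_def)
  finally show "ev t v Qr \<le> - (\<beta> / 16) * (\<Sum>i\<in>S <+> S. (v i)\<^sup>2)" .
qed auto

definition rr :: "'i list \<Rightarrow> ('i \<Rightarrow> real) \<Rightarrow> ('i \<Rightarrow> real) \<Rightarrow> real" where
  "rr x w u = gr.G (foldr gr.D (map Inr x) (Cst 1)) 0 (case_sum w u)"

lemma vars_rr: "vars (foldr gr.D (map Inr x) (Cst 1)) \<subseteq> S <+> S"
  by (rule gr.vars_Ds) simp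

lemma rr_deriv: "((\<lambda>z. rr x w (u(b := z))) has_real_derivative rr (b # x) w (u(b := z))) (at z)"
  unfolding rr_def case_sum_upd using gr.G_D[of "foldr gr.D (map Inr x) (Cst 1)" 0 "case_sum w u" "Inr b" z]
  by simp

lemma rr_bound: "\<exists>C\<ge>0. \<forall>w u. \<bar>rr x w u\<bar> \<le> C * exp (- (\<beta> / 32) * (\<Sum>i\<in>S. (w i)\<^sup>2)) * exp (- (\<beta> / 32) * (\<Sum>i\<in>S. (u i)\<^sup>2))"
proof -
  obtain C where C: "C \<ge> 0" "\<And>v. \<bar>gr.G (foldr gr.D (map Inr x) (Cst 1)) 0 v\<bar> \<le> C * exp (- (\<beta> / 16 / 2) * (\<Sum>i\<in>S <+> S. (v i)\<^sup>2))"
    using gr.G_bound[OF vars_rr, of 0 x] by auto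
  have "\<bar>rr x w u\<bar> \<le> C * exp (- (\<beta> / 32) * (\<Sum>i\<in>S. (w i)\<^sup>2)) * exp (- (\<beta> / 32) * (\<Sum>i\<in>S. (u i)\<^sup>2))" for w u
  proof -
    have "- (\<beta> / 16 / 2) * (\<Sum>i\<in>S <+> S. (case_sum w u i)\<^sup>2)
        = - (\<beta> / 32) * (\<Sum>i\<in>S. (w i)\<^sup>2) + - (\<beta> / 32) * (\<Sum>i\<in>S. (u i)\<^sup>2)"
      by (simp add: sum_Plus_sq algebra_simps)
    with C(2)[of "case_sum w u"] show ?thesis
      by (simp only: rr_def exp_add mult.assoc)
  qed
  with C(1) show ?thesis by blast
qed

lemma rr_bound_w: "\<exists>C\<ge>0. \<forall>w u. \<bar>rr x w u\<bar> \<le> C * exp (- (\<beta> / 32) * (\<Sum>i\<in>S. (w i)\<^sup>2))"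
proof -
  obtain C where C: "C \<ge> 0" "\<And>w u. \<bar>rr x w u\<bar> \<le> C * exp (- (\<beta> / 32) * (\<Sum>i\<in>S. (w i)\<^sup>2)) * exp (- (\<beta> / 32) * (\<Sum>i\<in>S. (u i)\<^sup>2))"
    using rr_bound by blast
  have "\<bar>rr x w u\<bar> \<le> C * exp (- (\<beta> / 32) * (\<Sum>i\<in>S. (w i)\<^sup>2))" for w u
  proof -
    have "C * exp (- (\<beta> / 32) * (\<Sum>i\<in>S. (w i)\<^sup>2)) * exp (- (\<beta> / 32) * (\<Sum>i\<in>S. (u i)\<^sup>2)) \<le> C * exp (- (\<beta> / 32) * (\<Sum>i\<in>S. (w i)\<^sup>2)) * 1"
      using C(1) \<beta>_pos by (intro mult_left_mono) (auto simp: sum_nonneg)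
    with C(2)[of w u] show ?thesis by linarith
  qed
  then show ?thesis using C(1) by blast
qed

lemma rr_bounded: "\<exists>C\<ge>0. \<forall>w u. \<bar>rr x w u\<bar> \<le> C"
proof -
  obtain C where C: "C \<ge> 0" "\<And>w u. \<bar>rr x w u\<bar> \<le> C * exp (- (\<beta> / 32) * (\<Sum>i\<in>S. (w i)\<^sup>2))"
    using rr_bound_w by blast
  have "\<bar>rr x w u\<bar> \<le> C" for w u
  proof -
    have "C * exp (- (\<beta> / 32) * (\<Sum>i\<in>S. (w i)\<^sup>2)) \<le> C * 1"
      using C(1) \<beta>_pos by (intro mult_left_mono) (auto simp: sum_nonneg)
    with C(2)[of w u] show ?thesis by linarith
  qed
  then show ?thesis using C(1) by blast
qed

lemma rr_measurable:
  assumes "\<And>i. i \<in> S \<Longrightarrow> (\<lambda>q. W q i) \<in> borel_measurable M" "\<And>i. i \<in> S \<Longrightarrow> (\<lambda>q. U q i) \<in> borel_measurable M"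
  shows "(\<lambda>q. rr x (W q) (U q)) \<in> borel_measurable M"
  unfolding rr_def
proof (rule gr.G_measurable[OF vars_rr])
  show "(\<lambda>q. case_sum (W q) (U q) i) \<in> borel_measurable M" if "i \<in> S <+> S" for i
    using that assms by auto
qed

lemma rr_mult_integrable: "integrable (leb S) (\<lambda>w. rr x w u * rr y w v)"
proof -
  obtain C where C: "C \<ge> 0" "\<And>w u. \<bar>rr x w u\<bar> \<le> C * exp (- (\<beta> / 32) * (\<Sum>i\<in>S. (w i)\<^sup>2))"
    using rr_bound_w by blast
  obtain C' where C': "C' \<ge> 0" "\<And>w u. \<bar>rr y w u\<bar> \<le> C'" using rr_bounded by blast
  show ?thesis
  proof (rule integrable_leb_bound[OF finS, of "\<beta> / 32" _ "C * C'"])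
    show "(\<lambda>w. rr x w u * rr y w v) \<in> borel_measurable (leb S)"
      by (intro borel_measurable_times rr_measurable measurable_coord borel_measurable_const)
    show "\<bar>rr x w u * rr y w v\<bar> \<le> C * C' * exp (- (\<beta> / 32) * (\<Sum>i\<in>S. (w i)\<^sup>2))" for w
      using mult_mono[OF C(2)[of w u] C'(2)[of w v]] C(1) by (simp add: abs_mult mult_ac)
  qed (use \<beta>_pos in simp)
qed

text \<open>Completing the square in w splits the product of the kernels into the pair density at
  correlation s^2 and a Gaussian in w. The constants cancel by 1 - s^4 = (1 - s^2)(1 + s^2).\<close>

lemma semigroup_base:
  "(LINT w|leb S. rr [] w u * rr [] w v) = gt.G (Cst 1) (s\<^sup>2) (case_sum u v)"
proof -
  let ?U = "bil u u" and ?V = "bil v v" and ?X = "bil u v"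
  let ?\<tau> = "1 - s\<^sup>2"
  \<comment> \<open>r is the coefficient of w in the completed square and a (u + v) its
    centre.\<close>
  define r where "r = (1 + s\<^sup>2) / ?\<tau>"
  have pos: "0 < r" "0 < 1 + s\<^sup>2" using s_sq by (auto simp: r_def intro!: divide_pos_pos add_pos_nonneg)
  define a where "a = s / (1 + s\<^sup>2)"
  have eq: "rr [] w u * rr [] w v = \<kappa>r\<^sup>2 * gt.G (Cst 1) (s\<^sup>2) (case_sum u v) / \<kappa>t (s\<^sup>2)
      * exp (- (r / 2) * bil (\<lambda>i. w i - (a * u i + a * v i)) (\<lambda>i. w i - (a * u i + a * v i)))" for w
  proof -
    let ?W = "bil w w" and ?wu = "bil w u" and ?wv = "bil w v"
    have sq: "bil (\<lambda>i. w i - (a * u i + a * v i)) (\<lambda>i. w i - (a * u i + a * v i))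
        = ?W - 2 * a * (?wu + ?wv) + a\<^sup>2 * (?U + 2 * ?X + ?V)"
    proof -
      have "bil (\<lambda>i. w i - (a * u i + a * v i)) (\<lambda>i. w i - (a * u i + a * v i))
          = bil (\<lambda>i. 1 * w i + (- 1) * (a * u i + a * v i)) (\<lambda>i. 1 * w i + (- 1) * (a * u i + a * v i))"
        by (intro arg_cong2[where f = bil] ext) simp_all
      also have "\<dots> = ?W - 2 * bil w (\<lambda>i. a * u i + a * v i) + bil (\<lambda>i. a * u i + a * v i) (\<lambda>i. a * u i + a * v i)"
        unfolding bil_comb[of 1 w] by simp
      finally show ?thesis unfolding bil_add_right[of w a u] bil_comb by (simp add: power2_eq_square algebra_simps)
    qed
    have "1 - (s\<^sup>2)\<^sup>2 = ?\<tau> * (1 + s\<^sup>2)" by (simp add: power2_eq_square algebra_simps)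
    note tt = this
    have Qt: "ev t (case_sum u v) Qt = - (?U + ?V - 2 * s\<^sup>2 * ?X) / (2 * (?\<tau> * (1 + s\<^sup>2)))" if "t = s\<^sup>2" for t
    proof -
      have "- (1 / 2) * (1 / T) * (U + V + - 2 * q * X) = - (U + V - 2 * q * X) / (2 * T)" for T U V q X :: real
        by (cases "T = 0") (simp_all add: field_simps)
      then show ?thesis
        unfolding ev_Qt that case_sum_o_inj tt .
    qed
    have Qr2: "ev 0 (case_sum w u) Qr + ev 0 (case_sum w v) Qr
        = - (1 / 2) * ?W - (?U + ?V - 2 * s * (?wu + ?wv) + 2 * s\<^sup>2 * ?W) / (2 * ?\<tau>)"
    proof -
      have "- (1 / 4) * W + - (1 / (2 * T)) * (U + (- 2 * s * Y + s\<^sup>2 * W))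
          + (- (1 / 4) * W + - (1 / (2 * T)) * (V + (- 2 * s * Z + s\<^sup>2 * W)))
          = - (1 / 2) * W - (U + V - 2 * s * (Y + Z) + 2 * s\<^sup>2 * W) / (2 * T)" if "T \<noteq> 0" for W U V Y Z T :: real
        using that by (simp add: field_simps)
      note gen = this
      show ?thesis
        unfolding ev_Qr case_sum_o_inj by (rule gen) (use s_sq(1) in simp)
    qed
    have "ev 0 (case_sum w u) Qr + ev 0 (case_sum w v) Qr = ev (s\<^sup>2) (case_sum u v) Qt
        + - (r / 2) * bil (\<lambda>i. w i - (a * u i + a * v i)) (\<lambda>i. w i - (a * u i + a * v i))"
    proof -
      have gen: "- (1 / 2) * W - (U + V - 2 * s * Y + 2 * s\<^sup>2 * W) / (2 * T)
          = - (U + V - 2 * s\<^sup>2 * X) / (2 * (T * R)) + - ((R / T) / 2) * (W - 2 * (s / R) * Y + (s / R)\<^sup>2 * (U + 2 * X + V))"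
        if "T = 1 - s\<^sup>2" "R = 1 + s\<^sup>2" "T \<noteq> 0" "R \<noteq> 0" for W U V Y X T R :: real
      proof -
        have "(- (1 / 2) * W - (U + V - 2 * s * Y + 2 * s\<^sup>2 * W) / (2 * T)) * (2 * (T * R))
            = - W * (T * R) - (U + V - 2 * s * Y + 2 * s\<^sup>2 * W) * R"
          using that(3,4) by (simp add: field_simps)
        also have "\<dots> = - (U + V - 2 * s\<^sup>2 * X) - (R\<^sup>2 * W - 2 * s * R * Y + s\<^sup>2 * (U + 2 * X + V))"
          unfolding that(1,2) by (simp add: power2_eq_square algebra_simps)
        also have "\<dots> = (- (U + V - 2 * s\<^sup>2 * X) / (2 * (T * R)) + - ((R / T) / 2) * (W - 2 * (s / R) * Y + (s / R)\<^sup>2 * (U + 2 * X + V))) * (2 * (T * R))"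
          using that(3,4) by (simp add: field_simps power2_eq_square)
        finally show ?thesis using that(3,4) by simp
      qed
      show ?thesis
        unfolding Qr2 Qt[OF refl] sq unfolding r_def a_def using s_sq pos by (intro gen) auto
    qed
    then have "exp (ev 0 (case_sum w u) Qr) * exp (ev 0 (case_sum w v) Qr) = exp (ev (s\<^sup>2) (case_sum u v) Qt)
        * exp (- (r / 2) * bil (\<lambda>i. w i - (a * u i + a * v i)) (\<lambda>i. w i - (a * u i + a * v i)))"
      by (simp only: exp_add[symmetric])
    moreover have "\<kappa>t (s\<^sup>2) \<noteq> 0"
    proof -
      have "(s\<^sup>2)\<^sup>2 < 1" using s_sq(1) abs_square_less_1[of "s\<^sup>2"] by simp
      then show ?thesis using \<kappa>0_pos by (simp add: \<kappa>t_def)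
    qed
    ultimately show ?thesis
      unfolding rr_def gr.G_def gt.G_def by (simp add: power2_eq_square)
  qed
  have const: "\<kappa>r\<^sup>2 / \<kappa>t (s\<^sup>2) * (r powr (- (real (card S) / 2)) / \<kappa>0) = 1"
  proof -
    let ?n = "- (real (card S) / 2)"
    have "1 - (s\<^sup>2)\<^sup>2 = ?\<tau> * (1 + s\<^sup>2)" by (simp add: power2_eq_square algebra_simps)
    then have "\<kappa>t (s\<^sup>2) = \<kappa>0\<^sup>2 * (?\<tau> powr ?n * (1 + s\<^sup>2) powr ?n)"
      unfolding \<kappa>t_def using s_sq pos by (simp add: powr_mult)
    moreover have "r powr ?n = (1 + s\<^sup>2) powr ?n / ?\<tau> powr ?n"
      unfolding r_def using s_sq pos by (simp add: powr_divide)
    moreover have "\<kappa>r\<^sup>2 = \<kappa>0 ^ 3 * (?\<tau> powr ?n)\<^sup>2"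
      unfolding \<kappa>r_def using \<kappa>0_pos by (simp add: power_mult_distrib power_divide power2_eq_square power3_eq_cube)
    moreover have "?\<tau> powr ?n > 0" "(1 + s\<^sup>2) powr ?n > 0" using s_sq pos by auto
    ultimately show ?thesis using \<kappa>0_pos by (simp add: power2_eq_square power3_eq_cube field_simps)
  qed
  have "(LINT w|leb S. rr [] w u * rr [] w v) = \<kappa>r\<^sup>2 * gt.G (Cst 1) (s\<^sup>2) (case_sum u v) / \<kappa>t (s\<^sup>2)
      * (r powr (- (real (card S) / 2)) / \<kappa>0)"
    unfolding eq using integral_gauss_scaled[OF pos(1), of "\<lambda>i. a * u i + a * v i"] by simp
  also have "\<dots> = gt.G (Cst 1) (s\<^sup>2) (case_sum u v) * (\<kappa>r\<^sup>2 / \<kappa>t (s\<^sup>2) * (r powr (- (real (card S) / 2)) / \<kappa>0))"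
    by simp
  finally show ?thesis unfolding const by simp
qed

text \<open>The first kernel supplies a Gaussian bound in w and the differentiated one is bounded
  uniformly in z, so differentiation under the integral is allowed.\<close>

lemma rr_mult_deriv:
  "((\<lambda>z. LINT w|leb S. rr x w u * rr y w (v(b := z))) has_real_derivative
     (LINT w|leb S. rr x w u * rr (b # y) w (v(b := z)))) (at z)"
proof -
  obtain C where C: "C \<ge> 0" "\<And>w u. \<bar>rr x w u\<bar> \<le> C * exp (- (\<beta> / 32) * (\<Sum>i\<in>S. (w i)\<^sup>2))"
    using rr_bound_w by blast
  obtain C' where C': "C' \<ge> 0" "\<And>w u. \<bar>rr (b # y) w u\<bar> \<le> C'" using rr_bounded by blast
  show ?thesis
  proof (rule has_real_derivative_integral)
    show "integrable (leb S) (\<lambda>w. rr x w u * rr y w (v(b := z)))" for z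
      by (rule rr_mult_integrable)
    show "((\<lambda>z. rr x w u * rr y w (v(b := z))) has_real_derivative rr x w u * rr (b # y) w (v(b := z))) (at z)" for z w
      by (intro DERIV_cmult rr_deriv)
    show "\<bar>rr x w u * rr (b # y) w (v(b := z))\<bar> \<le> C * C' * exp (- (\<beta> / 32) * (\<Sum>i\<in>S. (w i)\<^sup>2))" for z w
      using mult_mono[OF C(2)[of w u] C'(2)[of w "v(b := z)"]] C(1) by (simp add: abs_mult mult_ac)
    show "integrable (leb S) (\<lambda>w. C * C' * exp (- (\<beta> / 32) * (\<Sum>i\<in>S. (w i)\<^sup>2)))"
      using \<beta>_pos finS by (intro integrable_mult_right integrable_leb_gauss) auto
    show "(\<lambda>w. rr x w u * rr (b # y) w (v(b := z))) \<in> borel_measurable (leb S)" for z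
      using rr_mult_integrable by (rule borel_measurable_integrable)
  qed
qed

text \<open>Both sides of \<open>semigroup_base\<close> are differentiated, first along y in v, then
  along x in u; uniqueness of derivatives transfers the identity.\<close>

lemma semigroup:
  "(LINT w|leb S. rr x w u * rr y w v) = gt.G (foldr gt.D (map Inl x @ map Inr y) (Cst 1)) (s\<^sup>2) (case_sum u v)"
proof (induction x arbitrary: u)
  case Nil
  show ?case
  proof (induction y arbitrary: v)
    case Nil
    show ?case by (simp add: semigroup_base)
  next
    case (Cons b y)
    let ?e = "foldr gt.D (map Inr y) (Cst 1)"
    have f: "(LINT w|leb S. rr [] w u * rr y w (v(b := z))) = gt.G ?e (s\<^sup>2) ((case_sum u v)(Inr b := z))" for z
      using Cons.IH[of "v(b := z)"] by (simp only: case_sum_upd append_Nil list.map)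
    have "(LINT w|leb S. rr [] w u * rr (b # y) w (v(b := v b))) = gt.G (gt.D (Inr b) ?e) (s\<^sup>2) ((case_sum u v)(Inr b := v b))"
      using rr_mult_deriv[of "[]" u y v b "v b"] unfolding f by (rule DERIV_unique[OF _ gt.G_D])
    then show ?case
      by (simp only: case_sum_upd(1)[symmetric] fun_upd_triv append_Nil list.map foldr_Cons comp_apply)
  qed
next
  case (Cons a x)
  let ?e = "foldr gt.D (map Inl x @ map Inr y) (Cst 1)"
  have c: "(LINT w|leb S. rr y w v * rr x' w u') = (LINT w|leb S. rr x' w u' * rr y w v)" for x' u'
    by (intro Bochner_Integration.integral_cong refl mult.commute)
  have f: "(LINT w|leb S. rr y w v * rr x w (u(a := z))) = gt.G ?e (s\<^sup>2) ((case_sum u v)(Inl a := z))" for z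
    unfolding c using Cons.IH[of "u(a := z)"] by (simp only: case_sum_upd)
  have "(LINT w|leb S. rr y w v * rr (a # x) w (u(a := u a))) = gt.G (gt.D (Inl a) ?e) (s\<^sup>2) ((case_sum u v)(Inl a := u a))"
    using rr_mult_deriv[of y v x u a "u a"] unfolding f by (rule DERIV_unique[OF _ gt.G_D])
  then show ?case unfolding c
    by (simp only: case_sum_upd(2)[symmetric] fun_upd_triv append_Cons list.map foldr_Cons comp_apply)
qed

end

end

lemma integrable_leb_pair_bound:
  fixes h :: "('i \<Rightarrow> real) \<Rightarrow> ('j \<Rightarrow> real) \<Rightarrow> real"
  assumes I: "finite I" and J: "finite J" and c: "0 < c"
    and h: "(\<lambda>q. h (fst q) (snd q)) \<in> borel_measurable (leb I \<Otimes>\<^sub>M leb J)"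
    and le: "\<And>u v. \<bar>h u v\<bar> \<le> C * (exp (- c * (\<Sum>i\<in>I. (u i)\<^sup>2)) * exp (- c * (\<Sum>j\<in>J. (v j)\<^sup>2)))"
  shows "integrable (leb I \<Otimes>\<^sub>M leb J) (\<lambda>(u, v). h u v)"
proof (rule Bochner_Integration.integrable_bound)
  have "integrable (leb I \<Otimes>\<^sub>M leb J) (\<lambda>(u, v). exp (- c * (\<Sum>k\<in>I <+> J. (case_sum u v k)\<^sup>2)))"
    using I J c by (intro integrable_leb_Plus integrable_leb_gauss) auto
  also have "(\<lambda>(u, v). exp (- c * (\<Sum>k\<in>I <+> J. (case_sum u v k)\<^sup>2)))
      = (\<lambda>(u, v). exp (- c * (\<Sum>i\<in>I. (u i)\<^sup>2)) * exp (- c * (\<Sum>j\<in>J. (v j)\<^sup>2)))"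
    using I J by (auto simp: fun_eq_iff sum.Plus exp_add[symmetric] algebra_simps)
  finally show "integrable (leb I \<Otimes>\<^sub>M leb J) (\<lambda>q. C * (case q of (u, v) \<Rightarrow>
      exp (- c * (\<Sum>i\<in>I. (u i)\<^sup>2)) * exp (- c * (\<Sum>j\<in>J. (v j)\<^sup>2))))"
    by (rule integrable_mult_right)
  show "(\<lambda>(u, v). h u v) \<in> borel_measurable (leb I \<Otimes>\<^sub>M leb J)"
    using h by (simp add: case_prod_unfold)
  show "AE q in leb I \<Otimes>\<^sub>M leb J. norm (case q of (u, v) \<Rightarrow> h u v) \<le> norm (C * (case q of (u, v) \<Rightarrow>
      exp (- c * (\<Sum>i\<in>I. (u i)\<^sup>2)) * exp (- c * (\<Sum>j\<in>J. (v j)\<^sup>2))))"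
  proof (rule AE_I2)
    fix q :: "('i \<Rightarrow> real) \<times> ('j \<Rightarrow> real)"
    show "norm (case q of (u, v) \<Rightarrow> h u v) \<le> norm (C * (case q of (u, v) \<Rightarrow>
      exp (- c * (\<Sum>i\<in>I. (u i)\<^sup>2)) * exp (- c * (\<Sum>j\<in>J. (v j)\<^sup>2))))"
    proof (cases q)
      case (Pair u v)
      have "norm (h u v) \<le> C * (exp (- c * (\<Sum>i\<in>I. (u i)\<^sup>2)) * exp (- c * (\<Sum>j\<in>J. (v j)\<^sup>2)))"
        using le[of u v] by (simp only: real_norm_def)
      also have "\<dots> \<le> norm \<dots>" by (simp only: real_norm_def abs_ge_self)
      finally show ?thesis unfolding Pair by (simp only: prod.case)
    qed
  qed
qed

lemma AE_leb_coord_neq: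
  assumes "finite I"
  shows "AE u in leb I. \<forall>i\<in>I. u i \<noteq> l"
proof (rule AE_finite_allI[OF assms])
  fix i assume i: "i \<in> I"
  let ?A = "\<lambda>j. if j = i then {l} else UNIV"
  have "emeasure (leb I) (Pi\<^sub>E I ?A) = (\<Prod>j\<in>I. emeasure lborel (?A j))"
    using assms by (intro lborel_prod.emeasure_PiM) auto
  also have "\<dots> = 0" using assms i by (intro prod_zero bexI[of _ i]) auto
  finally have "Pi\<^sub>E I ?A \<in> null_sets (leb I)"
    using assms by (intro null_setsI sets_PiM_I_finite) auto
  then show "AE u in leb I. u i \<noteq> l"
    by (rule AE_I') (use i in \<open>auto simp: space_PiM PiE_iff extensional_def\<close>)
qed

section \<open>The intensities as a Gram matrix\<close>

context gexc
begin

lemma coord_pair_measurable: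
  assumes "i \<in> S"
  shows "(\<lambda>q. fst q i) \<in> borel_measurable (leb S \<Otimes>\<^sub>M N)" "(\<lambda>q. snd q i) \<in> borel_measurable (N' \<Otimes>\<^sub>M leb S)"
  using measurable_compose[OF measurable_fst measurable_coord[OF assms]]
    measurable_compose[OF measurable_snd measurable_coord[OF assms]] by auto

text \<open>The vectors of the Gram representation: \<open>P x y\<close> at s^2 is the L2 inner
  product of those for x and y.\<close>

definition \<tau> :: "real \<Rightarrow> 'i list \<Rightarrow> ('i \<Rightarrow> real) \<Rightarrow> real" where
  "\<tau> s x w = (LINT u|leb S. F u * rr s x w u)"

lemma P_iterated:
  assumes "0 \<le> t" "t < 1"
  shows "P x y t = (LINT u|leb S. LINT v|leb S. F u * F v * gt.G (foldr gt.D (map Inl x @ map Inr y) (Cst 1)) t (case_sum u v))"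
  unfolding P_def p_def using assms
  by (subst integral_leb_Plus[OF finS finS gt.integrable_G[OF vars_Ds1]])
    (simp_all add: \<Xi>2_exc case_sum_o_inj)

context
  fixes s :: real
  assumes s: "0 \<le> s" "s < 1"
begin

lemma F_rr_bound: "\<exists>C\<ge>0. \<forall>w u. \<bar>F u * rr s x w u\<bar> \<le> C * (exp (- (\<beta> / 32) * (\<Sum>i\<in>S. (w i)\<^sup>2)) * exp (- (\<beta> / 32) * (\<Sum>i\<in>S. (u i)\<^sup>2)))"
proof -
  obtain A where A: "A \<ge> 0" "\<And>u. \<bar>F u\<bar> \<le> A" using F_bounded by blast
  obtain C where C: "C \<ge> 0" "\<And>w u. \<bar>rr s x w u\<bar> \<le> C * exp (- (\<beta> / 32) * (\<Sum>i\<in>S. (w i)\<^sup>2)) * exp (- (\<beta> / 32) * (\<Sum>i\<in>S. (u i)\<^sup>2))"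
    using rr_bound[OF s] by blast
  have "\<bar>F u\<bar> * \<bar>rr s x w u\<bar> \<le> A * (C * exp (- (\<beta> / 32) * (\<Sum>i\<in>S. (w i)\<^sup>2)) * exp (- (\<beta> / 32) * (\<Sum>i\<in>S. (u i)\<^sup>2)))" for w u
    using A(1) by (intro mult_mono A(2) C(2)) auto
  then show ?thesis using A(1) C(1) by (intro exI[of _ "A * C"]) (simp add: abs_mult mult.assoc)
qed

lemma \<tau>_measurable: "\<tau> s x \<in> borel_measurable (leb S)"
proof -
  interpret sigma_finite_measure "leb S" by (rule sigma_finite_leb[OF finS])
  show ?thesis unfolding \<tau>_def[abs_def]
    by (intro borel_measurable_lebesgue_integral)
      (auto simp: case_prod_unfold intro!: borel_measurable_times F_measurable rr_measurable[OF s] coord_pair_measurable)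
qed

lemma \<tau>_bounded: "\<exists>C\<ge>0. \<forall>w. \<bar>\<tau> s x w\<bar> \<le> C"
proof -
  obtain C where C: "C \<ge> 0" "\<And>w u. \<bar>F u * rr s x w u\<bar> \<le> C * (exp (- (\<beta> / 32) * (\<Sum>i\<in>S. (w i)\<^sup>2)) * exp (- (\<beta> / 32) * (\<Sum>i\<in>S. (u i)\<^sup>2)))"
    using F_rr_bound by blast
  let ?g = "\<lambda>u :: 'i \<Rightarrow> real. C * exp (- (\<beta> / 32) * (\<Sum>i\<in>S. (u i)\<^sup>2))"
  have le: "\<bar>F u * rr s x w u\<bar> \<le> ?g u" for w u
  proof -
    have "exp (- (\<beta> / 32) * (\<Sum>i\<in>S. (w i)\<^sup>2)) * exp (- (\<beta> / 32) * (\<Sum>i\<in>S. (u i)\<^sup>2)) \<le> 1 * exp (- (\<beta> / 32) * (\<Sum>i\<in>S. (u i)\<^sup>2))"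
      using \<beta>_pos by (intro mult_right_mono) (auto simp: sum_nonneg)
    from mult_left_mono[OF this C(1)] C(2)[of u w] show ?thesis by simp
  qed
  have g: "integrable (leb S) ?g"
    using \<beta>_pos finS by (intro integrable_mult_right integrable_leb_gauss) auto
  have int: "integrable (leb S) (\<lambda>u. F u * rr s x w u)" for w
  proof (rule Bochner_Integration.integrable_bound[OF g])
    show "(\<lambda>u. F u * rr s x w u) \<in> borel_measurable (leb S)"
      by (intro borel_measurable_times F_measurable rr_measurable[OF s] measurable_coord borel_measurable_const)
    show "AE u in leb S. norm (F u * rr s x w u) \<le> norm (?g u)"
    proof (rule AE_I2)
      fix u show "norm (F u * rr s x w u) \<le> norm (?g u)"
        using order_trans[OF le abs_ge_self] by (simp only: real_norm_def)
    qed
  qed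
  have "\<bar>\<tau> s x w\<bar> \<le> integral\<^sup>L (leb S) ?g" for w
  proof -
    have "\<bar>\<tau> s x w\<bar> \<le> (LINT u|leb S. \<bar>F u * rr s x w u\<bar>)"
      unfolding \<tau>_def by (rule integral_abs_bound)
    also have "\<dots> \<le> integral\<^sup>L (leb S) ?g"
      using int g le by (intro integral_mono) auto
    finally show ?thesis .
  qed
  moreover have "0 \<le> integral\<^sup>L (leb S) ?g" using C(1) by (intro integral_nonneg_AE AE_I2) simp
  ultimately show ?thesis by blast
qed

text \<open>Insert \<open>semigroup\<close> and apply Fubini twice, to v and then to u, until the
  integral over w is outermost and the integrand factorises.\<close>

lemma P_semigroup:
  shows "P x y (s\<^sup>2) = (LINT w|leb S. \<tau> s x w * \<tau> s y w)"
    and "integrable (leb S) (\<lambda>w. \<tau> s x w * \<tau> s y w)"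
proof -
  interpret P: pair_sigma_finite "leb S" "leb S" by (intro pair_sigma_finite_leb finS)
  have s2: "0 \<le> s\<^sup>2" "s\<^sup>2 < 1" using s abs_square_less_1[of s] by auto
  have fub1: "(LINT v|leb S. LINT w|leb S. rr s x w u * (F v * rr s y w v)) = (LINT w|leb S. LINT v|leb S. rr s x w u * (F v * rr s y w v))" for u
  proof -
    obtain C where C: "C \<ge> 0" "\<And>w u. \<bar>F u * rr s y w u\<bar> \<le> C * (exp (- (\<beta> / 32) * (\<Sum>i\<in>S. (w i)\<^sup>2)) * exp (- (\<beta> / 32) * (\<Sum>i\<in>S. (u i)\<^sup>2)))"
      using F_rr_bound by blast
    obtain A where A: "A \<ge> 0" "\<And>w u. \<bar>rr s x w u\<bar> \<le> A" using rr_bounded[OF s] by blast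
    have "integrable (leb S \<Otimes>\<^sub>M leb S) (\<lambda>(w, v). rr s x w u * (F v * rr s y w v))"
    proof (rule integrable_leb_pair_bound[OF finS finS, of "\<beta> / 32" _ "A * C"])
      show "(\<lambda>q. rr s x (fst q) u * (F (snd q) * rr s y (fst q) (snd q))) \<in> borel_measurable (leb S \<Otimes>\<^sub>M leb S)"
        by (intro borel_measurable_times F_measurable rr_measurable[OF s] coord_pair_measurable borel_measurable_const)
      show "\<bar>rr s x w u * (F v * rr s y w v)\<bar> \<le> A * C * (exp (- (\<beta> / 32) * (\<Sum>i\<in>S. (w i)\<^sup>2)) * exp (- (\<beta> / 32) * (\<Sum>j\<in>S. (v j)\<^sup>2)))" for w v
        unfolding abs_mult[of "rr s x w u"] mult.assoc[of A] using A(1) by (intro mult_mono A(2) C(2)) auto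
    qed (use \<beta>_pos in simp)
    from P.Fubini_integral[OF this] show ?thesis .
  qed
  obtain T where T: "T \<ge> 0" "\<And>w. \<bar>\<tau> s y w\<bar> \<le> T" using \<tau>_bounded by blast
  have int2: "integrable (leb S \<Otimes>\<^sub>M leb S) (\<lambda>(w, u). \<tau> s y w * (F u * rr s x w u))"
  proof -
    obtain C where C: "C \<ge> 0" "\<And>w u. \<bar>F u * rr s x w u\<bar> \<le> C * (exp (- (\<beta> / 32) * (\<Sum>i\<in>S. (w i)\<^sup>2)) * exp (- (\<beta> / 32) * (\<Sum>i\<in>S. (u i)\<^sup>2)))"
      using F_rr_bound by blast
    show ?thesis
    proof (rule integrable_leb_pair_bound[OF finS finS, of "\<beta> / 32" _ "T * C"])
      show "(\<lambda>q. \<tau> s y (fst q) * (F (snd q) * rr s x (fst q) (snd q))) \<in> borel_measurable (leb S \<Otimes>\<^sub>M leb S)"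
        using measurable_compose[OF measurable_fst \<tau>_measurable]
        by (intro borel_measurable_times F_measurable rr_measurable[OF s] coord_pair_measurable) auto
      show "\<bar>\<tau> s y w * (F v * rr s x w v)\<bar> \<le> T * C * (exp (- (\<beta> / 32) * (\<Sum>i\<in>S. (w i)\<^sup>2)) * exp (- (\<beta> / 32) * (\<Sum>j\<in>S. (v j)\<^sup>2)))" for w v
        unfolding abs_mult[of "\<tau> s y w"] mult.assoc[of T] using T(1) by (intro mult_mono T(2) C(2)) auto
    qed (use \<beta>_pos in simp)
  qed
  have inner: "(LINT u|leb S. \<tau> s y w * (F u * rr s x w u)) = \<tau> s x w * \<tau> s y w" for w
    unfolding \<tau>_def[of s x] by simp
  have "P x y (s\<^sup>2) = (LINT u|leb S. F u * (LINT v|leb S. LINT w|leb S. rr s x w u * (F v * rr s y w v)))"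
    unfolding P_iterated[OF s2] semigroup[OF s, symmetric] by (simp add: mult_ac)
  also have "\<dots> = (LINT u|leb S. LINT w|leb S. \<tau> s y w * (F u * rr s x w u))"
  proof (intro Bochner_Integration.integral_cong refl)
    fix u
    have "(LINT v|leb S. rr s x w u * (F v * rr s y w v)) = rr s x w u * \<tau> s y w" for w
      by (simp add: \<tau>_def)
    then have "F u * (LINT v|leb S. LINT w|leb S. rr s x w u * (F v * rr s y w v)) = F u * (LINT w|leb S. rr s x w u * \<tau> s y w)"
      by (simp only: fub1)
    also have "\<dots> = (LINT w|leb S. F u * (rr s x w u * \<tau> s y w))" by simp
    also have "\<dots> = (LINT w|leb S. \<tau> s y w * (F u * rr s x w u))"
      by (intro Bochner_Integration.integral_cong refl) simp
    finally show "F u * (LINT v|leb S. LINT w|leb S. rr s x w u * (F v * rr s y w v)) = (LINT w|leb S. \<tau> s y w * (F u * rr s x w u))" .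
  qed
  also have "\<dots> = (LINT w|leb S. LINT u|leb S. \<tau> s y w * (F u * rr s x w u))"
    by (rule P.Fubini_integral[OF int2])
  also have "\<dots> = (LINT w|leb S. \<tau> s x w * \<tau> s y w)"
    by (simp only: inner)
  finally show "P x y (s\<^sup>2) = (LINT w|leb S. \<tau> s x w * \<tau> s y w)" .
  have "integrable (leb S) (\<lambda>w. LINT u|leb S. \<tau> s y w * (F u * rr s x w u))"
    using P.integrable_fst[OF int2] .
  then show "integrable (leb S) (\<lambda>w. \<tau> s x w * \<tau> s y w)"
    unfolding inner .
qed

end

text \<open>\<open>tens_lower\<close> holds pointwise in w and is integrated. The diagonal entries
  of a Gram matrix are nonnegative, and 2ab \<le> a^2 + b^2 reduces the other entries to
  them.\<close>

lemma Phi_lower: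
  assumes t: "0 \<le> t" "t < 1" and x: "x \<in> lists_of m"
  shows "b0 ^ m * P x x t \<le> Phi m t" "0 \<le> P x x t"
    and "y \<in> lists_of m \<Longrightarrow> b0 ^ m * \<bar>P x y t\<bar> \<le> Phi m t"
proof -
  \<comment> \<open>Composing two kernels of parameter s gives correlation s^2 = t.\<close>
  define s where "s = sqrt t"
  have s: "0 \<le> s" "s < 1" and t_eq: "t = s\<^sup>2" using t by (auto simp: s_def)
  have Phi: "Phi m t = (LINT w|leb S. tens m (\<lambda>x y. \<tau> s x w * \<tau> s y w))"
    "integrable (leb S) (\<lambda>w. tens m (\<lambda>x y. \<tau> s x w * \<tau> s y w))"
    unfolding Phi_def t_eq P_semigroup(1)[OF s]
    by (rule tens_integral, rule P_semigroup(2)[OF s])+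
  have P: "P x y t = (LINT w|leb S. \<tau> s x w * \<tau> s y w)" for x y
    unfolding t_eq by (rule P_semigroup(1)[OF s])
  show 0: "0 \<le> P x x t" unfolding P by (intro integral_nonneg_AE AE_I2) simp
  have 1: "b0 ^ m * P x x t \<le> Phi m t" if "x \<in> lists_of m" for x
  proof -
    have "b0 ^ m * P x x t = (LINT w|leb S. b0 ^ m * (\<tau> s x w * \<tau> s x w))" by (simp add: P)
    also have "\<dots> \<le> Phi m t"
      unfolding Phi(1)
      by (rule integral_mono)
        (use P_semigroup(2)[OF s] Phi(2) tens_lower[OF that, of "\<lambda>x. \<tau> s x w" for w] in \<open>auto simp: power2_eq_square\<close>)
    finally show ?thesis .
  qed
  then show "b0 ^ m * P x x t \<le> Phi m t" using x by blast
  assume y: "y \<in> lists_of m"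
  have "\<bar>P x y t\<bar> \<le> (LINT w|leb S. \<bar>\<tau> s x w * \<tau> s y w\<bar>)"
    unfolding P by (rule integral_abs_bound)
  also have "\<dots> \<le> (LINT w|leb S. (1 / 2) * (\<tau> s x w * \<tau> s x w) + (1 / 2) * (\<tau> s y w * \<tau> s y w))"
  proof (rule integral_mono)
    fix w
    have "0 \<le> (\<bar>\<tau> s x w\<bar> - \<bar>\<tau> s y w\<bar>)\<^sup>2" by simp
    then show "\<bar>\<tau> s x w * \<tau> s y w\<bar> \<le> (1 / 2) * (\<tau> s x w * \<tau> s x w) + (1 / 2) * (\<tau> s y w * \<tau> s y w)"
      by (simp add: power2_eq_square algebra_simps abs_mult)
  qed (use P_semigroup(2)[OF s] in auto)
  also have "\<dots> = (1 / 2) * P x x t + (1 / 2) * P y y t"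
    using P_semigroup(2)[OF s] by (simp add: P)
  finally have "b0 ^ m * \<bar>P x y t\<bar> \<le> b0 ^ m * ((1 / 2) * P x x t + (1 / 2) * P y y t)"
    using b0_pos by (intro mult_left_mono) auto
  then show "b0 ^ m * \<bar>P x y t\<bar> \<le> Phi m t"
    using 1[OF x] 1[OF y] by (simp add: algebra_simps)
qed

text \<open>For empty S and positive m there is no index list, and the sum is empty.\<close>

lemma Phi_nonneg: "0 \<le> t \<Longrightarrow> t < 1 \<Longrightarrow> 0 \<le> Phi m t"
proof (cases "lists_of m = {}")
  case False
  assume t: "0 \<le> t" "t < 1"
  from False obtain x where x: "x \<in> lists_of m" by blast
  show ?thesis
    by (rule order_trans[OF _ Phi_lower(1)[OF t x]], rule mult_nonneg_nonneg)
      (use b0_pos Phi_lower(2)[OF t x] in auto)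
qed (simp add: Phi_def tens_eq)

section \<open>The values at t = 0\<close>

definition cF :: "'i list \<Rightarrow> real" where
  "cF x = (LINT u|leb S. F u * g0.G (foldr g0.D x (Cst 1)) 0 u)"

text \<open>At t = 0 the two halves of the pair are independent. The factorisation of the density is
  differentiated in one half at a time.\<close>

lemma gt_G_0: "gt.G (foldr gt.D (map Inl x @ map Inr y) (Cst 1)) 0 (case_sum u v)
    = g0.G (foldr g0.D x (Cst 1)) 0 u * g0.G (foldr g0.D y (Cst 1)) 0 v"
proof (induction x arbitrary: u)
  case Nil
  show ?case
  proof (induction y arbitrary: v)
    case Nil
    have "exp (ev 0 (case_sum u v) Qt) = exp (ev 0 u Q0) * exp (ev 0 v Q0)"
      unfolding exp_add[symmetric] ev_Qt case_sum_o_inj by (simp add: Q0_def ev_bx add_divide_distrib)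
    then show ?case
      unfolding gt.G_def g0.G_def by (simp add: \<kappa>t_def power2_eq_square)
  next
    case (Cons b y)
    let ?e = "foldr gt.D (map Inr y) (Cst 1)"
    have f: "gt.G ?e 0 ((case_sum u v)(Inr b := z)) = g0.G (Cst 1) 0 u * g0.G (foldr g0.D y (Cst 1)) 0 (v(b := z))" for z
      using Cons.IH[of "v(b := z)"] by (simp only: case_sum_upd append_Nil list.map foldr_Nil id_apply)
    have "gt.G (gt.D (Inr b) ?e) 0 ((case_sum u v)(Inr b := v b))
        = g0.G (Cst 1) 0 u * g0.G (g0.D b (foldr g0.D y (Cst 1))) 0 (v(b := v b))"
      using gt.G_D[of ?e 0 "case_sum u v" "Inr b" "v b"] unfolding f
      by (rule DERIV_unique[OF _ DERIV_cmult[OF g0.G_D]])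
    then show ?case
      by (simp only: case_sum_upd(1)[symmetric] fun_upd_triv append_Nil list.map foldr_Cons foldr_Nil comp_apply id_apply)
  qed
next
  case (Cons a x)
  let ?e = "foldr gt.D (map Inl x @ map Inr y) (Cst 1)" and ?g = "g0.G (foldr g0.D y (Cst 1)) 0 v"
  have f: "gt.G ?e 0 ((case_sum u v)(Inl a := z)) = g0.G (foldr g0.D x (Cst 1)) 0 (u(a := z)) * ?g" for z
    using Cons.IH[of "u(a := z)"] by (simp only: case_sum_upd)
  have "gt.G (gt.D (Inl a) ?e) 0 ((case_sum u v)(Inl a := u a))
      = g0.G (g0.D a (foldr g0.D x (Cst 1))) 0 (u(a := u a)) * ?g"
    using gt.G_D[of ?e 0 "case_sum u v" "Inl a" "u a"] unfolding f
    by (rule DERIV_unique[OF _ DERIV_cmult_right[OF g0.G_D]])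
  then show ?case
    by (simp only: case_sum_upd(2)[symmetric] fun_upd_triv append_Cons list.map foldr_Cons comp_apply)
qed

lemma P_0: "P x y 0 = cF x * cF y"
proof -
  have 01: "(0 :: real) \<le> 0" "(0 :: real) < 1" by simp_all
  have "P x y 0 = (LINT u|leb S. LINT v|leb S. (F u * g0.G (foldr g0.D x (Cst 1)) 0 u) * (F v * g0.G (foldr g0.D y (Cst 1)) 0 v))"
    unfolding P_iterated[OF 01] gt_G_0 by (simp add: mult_ac)
  then show ?thesis by (simp add: cF_def)
qed

section \<open>The limit at t = 1\<close>

text \<open>F is locally constant away from the hyperplanes on which a coordinate equals l.\<close>

lemma F_tendsto:
  assumes "\<And>i. i \<in> S \<Longrightarrow> (\<lambda>k. X k i) \<longlonglongrightarrow> u i" "\<forall>i\<in>S. u i \<noteq> l"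
  shows "(\<lambda>k. F (X k)) \<longlonglongrightarrow> F u"
proof (rule tendsto_eventually)
  have "\<forall>\<^sub>F k in sequentially. \<forall>i\<in>S. X k i > l \<longleftrightarrow> u i > l"
  proof (rule eventually_ball_finite[OF finS], intro ballI)
    fix i assume i: "i \<in> S"
    show "\<forall>\<^sub>F k in sequentially. X k i > l \<longleftrightarrow> u i > l"
    proof (cases "u i > l")
      case True
      then show ?thesis by (intro eventually_mono[OF order_tendstoD(1)[OF assms(1)[OF i] True]]) simp
    next
      case False
      then have "u i < l" using assms(2) i by force
      then show ?thesis by (intro eventually_mono[OF order_tendstoD(2)[OF assms(1)[OF i], of l]]) auto
    qed
  qed
  then show "\<forall>\<^sub>F k in sequentially. F (X k) = F u"
    by eventually_elim (auto simp: F_def excursion_set_def intro!: arg_cong[where f = \<Xi>])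
qed

definition EF2 :: real where
  "EF2 = (LINT u|leb S. F u * F u * gaussian_density S K u)"

text \<open>The substitution v = t u + sqrt(1 - t^2) w undoes the passage to the pair density. Now t
  occurs inside F alone, and the limit t = 1 becomes accessible although the density
  degenerates.\<close>

lemma Phi_0_affine:
  assumes t: "0 \<le> t" "t < 1"
  shows "Phi 0 t = (LINT u|leb S. F u * gaussian_density S K u *
    (LINT w|leb S. F (\<lambda>i\<in>S. t * u i + sqrt (1 - t\<^sup>2) * w i) * gaussian_density S K w))"
proof -
  let ?r = "sqrt (1 - t\<^sup>2)"
  have p: "1 - t\<^sup>2 > 0" using t abs_square_less_1[of t] by simp
  have r: "0 < ?r" using p by simp
  have const: "?r ^ card S * \<kappa>t t = \<kappa>0\<^sup>2"
  proof -
    have "?r ^ card S = ((1 - t\<^sup>2) powr (1 / 2)) powr real (card S)"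
      using r p by (simp add: powr_realpow[OF r, symmetric] powr_half_sqrt)
    also have "\<dots> = (1 - t\<^sup>2) powr (real (card S) / 2)" by (simp add: powr_powr)
    finally show ?thesis using p by (simp add: \<kappa>t_def powr_minus)
  qed
  have inner: "(LINT v|leb S. F v * gt.G (Cst 1) t (case_sum u v))
      = gaussian_density S K u * (LINT w|leb S. F (\<lambda>i\<in>S. t * u i + ?r * w i) * gaussian_density S K w)" for u
  proof -
    let ?h = "\<lambda>v. F v * gt.G (Cst 1) t (case_sum u v)" and ?v = "\<lambda>w. \<lambda>i\<in>S. t * u i + ?r * w i"
    have "?h \<in> borel_measurable (leb S)"
    proof (intro borel_measurable_times F_measurable gt.G_measurable measurable_coord)
      show "(\<lambda>w. case_sum u w i) \<in> borel_measurable (leb S)" if "i \<in> S <+> S" for i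
        using that by (auto intro: measurable_coord)
    qed auto
    then have "integral\<^sup>L (leb S) ?h = ?r ^ card S * (LINT w|leb S. ?h (?v w))"
      by (intro integral_leb_affine finS r)
    also have "(LINT w|leb S. ?h (?v w)) = (LINT w|leb S. \<kappa>t t / \<kappa>0\<^sup>2 * (gaussian_density S K u * (F (?v w) * gaussian_density S K w)))"
    proof (intro Bochner_Integration.integral_cong refl)
      fix w
      let ?z = "\<lambda>i. t * u i + ?r * w i"
      have "gt.G (Cst 1) t (case_sum u (?v w)) = gt.G (Cst 1) t (case_sum u ?z)"
        by (rule gt.G_cong) auto
      also have "gt.G (Cst 1) t (case_sum u ?z) = \<kappa>t t / \<kappa>0\<^sup>2 * (gaussian_density S K u * gaussian_density S K w)"
      proof -
        have "bil u u + bil ?z ?z + - 2 * t * bil u ?z = (1 - t\<^sup>2) * (bil u u + bil w w)"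
          unfolding bil_comb bil_add_right[of u t u] using p by (simp add: power2_eq_square algebra_simps)
        then have "ev t (case_sum u ?z) Qt = - bil u u / 2 + - bil w w / 2"
        proof -
          have gen: "- (1 / 2) * (1 / T) * (T * (U + W)) = - U / 2 + - W / 2" if "T \<noteq> 0" for T U W :: real
            using that by (simp add: field_simps)
          assume eq: "bil u u + bil ?z ?z + - 2 * t * bil u ?z = (1 - t\<^sup>2) * (bil u u + bil w w)"
          show ?thesis unfolding ev_Qt case_sum_o_inj eq by (rule gen) (use p in simp)
        qed
        then have e: "exp (ev t (case_sum u ?z) Qt) = exp (- bil u u / 2) * exp (- bil w w / 2)"
          by (simp only: exp_add)
        show ?thesis
          unfolding gt.G_def ev.simps e density_eq using \<kappa>0_pos by (simp add: power2_eq_square)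
      qed
      finally show "?h (?v w) = \<kappa>t t / \<kappa>0\<^sup>2 * (gaussian_density S K u * (F (?v w) * gaussian_density S K w))"
        by simp
    qed
    also have "?r ^ card S * \<dots> = (?r ^ card S * \<kappa>t t) / \<kappa>0\<^sup>2 * (gaussian_density S K u * (LINT w|leb S. F (?v w) * gaussian_density S K w))"
      by simp
    finally show ?thesis unfolding const using \<kappa>0_pos by simp
  qed
  have "Phi 0 t = (LINT u|leb S. F u * (LINT v|leb S. F v * gt.G (Cst 1) t (case_sum u v)))"
    by (simp add: Phi_def P_iterated[OF t] mult.assoc)
  then show ?thesis unfolding inner by (simp add: mult.assoc)
qed

text \<open>Dominated convergence twice, in w and then in u: almost every u avoids the level l in
  all coordinates, and there F is continuous.\<close>

lemma Phi_0_limit: "(\<lambda>k. Phi 0 (1 - 1 / real (Suc k))) \<longlonglongrightarrow> EF2"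
proof -
  let ?X = "\<lambda>k. 1 - 1 / real (Suc k)" and ?\<phi> = "gaussian_density S K"
  let ?v = "\<lambda>k u w. \<lambda>i\<in>S. ?X k * u i + sqrt (1 - (?X k)\<^sup>2) * w i"
  obtain A where A: "A \<ge> 0" "\<And>u. \<bar>F u\<bar> \<le> A" using F_bounded by blast
  interpret sf: sigma_finite_measure "leb S" by (rule sigma_finite_leb[OF finS])
  have X: "?X \<longlonglongrightarrow> 1 - 0"
    by (intro tendsto_diff tendsto_const LIMSEQ_Suc lim_1_over_n)
  have \<phi>0: "0 \<le> ?\<phi> u" for u using \<kappa>0_pos by (simp add: density_eq)
  have v: "(\<lambda>k. ?v k u w i) \<longlonglongrightarrow> u i" if "i \<in> S" for u w i
  proof -
    have "(\<lambda>k. ?X k * u i + sqrt (1 - (?X k)\<^sup>2) * w i) \<longlonglongrightarrow> (1 - 0) * u i + sqrt (1 - (1 - 0)\<^sup>2) * w i"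
      by (intro tendsto_intros X)
    then show ?thesis using that by simp
  qed
  have \<phi>m: "?\<phi> \<in> borel_measurable (leb S)" using integrable_density by (rule borel_measurable_integrable)
  have vm: "(\<lambda>q. F (?v k (fst q) (snd q))) \<in> borel_measurable (leb S \<Otimes>\<^sub>M leb S)" for k
    by (intro F_measurable) (simp add: coord_pair_measurable)
  have vm1: "(\<lambda>w. F (?v k u w)) \<in> borel_measurable (leb S)" for k u
    by (intro F_measurable) (simp add: measurable_coord)
  let ?in = "\<lambda>k u. LINT w|leb S. F (?v k u w) * ?\<phi> w"
  have in_int: "integrable (leb S) (\<lambda>w. F (?v k u w) * ?\<phi> w)" for k u
    by (rule Bochner_Integration.integrable_bound[OF integrable_mult_right[OF integrable_density, of A]])
      (use vm1 \<phi>m A \<phi>0 in \<open>auto intro!: AE_I2 mult_right_mono simp: abs_mult\<close>)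
  have in_le: "\<bar>?in k u\<bar> \<le> A" for k u
  proof -
    have "\<bar>?in k u\<bar> \<le> (LINT w|leb S. \<bar>F (?v k u w) * ?\<phi> w\<bar>)" by (rule integral_abs_bound)
    also have "\<dots> \<le> (LINT w|leb S. A * ?\<phi> w)"
    proof (rule integral_mono)
      show "integrable (leb S) (\<lambda>w. \<bar>F (?v k u w) * ?\<phi> w\<bar>)" using in_int by (rule integrable_abs)
      show "integrable (leb S) (\<lambda>w. A * ?\<phi> w)" using integrable_density by simp
      show "\<bar>F (?v k u w) * ?\<phi> w\<bar> \<le> A * ?\<phi> w" for w
        unfolding abs_mult abs_of_nonneg[OF \<phi>0] by (intro mult_right_mono A(2) \<phi>0)
    qed
    finally show ?thesis by (simp add: total)
  qed
  have in_lim: "(\<lambda>k. ?in k u) \<longlonglongrightarrow> F u" if u: "\<forall>i\<in>S. u i \<noteq> l" for u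
  proof -
    have "(\<lambda>k. ?in k u) \<longlonglongrightarrow> (LINT w|leb S. F u * ?\<phi> w)"
    proof (rule integral_dominated_convergence[where w = "\<lambda>w. A * ?\<phi> w"])
      show "AE w in leb S. (\<lambda>k. F (?v k u w) * ?\<phi> w) \<longlonglongrightarrow> F u * ?\<phi> w"
      proof (rule AE_I2)
        fix w
        have "(\<lambda>k. F (?v k u w)) \<longlonglongrightarrow> F u"
          by (rule F_tendsto[where X = "\<lambda>k. ?v k u w", OF v u])
        then show "(\<lambda>k. F (?v k u w) * ?\<phi> w) \<longlonglongrightarrow> F u * ?\<phi> w"
          by (intro tendsto_mult tendsto_const)
      qed
      show "AE w in leb S. norm (F (?v k u w) * ?\<phi> w) \<le> A * ?\<phi> w" for k
        using A \<phi>0 by (intro AE_I2) (auto intro!: mult_right_mono simp: abs_mult)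
    qed (use \<phi>m vm1 integrable_density in auto)
    then show ?thesis by (simp add: total)
  qed
  have "(\<lambda>k. LINT u|leb S. F u * ?\<phi> u * ?in k u) \<longlonglongrightarrow> (LINT u|leb S. F u * ?\<phi> u * F u)"
  proof (rule integral_dominated_convergence[where w = "\<lambda>u. A * A * ?\<phi> u"])
    have Fm: "F \<in> borel_measurable (leb S)" using F_measurable[OF measurable_coord, of "\<lambda>u. u"] by simp
    show "(\<lambda>u. F u * ?\<phi> u * F u) \<in> borel_measurable (leb S)" using Fm \<phi>m by simp
    show "(\<lambda>u. F u * ?\<phi> u * ?in k u) \<in> borel_measurable (leb S)" for k
    proof -
      have "?in k \<in> borel_measurable (leb S)"
        using vm \<phi>m by (intro sf.borel_measurable_lebesgue_integral) (simp add: case_prod_unfold)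
      then show ?thesis using Fm \<phi>m by simp
    qed
    show "integrable (leb S) (\<lambda>u. A * A * ?\<phi> u)" using integrable_density by simp
    show "AE u in leb S. (\<lambda>k. F u * ?\<phi> u * ?in k u) \<longlonglongrightarrow> F u * ?\<phi> u * F u"
      using AE_leb_coord_neq[OF finS, of l] by eventually_elim (intro tendsto_mult tendsto_const in_lim)
    show "AE u in leb S. norm (F u * ?\<phi> u * ?in k u) \<le> A * A * ?\<phi> u" for k
    proof (rule AE_I2)
      fix u
      have "\<bar>F u\<bar> * \<bar>?in k u\<bar> \<le> A * A" using A by (intro mult_mono A(2) in_le) auto
      then have "(\<bar>F u\<bar> * \<bar>?in k u\<bar>) * ?\<phi> u \<le> (A * A) * ?\<phi> u" by (intro mult_right_mono \<phi>0)
      then show "norm (F u * ?\<phi> u * ?in k u) \<le> A * A * ?\<phi> u"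
        using \<phi>0[of u] by (simp add: abs_mult mult_ac)
    qed
  qed
  also have "(\<lambda>k. LINT u|leb S. F u * ?\<phi> u * ?in k u) = (\<lambda>k. Phi 0 (?X k))"
    by (intro ext Phi_0_affine[symmetric]) auto
  finally show ?thesis by (simp add: EF2_def mult_ac)
qed

sublocale am: abs_monotone Phi EF2
  by unfold_locales (fact Phi_nonneg Phi_integrable Phi_ftc Phi_0_limit)+

text \<open>\<open>Phi_lower\<close> supplies the domination, with constant 1 / b0^m, required by
  \<open>lincomb_to_1\<close>.\<close>

lemma sum_iterated_P:
  assumes "m \<ge> 1"
  shows "(\<Sum>x\<in>lists_of m. \<Sum>y\<in>lists_of m. (\<Prod>i<m. K (x ! i) (y ! i)) * iterated_integral m (P x y) 1)
    = EF2 - (\<Sum>k<m. am.a k)"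
proof -
  obtain n where m: "m = Suc n" using assms by (cases m) auto
  have "(\<Sum>k\<in>lists_of m \<times> lists_of m. (\<Prod>i<m. K (fst k ! i) (snd k ! i)) * iterated_integral (Suc n) (P (fst k) (snd k)) 1)
      = EF2 - (\<Sum>k<Suc n. am.a k)"
  proof (rule am.lincomb_to_1[where C = "1 / b0 ^ m" and h = "\<lambda>k. P (fst k) (snd k)"
        and w = "\<lambda>k. \<Prod>i<m. K (fst k ! i) (snd k ! i)"])
    show "finite (lists_of m \<times> lists_of m)" by (simp add: finite_lists_of)
    show "set_integrable lborel {0..T} (P (fst k) (snd k))" if "0 \<le> T" "T < 1" for T k
      using that by (rule P_integrable)
    show "\<bar>P (fst k) (snd k) t\<bar> \<le> 1 / b0 ^ m * Phi (Suc n) t" if "k \<in> lists_of m \<times> lists_of m" "0 \<le> t" "t < 1" for k t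
    proof -
      have "b0 ^ m * \<bar>P (fst k) (snd k) t\<bar> \<le> Phi m t"
        using that by (intro Phi_lower(3)) auto
      then show ?thesis using b0_pos by (simp add: m field_simps)
    qed
    show "Phi (Suc n) t = (\<Sum>k\<in>lists_of m \<times> lists_of m. (\<Prod>i<m. K (fst k ! i) (snd k ! i)) * P (fst k) (snd k) t)" for t
      unfolding Phi_def tens_eq m[symmetric] by (simp add: sum.cartesian_product case_prod_unfold)
  qed
  then show ?thesis by (simp add: sum.cartesian_product case_prod_unfold m)
qed

end


section \<open>Hermite polynomials and their Gram matrix\<close>

section \<open>Hermite expansion\<close>

context gexc
begin

text \<open>The Hermite polynomial of f for the derivatives listed in z, up to the sign (-1)^(length
  z).\<close>

definition h :: "'i list \<Rightarrow> ('i \<Rightarrow> real) \<Rightarrow> real" where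
  "h z u = ev 0 u (foldr g0.D z (Cst 1))"

definition del :: "'i list \<Rightarrow> nat \<Rightarrow> 'i list" where
  "del z j = take j z @ drop (Suc j) z"

lemma del_Cons_0: "del (a # z) 0 = z" and del_Cons_Suc: "del (a # z) (Suc j) = a # del z j"
  by (simp_all add: del_def)

lemma length_del: "j < length z \<Longrightarrow> length (del z j) = length z - 1"
  by (simp add: del_def)

lemma set_del: "set (del z j) \<subseteq> set z"
  unfolding del_def using set_take_subset set_drop_subset by fastforce

lemma mset_del: "j < length z \<Longrightarrow> mset (z ! j # del z j) = mset z"
proof -
  assume j: "j < length z"
  have "mset z = mset (take j z @ z ! j # drop (Suc j) z)" using id_take_nth_drop[OF j] by simp
  then show ?thesis by (simp add: del_def)
qed

lemma dc_dc_Q0: "a \<in> S \<Longrightarrow> b \<in> S \<Longrightarrow> ev t u (dc b (dc a Q0)) = - B a b"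
proof -
  assume ab: "a \<in> S" "b \<in> S"
  have "((\<lambda>z. - Bv (u(b := z)) a) has_real_derivative - B a b) (at (u b))"
    by (intro DERIV_minus Bv_upd ab)
  moreover have "((\<lambda>z. - Bv (u(b := z)) a) has_real_derivative ev t (u(b := u b)) (dc b (dc a Q0))) (at (u b))"
    using ev_dc[of t u b "dc a Q0" "u b"] by (simp only: dc_Q0[OF ab(1)])
  ultimately show ?thesis using DERIV_unique by fastforce
qed

lemma h_Cons: "a \<in> S \<Longrightarrow> h (a # z) u = ev 0 u (dc a (foldr g0.D z (Cst 1))) - Bv u a * h z u"
  by (simp add: h_def g0.D_def dc_Q0)

text \<open>Differentiation lowers the degree by one. Commuting the b-derivative past
  \<open>D a\<close> produces the second derivative of the exponent, the constant - B a b.\<close>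

lemma dc_h:
  assumes b: "b \<in> S" and z: "set z \<subseteq> S"
  shows "ev 0 u (dc b (foldr g0.D z (Cst 1))) = (\<Sum>j<length z. - B b (z ! j) * h (del z j) u)"
  using z
proof (induction z arbitrary: u)
  case (Cons a z)
  let ?e = "foldr g0.D z (Cst 1)"
  have a: "a \<in> S" using Cons.prems by simp
  have IH: "ev 0 u (dc b ?e) = (\<Sum>j<length z. - B b (z ! j) * ev 0 u (foldr g0.D (del z j) (Cst 1)))" for u
    using Cons by (simp add: h_def)
  have "ev 0 u (dc b (g0.D a ?e)) = ev 0 u (g0.D a (dc b ?e)) - B b a * ev 0 u ?e"
    unfolding g0.D_def using dc_dc_Q0[OF a b, of 0 u] B_sym[OF a b] by (simp add: dc_comm[of 0 u b a] algebra_simps)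
  also have "ev 0 u (g0.D a (dc b ?e)) = (\<Sum>j<length z. - B b (z ! j) * ev 0 u (g0.D a (foldr g0.D (del z j) (Cst 1))))"
    by (rule g0.D_linear[OF _ IH]) simp
  finally show ?case
    by (simp add: sum.lessThan_Suc_shift del_Cons_0 del_Cons_Suc h_def del: sum.lessThan_Suc)
qed simp

lemma vars_h: "vars (foldr g0.D z (Cst 1)) \<subseteq> S"
  by (rule g0.vars_Ds) simp

lemma h_cong: "(\<And>i. i \<in> S \<Longrightarrow> u i = v i) \<Longrightarrow> h z u = h z v"
  unfolding h_def using vars_h[of z] by (intro ev_cong) auto

lemma h_measurable: "(\<And>i. i \<in> S \<Longrightarrow> (\<lambda>w. X w i) \<in> borel_measurable M) \<Longrightarrow> (\<lambda>w. h z (X w)) \<in> borel_measurable M"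
  unfolding h_def using vars_h[of z] by (intro ev_measurable) auto

abbreviation \<phi> where "\<phi> \<equiv> gaussian_density S K"

lemma integrable_h_h: "integrable (leb S) (\<lambda>u. h y u * h z u * \<phi> u)"
  using g0.integrable_G[of "Mul (foldr g0.D y (Cst 1)) (foldr g0.D z (Cst 1))" 0 "\<lambda>_. 1" 0] vars_h[of y] vars_h[of z]
  by (simp add: g0_density h_def)

lemma integrable_F_h: "integrable (leb S) (\<lambda>u. F u * h z u * \<phi> u)"
  using g0.integrable_G[OF vars_h, of 0 \<Xi> l z] by (simp add: g0_density h_def F_def mult.assoc)

lemma integrable_F_F: "integrable (leb S) (\<lambda>u. F u * F u * \<phi> u)"
  using g0.integrable_G[of "Cst 1" 0 "\<lambda>E. \<Xi> E * \<Xi> E" l] by (simp add: g0_density F_def)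

definition gram :: "'i list \<Rightarrow> 'i list \<Rightarrow> real" where
  "gram z y = (LINT u|leb S. h z u * h y u * \<phi> u)"

lemma gram_sym: "gram z y = gram y z"
  by (simp add: gram_def mult.commute)

lemma gram_Nil: "gram [] [] = 1"
  by (simp add: gram_def h_def total)

text \<open>Integrating the b-derivative of the product of both polynomials and the density to 0
  moves the derivative onto \<open>h z\<close>, where \<open>dc_h\<close> applies.\<close>

lemma gram_Cons:
  assumes b: "b \<in> S" and z: "set z \<subseteq> S"
  shows "gram z (b # y) = (\<Sum>j<length z. B b (z ! j) * gram (del z j) y)"
proof -
  let ?z = "foldr g0.D z (Cst 1)" and ?y = "foldr g0.D y (Cst 1)"
  have v: "vars (Mul ?z ?y) \<subseteq> S" using vars_h[of z] vars_h[of y] by simp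
  have "0 = (LINT u|leb S. g0.G (g0.D b (Mul ?z ?y)) 0 u)"
    by (rule g0.integral_G_D[OF v _ _ b, symmetric]) auto
  also have "\<dots> = (LINT u|leb S. h z u * h (b # y) u * \<phi> u - (\<Sum>j<length z. B b (z ! j) * (h (del z j) u * h y u * \<phi> u)))"
  proof (intro Bochner_Integration.integral_cong refl)
    fix u
    have "ev 0 u (g0.D b (Mul ?z ?y)) = ev 0 u (dc b ?z) * h y u + h z u * h (b # y) u"
      by (simp add: g0.D_def h_def algebra_simps)
    also have "\<dots> = h z u * h (b # y) u - (\<Sum>j<length z. B b (z ! j) * h (del z j) u) * h y u"
      unfolding dc_h[OF b z] by (simp add: sum_negf)
    finally show "g0.G (g0.D b (Mul ?z ?y)) 0 u = h z u * h (b # y) u * \<phi> u - (\<Sum>j<length z. B b (z ! j) * (h (del z j) u * h y u * \<phi> u))"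
      unfolding g0_density by (simp only: left_diff_distrib sum_distrib_right mult.assoc)
  qed
  also have "\<dots> = gram z (b # y) - (\<Sum>j<length z. B b (z ! j) * gram (del z j) y)"
    unfolding gram_def by (simp add: integrable_h_h)
  finally show ?thesis by simp
qed

text \<open>\<open>gram_Cons\<close> shortens both lists by one until one of them is
  exhausted.\<close>

lemma gram_length: "set z \<subseteq> S \<Longrightarrow> set y \<subseteq> S \<Longrightarrow> length z \<noteq> length y \<Longrightarrow> gram z y = 0"
proof (induction y arbitrary: z)
  case Nil
  then obtain a z' where "z = a # z'" by (cases z) auto
  with Nil gram_Cons[of a "[]" z'] show ?case using gram_sym[of z "[]"] by simp
next
  case (Cons b y)
  have "gram (del z j) y = 0" if "j < length z" for j
    using Cons.prems that set_del[of z j] by (intro Cons.IH) (auto simp: length_del)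
  then show ?case using Cons.prems by (subst gram_Cons) auto
qed

text \<open>Each step of \<open>gram_Cons\<close> yields a factor B that cancels the next factor K
  and forces a = z_j. By symmetry of c all k positions j contribute equally, and k!
  accumulates.\<close>

lemma tens_gram:
  assumes c: "\<And>x y. mset x = mset y \<Longrightarrow> c x = c y" and z: "z \<in> lists_of k"
  shows "tens k (\<lambda>x y. c x * gram z y) = fact k * c z"
  using assms
proof (induction k arbitrary: c z)
  case 0
  show ?case using 0(2) by (simp add: lists_of_0 gram_Nil)
next
  case (Suc k)
  have z: "set z \<subseteq> S" "length z = Suc k" using Suc.prems(2) by (auto simp: lists_of_def)
  have del: "del z j \<in> lists_of k" if "j < Suc k" for j
    using that z set_del[of z j] length_del[of j z] by (auto simp: lists_of_def)
  have "tens (Suc k) (\<lambda>x y. c x * gram z y)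
      = (\<Sum>a\<in>S. \<Sum>b\<in>S. K a b * tens k (\<lambda>x y. \<Sum>j<Suc k. B b (z ! j) * (c (a # x) * gram (del z j) y)))"
    using z by (simp only: tens.simps, intro sum.cong refl arg_cong2[where f = times] arg_cong[where f = "tens k"] ext)
      (simp only: gram_Cons sum_distrib_left mult.left_commute)
  also have "\<dots> = (\<Sum>a\<in>S. \<Sum>b\<in>S. K a b * (\<Sum>j<Suc k. B b (z ! j) * (fact k * c (a # del z j))))"
  proof (intro sum.cong refl arg_cong2[where f = times])
    fix a b
    have "tens k (\<lambda>x y. c (a # x) * gram (del z j) y) = fact k * c (a # del z j)" if "j < Suc k" for j
    proof (rule Suc.IH[of "\<lambda>x. c (a # x)", OF _ del[OF that]])
      show "c (a # x) = c (a # y)" if "mset x = mset y" for x y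
        by (rule Suc.prems(1)) (simp add: that)
    qed
    then show "tens k (\<lambda>x y. \<Sum>j<Suc k. B b (z ! j) * (c (a # x) * gram (del z j) y))
        = (\<Sum>j<Suc k. B b (z ! j) * (fact k * c (a # del z j)))"
      unfolding tens_sum by (intro sum.cong) auto
  qed
  also have "\<dots> = (\<Sum>j<Suc k. \<Sum>a\<in>S. (\<Sum>b\<in>S. K a b * B b (z ! j)) * (fact k * c (a # del z j)))"
    by (simp only: sum_distrib_left sum_distrib_right mult.assoc sum.swap[of _ "{..<Suc k}" S])
  also have "\<dots> = (\<Sum>j<Suc k. fact k * c z)"
  proof (intro sum.cong refl)
    fix j assume "j \<in> {..<Suc k}"
    then have j: "j < length z" "z ! j \<in> S" using z by (auto simp: subset_iff)
    have "(\<Sum>a\<in>S. (\<Sum>b\<in>S. K a b * B b (z ! j)) * (fact k * c (a # del z j)))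
        = (\<Sum>a\<in>S. if a = z ! j then fact k * c (z ! j # del z j) else 0)"
      using j by (intro sum.cong refl) (simp add: KB)
    also have "\<dots> = fact k * c (z ! j # del z j)" using j finS by simp
    also have "c (z ! j # del z j) = c z" using mset_del[OF j(1)] by (rule Suc.prems(1))
    finally show "(\<Sum>a\<in>S. (\<Sum>b\<in>S. K a b * B b (z ! j)) * (fact k * c (a # del z j))) = fact k * c z" .
  qed
  finally show ?case by simp
qed

lemma cF_h: "cF x = (LINT u|leb S. F u * h x u * \<phi> u)"
  by (simp add: cF_def g0_density h_def mult.assoc)

lemma cF_mset: "mset x = mset y \<Longrightarrow> cF x = cF y"
  unfolding cF_h h_def using g0.Ds_mset[of x y] by simp

section \<open>Chaos components of F\<close>

text \<open>\<open>Y k\<close>, evaluated at \<open>f\<close>, is the projection of \<open>F(f)\<close> onto the \<open>k\<close>-th chaos.\<close>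

definition Y :: "nat \<Rightarrow> ('i \<Rightarrow> real) \<Rightarrow> real" where
  "Y k u = tens k (\<lambda>x y. cF x * h y u) / fact k"

lemma Y_integral:
  assumes "\<And>y. y \<in> lists_of k \<Longrightarrow> integrable (leb S) (\<lambda>u. h y u * r u * \<phi> u)"
  shows "(LINT u|leb S. Y k u * r u * \<phi> u) = tens k (\<lambda>x y. cF x * (LINT u|leb S. h y u * r u * \<phi> u)) / fact k"
    and "integrable (leb S) (\<lambda>u. Y k u * r u * \<phi> u)"
proof -
  have eq: "Y k u * r u * \<phi> u = tens k (\<lambda>x y. cF x * (h y u * r u * \<phi> u)) / fact k" for u
    by (simp add: Y_def tens_eq sum_distrib_right sum_distrib_left mult_ac sum_divide_distrib)
  have i: "integrable (leb S) (\<lambda>u. cF x * (h y u * r u * \<phi> u))" if "y \<in> lists_of k" for x y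
    using assms[OF that] by simp
  have "(LINT u|leb S. Y k u * r u * \<phi> u) = (LINT u|leb S. tens k (\<lambda>x y. cF x * (h y u * r u * \<phi> u))) / fact k"
    unfolding eq by simp
  also have "(LINT u|leb S. tens k (\<lambda>x y. cF x * (h y u * r u * \<phi> u))) = tens k (\<lambda>x y. LINT u|leb S. cF x * (h y u * r u * \<phi> u))"
    by (rule tens_integral(1)[symmetric]) (rule i)
  finally show "(LINT u|leb S. Y k u * r u * \<phi> u) = tens k (\<lambda>x y. cF x * (LINT u|leb S. h y u * r u * \<phi> u)) / fact k"
    by simp
  show "integrable (leb S) (\<lambda>u. Y k u * r u * \<phi> u)"
    unfolding eq by (intro integrable_divide tens_integral(2) i)
qed

text \<open>\<open>Y k\<close> has the same inner products as F with the Hermite polynomials of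
  degree k and is orthogonal to those of other degrees, by \<open>tens_gram\<close> and
  \<open>gram_length\<close>.\<close>

lemma Y_h: "z \<in> lists_of n \<Longrightarrow> (LINT u|leb S. Y k u * h z u * \<phi> u) = (if n = k then cF z else 0)"
proof -
  assume z: "z \<in> lists_of n"
  have "(LINT u|leb S. Y k u * h z u * \<phi> u) = tens k (\<lambda>x y. cF x * gram z y) / fact k"
  proof -
    have "gram y z = gram z y" for y by (rule gram_sym)
    then show ?thesis unfolding Y_integral(1)[OF integrable_h_h] gram_def[symmetric] by simp
  qed
  also have "\<dots> = (if n = k then cF z else 0)"
  proof (cases "n = k")
    case True
    have "tens k (\<lambda>x y. cF x * gram z y) = fact k * cF z"
      using z unfolding True by (intro tens_gram cF_mset)
    then show ?thesis using True by simp
  next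
    case False
    then have "gram z y = 0" if "y \<in> lists_of k" for y
      using that z by (intro gram_length) (auto simp: lists_of_def)
    then show ?thesis using False by (simp add: tens_eq)
  qed
  finally show ?thesis .
qed

lemma am_a: "am.a k = tens k (\<lambda>x y. cF x * cF y) / fact k"
  by (simp add: am.a_def Phi_def P_0)

lemma Y_F: "(LINT u|leb S. Y k u * F u * \<phi> u) = am.a k"
  by (subst Y_integral(1)) (use integrable_F_h in \<open>simp_all add: am_a cF_h mult_ac\<close>)

lemma integrable_Y_h: "integrable (leb S) (\<lambda>u. Y k u * h z u * \<phi> u)"
  by (rule Y_integral(2)) (rule integrable_h_h)

lemma Y_Y: "(LINT u|leb S. Y k u * Y j u * \<phi> u) = (if k = j then am.a k else 0)"
  and integrable_Y_Y: "integrable (leb S) (\<lambda>u. Y k u * Y j u * \<phi> u)"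
proof -
  have i: "integrable (leb S) (\<lambda>u. h y u * Y j u * \<phi> u)" for y
    using integrable_Y_h[of j y] by (simp add: mult_ac)
  show "integrable (leb S) (\<lambda>u. Y k u * Y j u * \<phi> u)" by (rule Y_integral(2)[OF i])
  have "(LINT u|leb S. Y k u * Y j u * \<phi> u) = tens k (\<lambda>x y. cF x * (LINT u|leb S. h y u * Y j u * \<phi> u)) / fact k"
    by (rule Y_integral(1)[OF i])
  also have "\<dots> = tens k (\<lambda>x y. cF x * (if k = j then cF y else 0)) / fact k"
    using Y_h[of _ k j] by (simp add: tens_eq mult.commute[of _ "Y j _"] cong: sum.cong)
  also have "\<dots> = (if k = j then am.a k else 0)"
    by (simp add: am_a tens_eq)
  finally show "(LINT u|leb S. Y k u * Y j u * \<phi> u) = (if k = j then am.a k else 0)" .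
qed

lemma Y_cong: "(\<And>i. i \<in> S \<Longrightarrow> u i = v i) \<Longrightarrow> Y k u = Y k v"
  unfolding Y_def using h_cong[of u v] by simp

lemma Y_measurable: "(\<And>i. i \<in> S \<Longrightarrow> (\<lambda>w. X w i) \<in> borel_measurable M) \<Longrightarrow> (\<lambda>w. Y k (X w)) \<in> borel_measurable M"
  unfolding Y_def tens_eq
  by (intro borel_measurable_divide borel_measurable_sum borel_measurable_times borel_measurable_const h_measurable)

section \<open>Polynomials versus Hermite polynomials\<close>

definition HS :: "nat \<Rightarrow> (('i \<Rightarrow> real) \<Rightarrow> real) set" where
  "HS n = {r. \<exists>c. r = (\<lambda>u. \<Sum>k\<le>n. \<Sum>z\<in>lists_of k. c z * h z u)}"

lemma HS_add: "r \<in> HS n \<Longrightarrow> q \<in> HS n \<Longrightarrow> (\<lambda>u. r u + q u) \<in> HS n"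
proof -
  assume "r \<in> HS n" "q \<in> HS n"
  then obtain c d where "r = (\<lambda>u. \<Sum>k\<le>n. \<Sum>z\<in>lists_of k. c z * h z u)" "q = (\<lambda>u. \<Sum>k\<le>n. \<Sum>z\<in>lists_of k. d z * h z u)"
    by (auto simp: HS_def)
  then show ?thesis
    unfolding HS_def by (intro CollectI exI[of _ "\<lambda>z. c z + d z"]) (simp add: sum.distrib distrib_right)
qed

lemma HS_scale: "r \<in> HS n \<Longrightarrow> (\<lambda>u. a * r u) \<in> HS n"
proof -
  assume "r \<in> HS n"
  then obtain c where "r = (\<lambda>u. \<Sum>k\<le>n. \<Sum>z\<in>lists_of k. c z * h z u)" by (auto simp: HS_def)
  then show ?thesis
    unfolding HS_def by (intro CollectI exI[of _ "\<lambda>z. a * c z"]) (simp add: sum_distrib_left mult.assoc)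
qed

lemma HS_0: "(\<lambda>u. 0) \<in> HS n"
  unfolding HS_def by (intro CollectI exI[of _ "\<lambda>_. 0"]) simp

lemma HS_sum: "(\<And>a. a \<in> A \<Longrightarrow> r a \<in> HS n) \<Longrightarrow> (\<lambda>u. \<Sum>a\<in>A. r a u) \<in> HS n"
  by (induction A rule: infinite_finite_induct) (auto intro: HS_0 HS_add)

lemma HS_h: "z \<in> lists_of k \<Longrightarrow> k \<le> n \<Longrightarrow> h z \<in> HS n"
proof -
  assume z: "z \<in> lists_of k" "k \<le> n"
  have "(\<Sum>j\<le>n. \<Sum>y\<in>lists_of j. (if y = z then 1 else 0) * h y u) = (\<Sum>j\<le>n. if j = k then h z u else 0)" for u
  proof (intro sum.cong refl)
    fix j
    have "(\<Sum>y\<in>lists_of j. (if y = z then 1 else 0) * h y u) = (\<Sum>y\<in>lists_of j. if y = z then h z u else 0)"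
      by (intro sum.cong) auto
    also have "\<dots> = (if j = k then h z u else 0)"
      using z finite_lists_of[of j] by (auto simp: lists_of_def)
    finally show "(\<Sum>y\<in>lists_of j. (if y = z then 1 else 0) * h y u) = (if j = k then h z u else 0)" .
  qed
  then show ?thesis
    unfolding HS_def using z by (intro CollectI exI[of _ "\<lambda>y. if y = z then 1 else 0"]) auto
qed

text \<open>Writing u_a as row a of K applied to \<open>Bv u\<close>, the recurrence
  \<open>h_Cons\<close> expresses each product of \<open>Bv u b\<close> with \<open>h z\<close> by
  Hermite polynomials one degree lower and one degree higher.\<close>

lemma HS_coord:
  assumes a: "a \<in> S" and r: "r \<in> HS n"
  shows "(\<lambda>u. u a * r u) \<in> HS (Suc n)"
proof -
  have one: "(\<lambda>u. u a * h z u) \<in> HS (Suc n)" if z: "z \<in> lists_of k" and k: "k \<le> n" for z k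
  proof -
    have zS: "set z \<subseteq> S" "length z = k" using z by (auto simp: lists_of_def)
    have "u a * h z u = (\<Sum>b\<in>S. K a b * ((\<Sum>j<length z. - B b (z ! j) * h (del z j) u) + (-1) * h (b # z) u))" for u
    proof -
      have "u a * h z u = (\<Sum>b\<in>S. K a b * (Bv u b * h z u))"
        unfolding K_Bv[OF a, of u, symmetric] by (simp only: sum_distrib_right mult.assoc)
      also have "\<dots> = (\<Sum>b\<in>S. K a b * ((\<Sum>j<length z. - B b (z ! j) * h (del z j) u) + (-1) * h (b # z) u))"
        using dc_h[OF _ zS(1)] h_Cons[of _ z u] by (intro sum.cong refl) simp
      finally show ?thesis .
    qed
    moreover have "(\<lambda>u. \<Sum>b\<in>S. K a b * ((\<Sum>j<length z. - B b (z ! j) * h (del z j) u) + (-1) * h (b # z) u)) \<in> HS (Suc n)"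
    proof (intro HS_sum HS_scale HS_add)
      fix b assume b: "b \<in> S"
      show "h (b # z) \<in> HS (Suc n)"
        by (rule HS_h[of _ "Suc k"]) (use b zS k in \<open>auto simp: lists_of_def\<close>)
      fix j assume "j \<in> {..<length z}"
      then show "h (del z j) \<in> HS (Suc n)"
        using zS set_del[of z j] length_del[of j z] k by (intro HS_h[of _ "k - 1"]) (auto simp: lists_of_def)
    qed
    ultimately show ?thesis by simp
  qed
  from r obtain c where r: "r = (\<lambda>u. \<Sum>k\<le>n. \<Sum>z\<in>lists_of k. c z * h z u)" by (auto simp: HS_def)
  have "(\<lambda>u. u a * r u) = (\<lambda>u. \<Sum>k\<le>n. \<Sum>z\<in>lists_of k. c z * (u a * h z u))"
    by (simp add: r sum_distrib_left mult.left_commute)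
  moreover have "(\<lambda>u. \<Sum>k\<le>n. \<Sum>z\<in>lists_of k. c z * (u a * h z u)) \<in> HS (Suc n)"
    by (intro HS_sum HS_scale one) auto
  ultimately show ?thesis by simp
qed

lemma HS_mono: "n \<le> m \<Longrightarrow> r \<in> HS n \<Longrightarrow> r \<in> HS m"
proof -
  assume n: "n \<le> m" and "r \<in> HS n"
  then obtain c where r: "r = (\<lambda>u. \<Sum>k\<le>n. \<Sum>z\<in>lists_of k. c z * h z u)" by (auto simp: HS_def)
  show ?thesis unfolding r by (intro HS_sum HS_scale) (erule HS_h, use n in simp)
qed

definition PF :: "nat \<Rightarrow> (('i \<Rightarrow> real) \<Rightarrow> real) set" where
  "PF n = {\<lambda>u. \<Sum>\<alpha>\<in>A. c \<alpha> * (\<Prod>x\<in>S. u x ^ \<alpha> x) | (A :: ('i \<Rightarrow> nat) set) c.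
      finite A \<and> (\<forall>\<alpha>\<in>A. (\<Sum>x\<in>S. \<alpha> x) \<le> n)}"

lemma prod_upd: "a \<in> S \<Longrightarrow> (\<Prod>x\<in>S. (u x :: real) ^ (\<alpha>(a := Suc (\<alpha> a))) x) = u a * (\<Prod>x\<in>S. u x ^ \<alpha> x)"
  using finS by (simp add: prod.remove[of S a])

lemma sum_upd: "a \<in> S \<Longrightarrow> (\<Sum>x\<in>S. (\<alpha>(a := Suc (\<alpha> a))) x) = Suc (\<Sum>x\<in>S. \<alpha> x)"
  using finS by (simp add: sum.remove[of S a])

lemma monomial_HS: "(\<Sum>x\<in>S. \<alpha> x) = n \<Longrightarrow> (\<lambda>u. \<Prod>x\<in>S. u x ^ \<alpha> x) \<in> HS n"
proof (induction n arbitrary: \<alpha>)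
  case 0
  then have "(\<lambda>u. \<Prod>x\<in>S. u x ^ \<alpha> x) = h []" using finS by (auto simp: h_def)
  then show ?case using HS_h[of "[]" 0 0] by (simp add: lists_of_0)
next
  case (Suc n)
  then obtain a where a: "a \<in> S" "\<alpha> a > 0" using finS by (metis sum_eq_0_iff bot_nat_0.not_eq_extremum nat.distinct(1))
  define \<alpha>' where "\<alpha>' = \<alpha>(a := \<alpha> a - 1)"
  have \<alpha>: "\<alpha> = \<alpha>'(a := Suc (\<alpha>' a))" using a by (auto simp: \<alpha>'_def)
  have "(\<Sum>x\<in>S. \<alpha>' x) = n" using Suc.prems sum_upd[OF a(1), of \<alpha>'] \<alpha> by simp
  from HS_coord[OF a(1) Suc.IH[OF this]] show ?case
    by (subst \<alpha>, subst prod_upd[OF a(1)])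
qed

text \<open>Used to test orthogonality to all polynomials on Hermite polynomials alone; the converse
  \<open>h_PF\<close> places the components \<open>Y k\<close> among the polynomials.\<close>

lemma PF_HS: "PF n \<subseteq> HS n"
proof
  fix r assume "r \<in> PF n"
  then obtain A c where r: "r = (\<lambda>u. \<Sum>\<alpha>\<in>A. c \<alpha> * (\<Prod>x\<in>S. u x ^ \<alpha> x))" "\<forall>\<alpha>\<in>A. (\<Sum>x\<in>S. \<alpha> x) \<le> n"
    by (auto simp: PF_def)
  show "r \<in> HS n" unfolding r(1)
    by (intro HS_sum HS_scale HS_mono[OF _ monomial_HS[OF refl]]) (use r(2) in auto)
qed

lemma PF_mono: "n \<le> m \<Longrightarrow> r \<in> PF n \<Longrightarrow> r \<in> PF m"
  unfolding PF_def by (auto intro: order_trans)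

lemma PF_scale: "r \<in> PF n \<Longrightarrow> (\<lambda>u. a * r u) \<in> PF n"
proof -
  assume "r \<in> PF n"
  then obtain A c where "r = (\<lambda>u. \<Sum>\<alpha>\<in>A. c \<alpha> * (\<Prod>x\<in>S. u x ^ \<alpha> x))" "finite A" "\<forall>\<alpha>\<in>A. (\<Sum>x\<in>S. \<alpha> x) \<le> n"
    by (auto simp: PF_def)
  then show ?thesis
    unfolding PF_def by (intro CollectI exI[of _ A] exI[of _ "\<lambda>\<alpha>. a * c \<alpha>"]) (simp add: sum_distrib_left mult.assoc)
qed

lemma PF_add: "r \<in> PF n \<Longrightarrow> q \<in> PF n \<Longrightarrow> (\<lambda>u. r u + q u) \<in> PF n"
proof -
  assume "r \<in> PF n" "q \<in> PF n"
  then obtain A c A' c' where r: "r = (\<lambda>u. \<Sum>\<alpha>\<in>A. c \<alpha> * (\<Prod>x\<in>S. u x ^ \<alpha> x))" "finite A" "\<forall>\<alpha>\<in>A. (\<Sum>x\<in>S. \<alpha> x) \<le> n"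
    and q: "q = (\<lambda>u. \<Sum>\<alpha>\<in>A'. c' \<alpha> * (\<Prod>x\<in>S. u x ^ \<alpha> x))" "finite A'" "\<forall>\<alpha>\<in>A'. (\<Sum>x\<in>S. \<alpha> x) \<le> n"
    unfolding PF_def by blast
  have ext: "(\<Sum>\<alpha>\<in>A0. c0 \<alpha> * (\<Prod>x\<in>S. u x ^ \<alpha> x)) = (\<Sum>\<alpha>\<in>A \<union> A'. (if \<alpha> \<in> A0 then c0 \<alpha> else 0) * (\<Prod>x\<in>S. u x ^ \<alpha> x))"
    if "A0 \<subseteq> A \<union> A'" for A0 c0 and u :: "'i \<Rightarrow> real"
    using that r(2) q(2) by (intro sum.mono_neutral_cong_left) auto
  show ?thesis
    unfolding PF_def
    by (intro CollectI exI[of _ "A \<union> A'"] exI[of _ "\<lambda>\<alpha>. (if \<alpha> \<in> A then c \<alpha> else 0) + (if \<alpha> \<in> A' then c' \<alpha> else 0)"])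
      (use r q ext[of A c] ext[of A' c'] in \<open>auto simp: sum.distrib distrib_right\<close>)
qed

lemma PF_0: "(\<lambda>u. 0) \<in> PF n"
  unfolding PF_def by (intro CollectI exI[of _ "{}"]) auto

lemma PF_1: "(\<lambda>u. 1) \<in> PF n"
  unfolding PF_def by (intro CollectI exI[of _ "{\<lambda>_. 0}"] exI[of _ "\<lambda>_. 1"]) auto

lemma PF_sum: "(\<And>a. a \<in> A \<Longrightarrow> r a \<in> PF n) \<Longrightarrow> (\<lambda>u. \<Sum>a\<in>A. r a u) \<in> PF n"
  by (induction A rule: infinite_finite_induct) (auto intro: PF_0 PF_add)

lemma PF_coord:
  assumes a: "a \<in> S" and r: "r \<in> PF n"
  shows "(\<lambda>u. u a * r u) \<in> PF (Suc n)"
proof -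
  from r obtain A c where r: "r = (\<lambda>u. \<Sum>\<alpha>\<in>A. c \<alpha> * (\<Prod>x\<in>S. u x ^ \<alpha> x))" "finite A" "\<forall>\<alpha>\<in>A. (\<Sum>x\<in>S. \<alpha> x) \<le> n"
    by (auto simp: PF_def)
  have "(\<lambda>u. u a * r u) = (\<lambda>u. \<Sum>\<alpha>\<in>A. c \<alpha> * (u a * (\<Prod>x\<in>S. u x ^ \<alpha> x)))"
    by (simp add: r(1) sum_distrib_left mult.left_commute)
  moreover have "(\<lambda>u. \<Sum>\<alpha>\<in>A. c \<alpha> * (u a * (\<Prod>x\<in>S. u x ^ \<alpha> x))) \<in> PF (Suc n)"
  proof (intro PF_sum PF_scale)
    fix \<alpha> assume \<alpha>: "\<alpha> \<in> A"
    show "(\<lambda>u. u a * (\<Prod>x\<in>S. u x ^ \<alpha> x)) \<in> PF (Suc n)"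
      unfolding PF_def
      by (intro CollectI exI[of _ "{\<alpha>(a := Suc (\<alpha> a))}"] exI[of _ "\<lambda>_. 1"])
        (use r(3) \<alpha> in \<open>simp add: prod_upd[OF a] sum_upd[OF a] del: fun_upd_apply\<close>)
  qed
  ultimately show ?thesis by simp
qed

lemma h_PF: "z \<in> lists_of k \<Longrightarrow> h z \<in> PF k"
proof (induction k arbitrary: z rule: less_induct)
  case (less k)
  then have zS: "set z \<subseteq> S" "length z = k" by (auto simp: lists_of_def)
  show ?case
  proof (cases z)
    case Nil
    then have "h z = (\<lambda>u. 1)" by (auto simp: h_def)
    then show ?thesis using PF_1 by simp
  next
    case (Cons a z')
    then have a: "a \<in> S" "set z' \<subseteq> S" "k = Suc (length z')" using zS by auto
    have "h z = (\<lambda>u. (\<Sum>j<length z'. - B a (z' ! j) * h (del z' j) u) + (\<Sum>b\<in>S. - B a b * (u b * h z' u)))"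
      using a by (auto simp: Cons h_Cons dc_h Bv_def sum_distrib_right mult.assoc sum_negf)
    moreover have "\<dots> \<in> PF k"
    proof (intro PF_add PF_sum PF_scale)
      fix j assume j: "j \<in> {..<length z'}"
      have "h (del z' j) \<in> PF (length z' - 1)"
        using j a set_del[of z' j] length_del[of j z'] by (intro less.IH) (auto simp: lists_of_def)
      then show "h (del z' j) \<in> PF k" by (rule PF_mono[rotated]) (use a in simp)
    next
      fix b assume b: "b \<in> S"
      have "h z' \<in> PF (length z')" using a by (intro less.IH) (auto simp: lists_of_def)
      then show "(\<lambda>u. u b * h z' u) \<in> PF k" using PF_coord[OF b] a by simp
    qed
    ultimately show ?thesis by simp
  qed
qed

lemma Y_PF: "Y k \<in> PF k"
proof -
  have "Y k = (\<lambda>u. \<Sum>x\<in>lists_of k. \<Sum>y\<in>lists_of k. ((\<Prod>i<k. K (x ! i) (y ! i)) * cF x / fact k) * h y u)"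
    by (auto simp: Y_def tens_eq sum_divide_distrib mult_ac)
  moreover have "\<dots> \<in> PF k" by (intro PF_sum PF_scale h_PF)
  ultimately show ?thesis by simp
qed


end


section \<open>Chaos decomposition\<close>

lemma L2_mult_integrable:
  assumes "X \<in> L2 M" "Y \<in> L2 M"
  shows "integrable M (\<lambda>\<omega>. X \<omega> * Y \<omega>)"
proof (rule Bochner_Integration.integrable_bound)
  show "integrable M (\<lambda>\<omega>. (X \<omega>)\<^sup>2 + (Y \<omega>)\<^sup>2)" using assms by (auto simp: L2_def)
  show "(\<lambda>\<omega>. X \<omega> * Y \<omega>) \<in> borel_measurable M" using assms by (auto simp: L2_def)
  show "AE \<omega> in M. norm (X \<omega> * Y \<omega>) \<le> norm ((X \<omega>)\<^sup>2 + (Y \<omega>)\<^sup>2)"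
  proof (rule AE_I2)
    fix \<omega>
    have "0 \<le> (\<bar>X \<omega>\<bar> - \<bar>Y \<omega>\<bar>)\<^sup>2" by simp
    then have "2 * (\<bar>X \<omega>\<bar> * \<bar>Y \<omega>\<bar>) \<le> (X \<omega>)\<^sup>2 + (Y \<omega>)\<^sup>2" by (simp add: power2_diff)
    moreover have "0 \<le> \<bar>X \<omega>\<bar> * \<bar>Y \<omega>\<bar>" by simp
    ultimately have "\<bar>X \<omega>\<bar> * \<bar>Y \<omega>\<bar> \<le> (X \<omega>)\<^sup>2 + (Y \<omega>)\<^sup>2" by linarith
    then show "norm (X \<omega> * Y \<omega>) \<le> norm ((X \<omega>)\<^sup>2 + (Y \<omega>)\<^sup>2)" by (simp add: abs_mult)
  qed
qed

lemma L2_scale: "X \<in> L2 M \<Longrightarrow> (\<lambda>\<omega>. a * X \<omega>) \<in> L2 M"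
  by (auto simp: L2_def power_mult_distrib)

lemma L2_add: "X \<in> L2 M \<Longrightarrow> Y \<in> L2 M \<Longrightarrow> (\<lambda>\<omega>. X \<omega> + Y \<omega>) \<in> L2 M"
  using L2_mult_integrable[of X M Y] by (auto simp: L2_def power2_sum mult.assoc)

lemma L2_diff: "X \<in> L2 M \<Longrightarrow> Y \<in> L2 M \<Longrightarrow> (\<lambda>\<omega>. X \<omega> - Y \<omega>) \<in> L2 M"
  using L2_add[of X M "\<lambda>\<omega>. (-1) * Y \<omega>"] L2_scale[of Y M "-1"] by simp

lemma L2_0: "(\<lambda>\<omega>. 0) \<in> L2 M"
  by (simp add: L2_def)

lemma L2_sum: "(\<And>a. a \<in> A \<Longrightarrow> X a \<in> L2 M) \<Longrightarrow> (\<lambda>\<omega>. \<Sum>a\<in>A. X a \<omega>) \<in> L2 M"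
  by (induction A rule: infinite_finite_induct) (auto intro: L2_0 L2_add)

lemma L2_closure_subset: "P \<inter> L2 M \<subseteq> L2_closure M P"
proof
  fix X assume X: "X \<in> P \<inter> L2 M"
  have "\<exists>Y\<in>P \<inter> L2 M. (LINT \<omega>|M. (X \<omega> - Y \<omega>)\<^sup>2) < e" if "e > 0" for e
    using X that by (intro bexI[of _ X]) auto
  then show "X \<in> L2_closure M P" using X by (auto simp: L2_closure_def)
qed

text \<open>Approximate Z by Y in P and bound the product of W and Z - Y by a weighted sum of
  squares.\<close>

lemma L2_closure_orthogonal:
  assumes W: "W \<in> L2 M" and orth: "\<And>Y. Y \<in> P \<Longrightarrow> Y \<in> L2 M \<Longrightarrow> (LINT \<omega>|M. W \<omega> * Y \<omega>) = 0"
    and Z: "Z \<in> L2_closure M P"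
  shows "(LINT \<omega>|M. W \<omega> * Z \<omega>) = 0"
proof -
  let ?i = "LINT \<omega>|M. W \<omega> * Z \<omega>" and ?w = "LINT \<omega>|M. (W \<omega>)\<^sup>2"
  have ZL: "Z \<in> L2 M" using Z by (simp add: L2_closure_def)
  have w0: "0 \<le> ?w" by simp
  have le: "\<bar>?i\<bar> \<le> e * (?w + 1)" if e: "e > 0" for e
  proof -
    \<comment> \<open>Accuracy e^2, because the weight 1 / e in front of the error turns it into
      e.\<close>
    from Z e obtain Y where Y: "Y \<in> P" "Y \<in> L2 M" and lt: "(LINT \<omega>|M. (Z \<omega> - Y \<omega>)\<^sup>2) < e\<^sup>2"
      unfolding L2_closure_def by (auto dest: spec[of _ "e\<^sup>2"])
    have V: "(\<lambda>\<omega>. Z \<omega> - Y \<omega>) \<in> L2 M" using ZL Y by (intro L2_diff)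
    have "?i = ?i - (LINT \<omega>|M. W \<omega> * Y \<omega>)" using orth[OF Y] by simp
    also have "\<dots> = (LINT \<omega>|M. W \<omega> * Z \<omega> - W \<omega> * Y \<omega>)"
      using W ZL Y by (intro Bochner_Integration.integral_diff[symmetric] L2_mult_integrable)
    finally have i: "?i = (LINT \<omega>|M. W \<omega> * (Z \<omega> - Y \<omega>))" by (simp add: right_diff_distrib)
    have "\<bar>?i\<bar> \<le> (LINT \<omega>|M. \<bar>W \<omega> * (Z \<omega> - Y \<omega>)\<bar>)"
      unfolding i by (rule integral_abs_bound)
    also have "\<dots> \<le> (LINT \<omega>|M. e * (W \<omega>)\<^sup>2 + (1 / e) * (Z \<omega> - Y \<omega>)\<^sup>2)"
    proof (rule integral_mono)
      show "integrable M (\<lambda>\<omega>. \<bar>W \<omega> * (Z \<omega> - Y \<omega>)\<bar>)"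
        by (intro integrable_abs L2_mult_integrable W V)
      show "integrable M (\<lambda>\<omega>. e * (W \<omega>)\<^sup>2 + (1 / e) * (Z \<omega> - Y \<omega>)\<^sup>2)"
        using W V by (auto simp: L2_def)
      fix \<omega>
      let ?a = "\<bar>W \<omega>\<bar>" and ?b = "\<bar>Z \<omega> - Y \<omega>\<bar>"
      have "0 \<le> (e * ?a - ?b)\<^sup>2 + 2 * (e * ?a * ?b)" using e by simp
      moreover have "2 * (e * ?a * ?b) \<le> (e * ?a)\<^sup>2 + ?b\<^sup>2" using zero_le_power2[of "e * ?a - ?b"] by (simp add: power2_diff)
      moreover have "0 \<le> e * ?a * ?b" using e by simp
      ultimately have "e * (?a * ?b) \<le> e * (e * ?a\<^sup>2 + (1 / e) * ?b\<^sup>2)"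
        using e by (simp add: power_mult_distrib power2_eq_square algebra_simps)
      then have "?a * ?b \<le> e * ?a\<^sup>2 + (1 / e) * ?b\<^sup>2" using e by (rule mult_left_le_imp_le)
      then show "\<bar>W \<omega> * (Z \<omega> - Y \<omega>)\<bar> \<le> e * (W \<omega>)\<^sup>2 + (1 / e) * (Z \<omega> - Y \<omega>)\<^sup>2"
        by (simp add: abs_mult)
    qed
    also have "\<dots> = e * ?w + (1 / e) * (LINT \<omega>|M. (Z \<omega> - Y \<omega>)\<^sup>2)"
      using W V by (simp add: L2_def)
    also have "\<dots> \<le> e * ?w + (1 / e) * e\<^sup>2"
      using lt e by (intro add_left_mono mult_left_mono) auto
    also have "\<dots> = e * (?w + 1)" using e by (simp add: power2_eq_square algebra_simps)
    finally show ?thesis .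
  qed
  have "\<bar>?i\<bar> \<le> 0 + e" if "e > 0" for e
  proof -
    have w1: "?w + 1 > 0" using w0 by linarith
    then have "e / (?w + 1) * (?w + 1) = e" by simp
    with le[OF divide_pos_pos[OF that w1]] show ?thesis by simp
  qed
  then have "\<bar>?i\<bar> \<le> 0" by (rule field_le_epsilon)
  then show ?thesis by simp
qed

lemma L2_dist_0_AE:
  assumes "X \<in> L2 M" "Y \<in> L2 M" "(LINT \<omega>|M. (X \<omega> - Y \<omega>)\<^sup>2) = 0"
  shows "AE \<omega> in M. X \<omega> = Y \<omega>"
proof -
  have "integrable M (\<lambda>\<omega>. (X \<omega> - Y \<omega>)\<^sup>2)" using L2_diff[OF assms(1,2)] by (simp add: L2_def)
  then have "AE \<omega> in M. (X \<omega> - Y \<omega>)\<^sup>2 = 0"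
    using integral_nonneg_eq_0_iff_AE[of M "\<lambda>\<omega>. (X \<omega> - Y \<omega>)\<^sup>2"] assms(3) by simp
  then show ?thesis by eventually_elim simp
qed

section \<open>Transfer between coordinate space and probability space\<close>

locale gchaos = gexc S K \<Xi> l + prob_space M
  for S :: "'i set" and K \<Xi> l and M :: "'a measure" +
  fixes f :: "'i \<Rightarrow> 'a \<Rightarrow> real"
  assumes dist: "distributed M (leb S) (\<lambda>\<omega>. \<lambda>i\<in>S. f i \<omega>) (\<lambda>u. ennreal (gaussian_density S K u))"
begin

text \<open>Points of \<open>leb S\<close> are undefined off S, whereas the sample vector of f is
  not restricted. Dependence on the coordinates in S alone reconciles the two.\<close>

definition cyl :: "(('i \<Rightarrow> real) \<Rightarrow> real) \<Rightarrow> bool" where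
  "cyl r \<longleftrightarrow> r \<in> borel_measurable (leb S) \<and> (\<forall>u v. (\<forall>i\<in>S. u i = v i) \<longrightarrow> r u = r v)"

definition rv :: "(('i \<Rightarrow> real) \<Rightarrow> real) \<Rightarrow> 'a \<Rightarrow> real" where
  "rv r \<omega> = r (\<lambda>i. f i \<omega>)"

lemma cylI: "r \<in> borel_measurable (leb S) \<Longrightarrow> (\<And>u v. (\<And>i. i \<in> S \<Longrightarrow> u i = v i) \<Longrightarrow> r u = r v) \<Longrightarrow> cyl r"
  unfolding cyl_def by blast

lemma cyl_measurable: "cyl r \<Longrightarrow> r \<in> borel_measurable (leb S)"
  unfolding cyl_def by (rule conjunct1)

lemma cyl_cong: "cyl r \<Longrightarrow> (\<And>i. i \<in> S \<Longrightarrow> u i = v i) \<Longrightarrow> r u = r v"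
  unfolding cyl_def by blast

lemma rv_restrict: "cyl r \<Longrightarrow> rv r = (\<lambda>\<omega>. r (\<lambda>i\<in>S. f i \<omega>))"
  unfolding rv_def[abs_def] by (rule ext, erule cyl_cong) simp

lemma \<phi>_nonneg: "0 \<le> \<phi> u"
  using \<kappa>0_pos by (simp add: density_eq)

lemma rv_measurable: "cyl r \<Longrightarrow> rv r \<in> borel_measurable M"
  using measurable_compose[OF distributed_measurable[OF dist] cyl_measurable] by (simp add: rv_restrict)

lemma rv_integral: "cyl r \<Longrightarrow> (LINT \<omega>|M. rv r \<omega>) = (LINT u|leb S. r u * \<phi> u)"
  using distributed_integral[OF dist cyl_measurable \<phi>_nonneg] by (simp add: rv_restrict mult.commute)

lemma rv_integrable: "cyl r \<Longrightarrow> integrable M (rv r) \<longleftrightarrow> integrable (leb S) (\<lambda>u. r u * \<phi> u)"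
  using distributed_integrable[OF dist cyl_measurable \<phi>_nonneg] by (simp add: rv_restrict mult.commute)

lemma cyl_mult:
  assumes "cyl r" "cyl q"
  shows "cyl (\<lambda>u. r u * q u)"
proof (rule cylI)
  show "(\<lambda>u. r u * q u) \<in> borel_measurable (leb S)"
    by (intro borel_measurable_times cyl_measurable assms)
  fix u v :: "'i \<Rightarrow> real" assume "\<And>i. i \<in> S \<Longrightarrow> u i = v i"
  then have "r u = r v" "q u = q v" by (auto intro: cyl_cong assms)
  then show "r u * q u = r v * q v" by simp
qed

lemma cyl_h: "cyl (h z)"
  by (rule cylI, rule h_measurable, erule measurable_coord, rule h_cong)

lemma cyl_Y: "cyl (Y k)"
  by (rule cylI, rule Y_measurable, erule measurable_coord, rule Y_cong)

lemma cyl_F: "cyl F"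
  by (rule cylI, rule F_measurable, erule measurable_coord, rule F_cong)

lemma rv_mult_integral: "cyl r \<Longrightarrow> cyl q \<Longrightarrow> (LINT \<omega>|M. rv r \<omega> * rv q \<omega>) = (LINT u|leb S. r u * q u * \<phi> u)"
  using rv_integral[OF cyl_mult, of r q] by (simp add: rv_def)

lemma rv_L2: "cyl r \<Longrightarrow> integrable (leb S) (\<lambda>u. r u * r u * \<phi> u) \<Longrightarrow> rv r \<in> L2 M"
  using rv_integrable[OF cyl_mult, of r r] rv_measurable[of r] by (simp add: L2_def rv_def[abs_def] power2_eq_square)

lemma L2_h: "rv (h z) \<in> L2 M" and L2_Y: "rv (Y k) \<in> L2 M" and L2_F: "rv F \<in> L2 M"
  using integrable_h_h integrable_Y_Y integrable_F_F by (auto intro!: rv_L2 cyl_h cyl_Y cyl_F)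

lemma PF_rv: "polynomial_rvs S f n = rv ` PF n"
proof (intro equalityI subsetI)
  fix Z assume "Z \<in> polynomial_rvs S f n"
  then have "\<exists>A c. Z = (\<lambda>\<omega>. \<Sum>\<alpha>\<in>A. c \<alpha> * (\<Prod>x\<in>S. f x \<omega> ^ \<alpha> x)) \<and> finite A \<and> (\<forall>\<alpha>\<in>A. (\<Sum>x\<in>S. \<alpha> x) \<le> n)"
    unfolding polynomial_rvs_def by (rule CollectD)
  then show "Z \<in> rv ` PF n"
  proof (elim exE conjE)
    fix A c assume Z: "Z = (\<lambda>\<omega>. \<Sum>\<alpha>\<in>A. c \<alpha> * (\<Prod>x\<in>S. f x \<omega> ^ \<alpha> x))" "finite A" "\<forall>\<alpha>\<in>A. (\<Sum>x\<in>S. \<alpha> x) \<le> n"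
    show "Z \<in> rv ` PF n"
    proof (rule rev_image_eqI)
      show "(\<lambda>u. \<Sum>\<alpha>\<in>A. c \<alpha> * (\<Prod>x\<in>S. u x ^ \<alpha> x)) \<in> PF n"
        unfolding PF_def by (rule CollectI, rule exI[of _ A], rule exI[of _ c], rule conjI[OF refl conjI[OF Z(2,3)]])
      show "Z = rv (\<lambda>u. \<Sum>\<alpha>\<in>A. c \<alpha> * (\<Prod>x\<in>S. u x ^ \<alpha> x))" unfolding Z(1) rv_def[abs_def] ..
    qed
  qed
next
  fix Z assume "Z \<in> rv ` PF n"
  then obtain r where r: "r \<in> PF n" "Z = rv r" by blast
  have "\<exists>A c. r = (\<lambda>u. \<Sum>\<alpha>\<in>A. c \<alpha> * (\<Prod>x\<in>S. u x ^ \<alpha> x)) \<and> finite A \<and> (\<forall>\<alpha>\<in>A. (\<Sum>x\<in>S. \<alpha> x) \<le> n)"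
    using r(1) unfolding PF_def by (rule CollectD)
  then show "Z \<in> polynomial_rvs S f n"
  proof (elim exE conjE)
    fix A c assume A: "r = (\<lambda>u. \<Sum>\<alpha>\<in>A. c \<alpha> * (\<Prod>x\<in>S. u x ^ \<alpha> x))" "finite A" "\<forall>\<alpha>\<in>A. (\<Sum>x\<in>S. \<alpha> x) \<le> n"
    have "Z = (\<lambda>\<omega>. \<Sum>\<alpha>\<in>A. c \<alpha> * (\<Prod>x\<in>S. f x \<omega> ^ \<alpha> x))" unfolding r(2) A(1) rv_def[abs_def] ..
    then show "Z \<in> polynomial_rvs S f n"
      unfolding polynomial_rvs_def by (intro CollectI exI[of _ A] exI[of _ c] conjI A(2,3))
  qed
qed

lemma PF_hE:
  assumes "r \<in> PF n"
  obtains c where "r = (\<lambda>u. \<Sum>k\<le>n. \<Sum>z\<in>lists_of k. c z * h z u)"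
  using subsetD[OF PF_HS assms] unfolding HS_def by (elim CollectE exE)

text \<open>Polynomials of degree at most n are combinations of Hermite polynomials of degree at
  most n, and orthogonality extends to the closure.\<close>

lemma orth_PF:
  assumes W: "W \<in> L2 M" and orth: "\<And>k z. k \<le> n \<Longrightarrow> z \<in> lists_of k \<Longrightarrow> (LINT \<omega>|M. W \<omega> * rv (h z) \<omega>) = 0"
    and Z: "Z \<in> L2_closure M (polynomial_rvs S f n)"
  shows "(LINT \<omega>|M. W \<omega> * Z \<omega>) = 0"
proof (rule L2_closure_orthogonal[OF W _ Z])
  fix Y assume "Y \<in> polynomial_rvs S f n"
  then obtain r where r: "r \<in> PF n" "Y = rv r" unfolding PF_rv by blast
  from r(1) obtain c where c: "r = (\<lambda>u. \<Sum>k\<le>n. \<Sum>z\<in>lists_of k. c z * h z u)" by (rule PF_hE)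
  have Yeq: "Y \<omega> = (\<Sum>k\<le>n. \<Sum>z\<in>lists_of k. c z * rv (h z) \<omega>)" for \<omega>
    unfolding r(2) c rv_def ..
  have "(LINT \<omega>|M. W \<omega> * Y \<omega>) = (LINT \<omega>|M. (\<Sum>k\<le>n. \<Sum>z\<in>lists_of k. c z * (W \<omega> * rv (h z) \<omega>)))"
    unfolding Yeq by (simp only: sum_distrib_left mult.left_commute)
  also have "\<dots> = (\<Sum>k\<le>n. \<Sum>z\<in>lists_of k. c z * (LINT \<omega>|M. W \<omega> * rv (h z) \<omega>))"
    using L2_mult_integrable[OF W L2_h] by (simp add: Bochner_Integration.integral_sum)
  also have "\<dots> = 0" by (intro sum.neutral ballI) (use orth in auto)
  finally show "(LINT \<omega>|M. W \<omega> * Y \<omega>) = 0" .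
qed

lemma Y_orth: "n < k \<Longrightarrow> Z \<in> L2_closure M (polynomial_rvs S f n) \<Longrightarrow> (LINT \<omega>|M. rv (Y k) \<omega> * Z \<omega>) = 0"
  by (rule orth_PF[OF L2_Y]) (auto simp: rv_mult_integral cyl_Y cyl_h Y_h)

section \<open>Residuals, projections and the chaos tail\<close>

text \<open>The sum stops before n, so \<open>res (Suc n)\<close> is orthogonal to degree at most n,
  and \<open>res m\<close> is the candidate for the tail starting at m.\<close>

definition res :: "nat \<Rightarrow> 'a \<Rightarrow> real" where
  "res n \<omega> = rv F \<omega> - (\<Sum>k<n. rv (Y k) \<omega>)"

lemma L2_res: "res n \<in> L2 M"
  unfolding res_def[abs_def] by (intro L2_diff L2_sum L2_F L2_Y)

lemma res_mult:
  assumes "cyl q" "rv q \<in> L2 M"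
  shows "(LINT \<omega>|M. res n \<omega> * rv q \<omega>) = (LINT u|leb S. F u * q u * \<phi> u) - (\<Sum>k<n. LINT u|leb S. Y k u * q u * \<phi> u)"
proof -
  have "(LINT \<omega>|M. res n \<omega> * rv q \<omega>) = (LINT \<omega>|M. rv F \<omega> * rv q \<omega> - (\<Sum>k<n. rv (Y k) \<omega> * rv q \<omega>))"
    by (simp add: res_def left_diff_distrib sum_distrib_right)
  also have "\<dots> = (LINT \<omega>|M. rv F \<omega> * rv q \<omega>) - (\<Sum>k<n. LINT \<omega>|M. rv (Y k) \<omega> * rv q \<omega>)"
    using assms L2_mult_integrable[OF L2_F assms(2)] L2_mult_integrable[OF L2_Y assms(2)] by simp
  finally show ?thesis using assms by (simp add: rv_mult_integral cyl_F cyl_Y)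
qed

lemma res_orth: "Z \<in> L2_closure M (polynomial_rvs S f n) \<Longrightarrow> (LINT \<omega>|M. res (Suc n) \<omega> * Z \<omega>) = 0"
proof (rule orth_PF[OF L2_res])
  fix k z assume "k \<le> n" "z \<in> lists_of k"
  then show "(LINT \<omega>|M. res (Suc n) \<omega> * rv (h z) \<omega>) = 0"
    by (simp add: res_mult cyl_h L2_h Y_h cF_h[symmetric] del: sum.lessThan_Suc)
qed

text \<open>Pythagoras: the residual is orthogonal to the components already subtracted.\<close>

lemma res_norm: "(LINT \<omega>|M. (res n \<omega>)\<^sup>2) = EF2 - (\<Sum>k<n. am.a k)"
proof -
  have "(LINT \<omega>|M. (res n \<omega>)\<^sup>2) = (LINT \<omega>|M. res n \<omega> * rv F \<omega> - (\<Sum>k<n. res n \<omega> * rv (Y k) \<omega>))"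
    by (simp add: res_def power2_eq_square right_diff_distrib sum_distrib_left)
  also have "\<dots> = (LINT \<omega>|M. res n \<omega> * rv F \<omega>) - (\<Sum>k<n. LINT \<omega>|M. res n \<omega> * rv (Y k) \<omega>)"
    using L2_mult_integrable[OF L2_res L2_F] L2_mult_integrable[OF L2_res L2_Y] by simp
  also have "(LINT \<omega>|M. res n \<omega> * rv F \<omega>) = EF2 - (\<Sum>k<n. am.a k)"
    by (simp add: res_mult cyl_F L2_F Y_F EF2_def)
  also have "(\<Sum>k<n. LINT \<omega>|M. res n \<omega> * rv (Y k) \<omega>) = 0"
  proof (rule sum.neutral, rule ballI)
    fix k assume "k \<in> {..<n}"
    then show "(LINT \<omega>|M. res n \<omega> * rv (Y k) \<omega>) = 0"
      using Y_F[of k] by (simp add: res_mult cyl_Y L2_Y Y_Y mult.commute[of "F _"])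
  qed
  finally show ?thesis by simp
qed

lemma Y_polynomial: "rv (Y k) \<in> L2_closure M (polynomial_rvs S f k)"
  using L2_closure_subset[of "polynomial_rvs S f k" M] L2_Y Y_PF by (auto simp: PF_rv)

lemma Y_closure_mono: "k \<le> n \<Longrightarrow> rv (Y k) \<in> L2_closure M (polynomial_rvs S f n)"
  using L2_closure_subset[of "polynomial_rvs S f n" M] L2_Y PF_mono[OF _ Y_PF] by (auto simp: PF_rv)

lemma Y_chaos: "rv (Y k) \<in> chaos M S f k"
  using Y_polynomial Y_orth by (cases k) auto

lemma chaos_L2: "chaos M S f k \<subseteq> L2 M"
  by (cases k) (auto simp: L2_closure_def)

lemma Y_proj: "Z \<in> chaos M S f k \<Longrightarrow> (LINT \<omega>|M. (rv F \<omega> - rv (Y k) \<omega>) * Z \<omega>) = 0"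
proof -
  assume Z: "Z \<in> chaos M S f k"
  then have ZL: "Z \<in> L2 M" using chaos_L2 by blast
  have cl: "Z \<in> L2_closure M (polynomial_rvs S f k)" using Z by (cases k) auto
  have orth: "(LINT \<omega>|M. rv (Y j) \<omega> * Z \<omega>) = 0" if "j < k" for j
  proof (cases k)
    case (Suc n)
    then have "(LINT \<omega>|M. Z \<omega> * rv (Y j) \<omega>) = 0"
      using Z that Y_closure_mono[of j n] by auto
    then show ?thesis by (simp add: mult.commute)
  qed (use that in simp)
  have "0 = (LINT \<omega>|M. res (Suc k) \<omega> * Z \<omega>)" using res_orth[OF cl] by simp
  also have "\<dots> = (LINT \<omega>|M. (rv F \<omega> - rv (Y k) \<omega>) * Z \<omega> - (\<Sum>j<k. rv (Y j) \<omega> * Z \<omega>))"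
    by (intro Bochner_Integration.integral_cong refl) (simp add: res_def algebra_simps sum_distrib_left)
  also have "\<dots> = (LINT \<omega>|M. (rv F \<omega> - rv (Y k) \<omega>) * Z \<omega>) - (\<Sum>j<k. LINT \<omega>|M. rv (Y j) \<omega> * Z \<omega>)"
    using L2_mult_integrable[OF L2_diff[OF L2_F L2_Y] ZL] L2_mult_integrable[OF L2_Y ZL] by simp
  also have "(\<Sum>j<k. LINT \<omega>|M. rv (Y j) \<omega> * Z \<omega>) = 0" by (intro sum.neutral) (use orth in auto)
  finally show ?thesis by simp
qed

text \<open>The choice by \<open>SOME\<close> is fixed up to null sets: the difference of two
  candidates lies in the chaos and is orthogonal to it, hence to itself.\<close>

lemma chaos_proj_AE:
  shows "chaos_proj M S f k (rv F) \<in> L2 M" and "AE \<omega> in M. chaos_proj M S f k (rv F) \<omega> = rv (Y k) \<omega>"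
proof -
  let ?Q = "chaos_proj M S f k (rv F)"
  have "\<exists>Y. Y \<in> chaos M S f k \<and> (\<forall>Z\<in>chaos M S f k. (LINT \<omega>|M. (rv F \<omega> - Y \<omega>) * Z \<omega>) = 0)"
    using Y_chaos Y_proj by blast
  from someI_ex[OF this] have Q: "?Q \<in> chaos M S f k" "\<And>Z. Z \<in> chaos M S f k \<Longrightarrow> (LINT \<omega>|M. (rv F \<omega> - ?Q \<omega>) * Z \<omega>) = 0"
    unfolding chaos_proj_def by auto
  show QL: "?Q \<in> L2 M" using Q(1) chaos_L2 by blast
  have d: "(LINT \<omega>|M. (?Q \<omega> - rv (Y k) \<omega>) * Z \<omega>) = 0" if Z: "Z \<in> chaos M S f k" for Z
  proof -
    have ZL: "Z \<in> L2 M" using Z chaos_L2 by blast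
    have "(LINT \<omega>|M. (?Q \<omega> - rv (Y k) \<omega>) * Z \<omega>) = (LINT \<omega>|M. (rv F \<omega> - rv (Y k) \<omega>) * Z \<omega> - (rv F \<omega> - ?Q \<omega>) * Z \<omega>)"
      by (simp add: algebra_simps)
    also have "\<dots> = 0"
      using Y_proj[OF Z] Q(2)[OF Z] L2_mult_integrable[OF L2_diff[OF L2_F L2_Y] ZL] L2_mult_integrable[OF L2_diff[OF L2_F QL] ZL]
      by simp
    finally show ?thesis .
  qed
  have D: "(\<lambda>\<omega>. ?Q \<omega> - rv (Y k) \<omega>) \<in> L2 M" by (intro L2_diff QL L2_Y)
  have "(LINT \<omega>|M. (?Q \<omega> - rv (Y k) \<omega>)\<^sup>2)
      = (LINT \<omega>|M. (?Q \<omega> - rv (Y k) \<omega>) * ?Q \<omega> - (?Q \<omega> - rv (Y k) \<omega>) * rv (Y k) \<omega>)"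
    by (simp add: power2_eq_square right_diff_distrib)
  also have "\<dots> = 0"
    using d[OF Q(1)] d[OF Y_chaos] L2_mult_integrable[OF D QL] L2_mult_integrable[OF D L2_Y] by simp
  finally show "AE \<omega> in M. ?Q \<omega> = rv (Y k) \<omega>"
    by (rule L2_dist_0_AE[OF QL L2_Y])
qed

text \<open>Almost everywhere the difference is - \<open>res n\<close>, so the distance is the
  Taylor tail, which \<open>sums_E\<close> sends to 0.\<close>

lemma tail_dist:
  assumes "m \<le> n"
  shows "(LINT \<omega>|M. ((\<Sum>k\<in>{m..<n}. chaos_proj M S f k (rv F) \<omega>) - res m \<omega>)\<^sup>2) = EF2 - (\<Sum>k<n. am.a k)"
proof -
  have "AE \<omega> in M. \<forall>k\<in>{m..<n}. chaos_proj M S f k (rv F) \<omega> = rv (Y k) \<omega>"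
    using chaos_proj_AE(2) by (intro AE_finite_allI) auto
  then have "AE \<omega> in M. ((\<Sum>k\<in>{m..<n}. chaos_proj M S f k (rv F) \<omega>) - res m \<omega>)\<^sup>2 = (res n \<omega>)\<^sup>2"
  proof eventually_elim
    fix \<omega> assume "\<forall>k\<in>{m..<n}. chaos_proj M S f k (rv F) \<omega> = rv (Y k) \<omega>"
    then have "(\<Sum>k\<in>{m..<n}. chaos_proj M S f k (rv F) \<omega>) - res m \<omega>
        = ((\<Sum>k<m. rv (Y k) \<omega>) + (\<Sum>k\<in>{m..<n}. rv (Y k) \<omega>)) - rv F \<omega>"
      by (simp add: res_def)
    also have "(\<Sum>k<m. rv (Y k) \<omega>) + (\<Sum>k\<in>{m..<n}. rv (Y k) \<omega>) = (\<Sum>k<n. rv (Y k) \<omega>)"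
      using assms by (simp add: lessThan_atLeast0 sum.atLeastLessThan_concat)
    finally have "(\<Sum>k\<in>{m..<n}. chaos_proj M S f k (rv F) \<omega>) - res m \<omega> = - res n \<omega>"
      unfolding res_def[of n] by simp
    then show "((\<Sum>k\<in>{m..<n}. chaos_proj M S f k (rv F) \<omega>) - res m \<omega>)\<^sup>2 = (res n \<omega>)\<^sup>2"
      by simp
  qed
  moreover have "(\<lambda>\<omega>. (\<Sum>k\<in>{m..<n}. chaos_proj M S f k (rv F) \<omega>) - res m \<omega>) \<in> L2 M" "res n \<in> L2 M"
    by (intro L2_diff L2_sum chaos_proj_AE(1) L2_res)+
  ultimately have "(LINT \<omega>|M. ((\<Sum>k\<in>{m..<n}. chaos_proj M S f k (rv F) \<omega>) - res m \<omega>)\<^sup>2) = (LINT \<omega>|M. (res n \<omega>)\<^sup>2)"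
    by (intro integral_cong_AE) (auto simp: L2_def)
  then show ?thesis by (simp add: res_norm)
qed

text \<open>\<open>res m\<close> witnesses that the limit exists, and L2 limits are unique almost
  everywhere, so the chosen tail agrees with it.\<close>

lemma tail_AE:
  shows "chaos_tail M S f m (rv F) \<in> L2 M" and "AE \<omega> in M. chaos_tail M S f m (rv F) \<omega> = res m \<omega>"
proof -
  let ?s = "\<lambda>n \<omega>. \<Sum>k\<in>{m..<n}. chaos_proj M S f k (rv F) \<omega>"
  have sL: "?s n \<in> L2 M" for n by (intro L2_sum chaos_proj_AE(1))
  have "(\<lambda>n. EF2 - (\<Sum>k<n. am.a k)) \<longlonglongrightarrow> EF2 - EF2"
    by (intro tendsto_diff tendsto_const am.sums_E)
  moreover have "\<forall>\<^sub>F n in sequentially. EF2 - (\<Sum>k<n. am.a k) = (LINT \<omega>|M. (?s n \<omega> - res m \<omega>)\<^sup>2)"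
    using eventually_ge_at_top[of m] by eventually_elim (simp add: tail_dist)
  ultimately have lim0: "(\<lambda>n. LINT \<omega>|M. (?s n \<omega> - res m \<omega>)\<^sup>2) \<longlonglongrightarrow> 0"
    by (auto intro: Lim_transform_eventually)
  then have "\<exists>T. T \<in> L2 M \<and> (\<lambda>n. LINT \<omega>|M. (?s n \<omega> - T \<omega>)\<^sup>2) \<longlonglongrightarrow> 0"
    using L2_res by blast
  from someI_ex[OF this] have T: "chaos_tail M S f m (rv F) \<in> L2 M"
    "(\<lambda>n. LINT \<omega>|M. (?s n \<omega> - chaos_tail M S f m (rv F) \<omega>)\<^sup>2) \<longlonglongrightarrow> 0"
    unfolding chaos_tail_def by auto
  let ?T = "chaos_tail M S f m (rv F)"
  show "?T \<in> L2 M" by (rule T(1))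
  have "(LINT \<omega>|M. (?T \<omega> - res m \<omega>)\<^sup>2) \<le> 2 * (LINT \<omega>|M. (?s n \<omega> - ?T \<omega>)\<^sup>2) + 2 * (LINT \<omega>|M. (?s n \<omega> - res m \<omega>)\<^sup>2)" for n
  proof -
    have i: "integrable M (\<lambda>\<omega>. (?s n \<omega> - ?T \<omega>)\<^sup>2)" "integrable M (\<lambda>\<omega>. (?s n \<omega> - res m \<omega>)\<^sup>2)"
      "integrable M (\<lambda>\<omega>. (?T \<omega> - res m \<omega>)\<^sup>2)"
      using L2_diff[OF sL T(1)] L2_diff[OF sL L2_res] L2_diff[OF T(1) L2_res] by (simp_all add: L2_def)
    have "(LINT \<omega>|M. (?T \<omega> - res m \<omega>)\<^sup>2) \<le> (LINT \<omega>|M. 2 * (?s n \<omega> - ?T \<omega>)\<^sup>2 + 2 * (?s n \<omega> - res m \<omega>)\<^sup>2)"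
    proof (rule integral_mono)
      fix \<omega>
      have "(b - c)\<^sup>2 \<le> 2 * (a - b)\<^sup>2 + 2 * (a - c)\<^sup>2" for a b c :: real
        using zero_le_power2[of "(a - b) + (a - c)"] by (simp add: power2_eq_square algebra_simps)
      then show "(?T \<omega> - res m \<omega>)\<^sup>2 \<le> 2 * (?s n \<omega> - ?T \<omega>)\<^sup>2 + 2 * (?s n \<omega> - res m \<omega>)\<^sup>2" .
    qed (use i in auto)
    then show ?thesis using i by simp
  qed
  moreover have "(\<lambda>n. 2 * (LINT \<omega>|M. (?s n \<omega> - ?T \<omega>)\<^sup>2) + 2 * (LINT \<omega>|M. (?s n \<omega> - res m \<omega>)\<^sup>2)) \<longlonglongrightarrow> 2 * 0 + 2 * 0"
    by (intro tendsto_intros T lim0)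
  ultimately have "(LINT \<omega>|M. (?T \<omega> - res m \<omega>)\<^sup>2) \<le> 2 * 0 + 2 * 0"
    by (intro LIMSEQ_le_const[of "\<lambda>n. 2 * (LINT \<omega>|M. (?s n \<omega> - ?T \<omega>)\<^sup>2) + 2 * (LINT \<omega>|M. (?s n \<omega> - res m \<omega>)\<^sup>2)"]) auto
  then have "(LINT \<omega>|M. (?T \<omega> - res m \<omega>)\<^sup>2) = 0"
    by (intro antisym integral_nonneg_AE AE_I2) auto
  then show "AE \<omega> in M. ?T \<omega> = res m \<omega>" by (rule L2_dist_0_AE[OF T(1) L2_res])
qed

text \<open>For m \<ge> 1 the residual is orthogonal to the constant \<open>h []\<close>. Its mean
  is thus 0, and the variance is the second moment.\<close>

lemma variance_tail:
  assumes "m \<ge> 1"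
  shows "variance (chaos_tail M S f m (rv F)) = EF2 - (\<Sum>k<m. am.a k)"
proof -
  let ?T = "chaos_tail M S f m (rv F)"
  obtain n where m: "m = Suc n" using assms by (cases m) auto
  have [measurable]: "?T \<in> borel_measurable M" "res m \<in> borel_measurable M"
    using tail_AE(1) L2_res by (auto simp: L2_def)
  have "expectation ?T = expectation (res m)"
    using tail_AE(2) by (intro integral_cong_AE) auto
  also have "\<dots> = (LINT \<omega>|M. res (Suc n) \<omega> * rv (h []) \<omega>)"
    by (simp add: m rv_def h_def)
  also have "\<dots> = 0"
    by (simp add: res_mult cyl_h L2_h Y_h[of _ 0] lists_of_0 cF_h[symmetric] del: sum.lessThan_Suc)
  finally have "variance ?T = expectation (\<lambda>\<omega>. (?T \<omega>)\<^sup>2)" by simp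
  also have "\<dots> = expectation (\<lambda>\<omega>. (res m \<omega>)\<^sup>2)"
  proof (rule integral_cong_AE)
    show "AE \<omega> in M. (?T \<omega>)\<^sup>2 = (res m \<omega>)\<^sup>2" using tail_AE(2)[of m] by eventually_elim simp
  qed auto
  finally show ?thesis by (simp add: res_norm)
qed

end


section \<open>Pivotal intensities\<close>

lemma gaussian_density_cong:
  assumes "\<And>i j. i \<in> I \<Longrightarrow> j \<in> I \<Longrightarrow> C i j = C' i j"
  shows "gaussian_density I C = gaussian_density I C'"
proof -
  have "set_inverse I C = set_inverse I C'"
    unfolding set_inverse_def using assms by simp
  moreover have "set_det I C = set_det I C'"
    unfolding set_det_def using assms
    by (intro sum.cong refl arg_cong2[where f = times] prod.cong) (auto simp: permutes_in_image)
  ultimately show ?thesis by (intro ext) (simp add: gaussian_density_def)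
qed

lemma pos_def_cong:
  assumes "\<And>i j. i \<in> I \<Longrightarrow> j \<in> I \<Longrightarrow> C i j = C' i j" "pos_def I C'"
  shows "pos_def I C"
  using assms unfolding pos_def_def by simp

lemma pos_def_subset:
  assumes I: "finite I" and C: "pos_def I C" and J: "J \<subseteq> I"
  shows "pos_def J C"
  unfolding pos_def_def
proof (intro conjI allI impI)
  show "\<forall>i\<in>J. \<forall>j\<in>J. C i j = C j i" using C J unfolding pos_def_def by blast
  fix a :: "'a \<Rightarrow> real" assume a: "\<exists>i\<in>J. a i \<noteq> 0"
  define b where "b i = (if i \<in> J then a i else 0)" for i
  have "\<exists>i\<in>I. b i \<noteq> 0" using a J by (auto simp: b_def)
  then have "0 < (\<Sum>i\<in>I. \<Sum>j\<in>I. b i * C i j * b j)" using C unfolding pos_def_def by blast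
  also have "\<dots> = (\<Sum>i\<in>I. \<Sum>j\<in>J. b i * C i j * b j)"
    using I J by (intro sum.cong refl sum.mono_neutral_right) (auto simp: b_def)
  also have "\<dots> = (\<Sum>i\<in>J. \<Sum>j\<in>J. b i * C i j * b j)"
    using I J by (intro sum.mono_neutral_right) (auto simp: b_def)
  also have "\<dots> = (\<Sum>i\<in>J. \<Sum>j\<in>J. a i * C i j * a j)"
    by (intro sum.cong refl) (simp add: b_def)
  finally show "0 < (\<Sum>i\<in>J. \<Sum>j\<in>J. a i * C i j * a j)" .
qed

text \<open>The hypothesis concerns the density after truncation to \<open>ennreal\<close>. A
  nonpositive prefactor would make that 0, so the density is positive and the real integral
  agrees.\<close>

lemma integral_gaussian_density:
  assumes "prob_space M" "nondegenerate_gaussian M D f K"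
  shows "integral\<^sup>L (leb D) (gaussian_density D K) = 1"
proof -
  interpret prob_space M by fact
  have dist: "distributed M (leb D) (\<lambda>\<omega>. \<lambda>i\<in>D. f i \<omega>) (\<lambda>u. ennreal (gaussian_density D K u))"
    using assms(2) by (simp add: nondegenerate_gaussian_def)
  have one: "(\<integral>\<^sup>+u. ennreal (gaussian_density D K u) \<partial>leb D) = 1"
    using distributed_nn_integral[OF dist, of "\<lambda>_. 1"] emeasure_space_1 by simp
  define k where "k = 1 / sqrt ((2 * pi) ^ card D * set_det D K)"
  have eq: "gaussian_density D K u = k * exp (- (\<Sum>i\<in>D. \<Sum>j\<in>D. u i * set_inverse D K i j * u j) / 2)" for u
    by (simp add: gaussian_density_def k_def)
  have "\<not> k \<le> 0"
  proof
    assume "k \<le> 0"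
    then have "ennreal (gaussian_density D K u) = 0" for u
      unfolding eq by (intro ennreal_neg mult_nonpos_nonneg) auto
    with one show False by simp
  qed
  then have nn: "0 \<le> gaussian_density D K u" for u by (simp add: eq)
  have "integral\<^sup>L (leb D) (gaussian_density D K) = (\<integral>u. gaussian_density D K u * 1 \<partial>leb D)" by simp
  also have "\<dots> = (\<integral>\<omega>. 1 \<partial>M)"
    by (rule distributed_integral[OF dist]) (auto simp: nn)
  finally show ?thesis by (simp add: prob_space)
qed

context gcov
begin

lemma bilK_pos: "i \<in> S \<Longrightarrow> u i \<noteq> 0 \<Longrightarrow> 0 < bilK u u"
  using pdK unfolding pos_def_def bilK_def by blast

text \<open>The variance of a linear combination of f and its interpolation, written in the
  independent vectors f and its copy: their coefficients are a + t b and sqrt(1 - t^2) b.\<close>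

lemma pair_cov_form: "(\<Sum>i\<in>S <+> S. \<Sum>j\<in>S <+> S. a i * pair_cov K t i j * a j)
    = bilK (\<lambda>i. 1 * a (Inl i) + t * a (Inr i)) (\<lambda>i. 1 * a (Inl i) + t * a (Inr i)) + (1 - t\<^sup>2) * bilK (\<lambda>i. a (Inr i)) (\<lambda>i. a (Inr i))"
proof -
  have "(\<Sum>i\<in>S <+> S. \<Sum>j\<in>S <+> S. a i * pair_cov K t i j * a j)
      = bilK (\<lambda>i. a (Inl i)) (\<lambda>i. a (Inl i)) + t * bilK (\<lambda>i. a (Inl i)) (\<lambda>i. a (Inr i))
        + (t * bilK (\<lambda>i. a (Inr i)) (\<lambda>i. a (Inl i)) + bilK (\<lambda>i. a (Inr i)) (\<lambda>i. a (Inr i)))"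
    using finS by (simp add: sum.Plus pair_cov_def bilK_def sum.distrib sum_distrib_left mult.left_commute mult.assoc)
  then show ?thesis
    unfolding bilK_lin_left bilK_lin_right by (simp add: algebra_simps power2_eq_square)
qed

lemma pos_def_pair:
  assumes "t\<^sup>2 < 1"
  shows "pos_def (S <+> S) (pair_cov K t)"
  unfolding pos_def_def
proof (intro conjI allI impI)
  show "\<forall>i\<in>S <+> S. \<forall>j\<in>S <+> S. pair_cov K t i j = pair_cov K t j i"
    using K_sym by (auto simp: pair_cov_def)
  fix a :: "'i + 'i \<Rightarrow> real" assume a: "\<exists>i\<in>S <+> S. a i \<noteq> 0"
  let ?u = "\<lambda>i. 1 * a (Inl i) + t * a (Inr i)" and ?v = "\<lambda>i. a (Inr i)"
  have "0 < bilK ?u ?u + (1 - t\<^sup>2) * bilK ?v ?v"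
  proof (cases "\<exists>i\<in>S. ?v i \<noteq> 0")
    case True
    then have "0 < (1 - t\<^sup>2) * bilK ?v ?v" using bilK_pos[of _ ?v] assms by auto
    then show ?thesis using bilK_nonneg[of ?u] by linarith
  next
    case False
    then obtain i where "i \<in> S" "?u i \<noteq> 0" using a by force
    then have "0 < bilK ?u ?u" by (rule bilK_pos)
    moreover have "0 \<le> (1 - t\<^sup>2) * bilK ?v ?v" using bilK_nonneg assms by simp
    ultimately show ?thesis by linarith
  qed
  then show "0 < (\<Sum>i\<in>S <+> S. \<Sum>j\<in>S <+> S. a i * pair_cov K t i j * a j)" unfolding pair_cov_form .
qed

lemma sum_scaled_KB: "i \<in> S \<Longrightarrow> j \<in> S \<Longrightarrow> (\<Sum>k\<in>S. (a * K i k) * (b * B k j)) = a * b * (if i = j then 1 else 0)"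
proof -
  assume "i \<in> S" "j \<in> S"
  have "(\<Sum>k\<in>S. (a * K i k) * (b * B k j)) = a * b * (\<Sum>k\<in>S. K i k * B k j)"
    by (simp add: sum_distrib_left mult_ac)
  with KB[OF \<open>i \<in> S\<close> \<open>j \<in> S\<close>] show ?thesis by simp
qed

text \<open>The block ansatz with r B on the diagonal and s B off it leaves exactly these two scalar
  equations. They are kept as hypotheses so that no fraction enters the computation.\<close>

lemma set_inverse_pair_cov:
  assumes t: "t\<^sup>2 < 1" and rs: "r + t * s = 1" "s + t * r = 0" and ij: "i \<in> S <+> S" "j \<in> S <+> S"
  shows "set_inverse (S <+> S) (pair_cov K t) i j = (case i of
      Inl x \<Rightarrow> (case j of Inl y \<Rightarrow> r * B x y | Inr y \<Rightarrow> s * B x y)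
    | Inr x \<Rightarrow> (case j of Inl y \<Rightarrow> s * B x y | Inr y \<Rightarrow> r * B x y))" (is "_ = ?B i j")
proof (rule set_inverse_eqI[OF _ pos_def_pair[OF t] _ ij])
  show "finite (S <+> S)" using finS by simp
  have KB1: "(\<Sum>k\<in>S. K i k * (b * B k j)) = b * (if i = j then 1 else 0)" if "i \<in> S" "j \<in> S" for i j b
    using sum_scaled_KB[OF that, of 1 b] by simp
  have rs': "t * s + r = 1" "t * r + s = 0" using rs by simp_all
  fix i j assume "i \<in> S <+> S" "j \<in> S <+> S"
  then show "(\<Sum>k\<in>S <+> S. pair_cov K t i k * ?B k j) = (if i = j then 1 else 0)"
    by (elim PlusE) (simp_all add: sum.Plus finS pair_cov_def KB1 sum_scaled_KB rs rs')
qed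

lemma density_pair:
  assumes t: "t\<^sup>2 < 1"
  shows "gaussian_density (S <+> S) (pair_cov K t) = gt.G (Cst 1) t"
proof
  fix u :: "'i + 'i \<Rightarrow> real"
  let ?u = "u \<circ> Inl" and ?v = "u \<circ> Inr" and ?r = "1 / (1 - t\<^sup>2)" and ?s = "- t / (1 - t\<^sup>2)"
  have pos: "0 < 1 - t\<^sup>2" using t by simp
  then have rs: "?r + t * ?s = 1" "?s + t * ?r = 0" by (simp_all add: divide_simps power2_eq_square)
  have "(\<Sum>i\<in>S <+> S. \<Sum>j\<in>S <+> S. u i * set_inverse (S <+> S) (pair_cov K t) i j * u j)
      = ?r * bil ?u ?u + ?s * bil ?u ?v + (?s * bil ?v ?u + ?r * bil ?v ?v)"
    using finS
    by (simp add: sum.Plus set_inverse_pair_cov[OF t rs] bil_def sum.distrib sum_distrib_left mult.left_commute mult.assoc)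
  also have "\<dots> = ?r * (bil ?u ?u + bil ?v ?v + - 2 * t * bil ?u ?v)"
    using bil_sym[of ?v ?u] by (simp add: diff_divide_distrib add_divide_distrib algebra_simps)
  finally have form: "(\<Sum>i\<in>S <+> S. \<Sum>j\<in>S <+> S. u i * set_inverse (S <+> S) (pair_cov K t) i j * u j)
      = ?r * (bil ?u ?u + bil ?v ?v + - 2 * t * bil ?u ?v)" .
  have pos: "0 < 1 - t\<^sup>2" using t by simp
  have "(2 * pi) ^ card (S <+> S) * set_det (S <+> S) (pair_cov K t)
      = ((2 * pi) ^ card S * set_det S K)\<^sup>2 * (1 - t\<^sup>2) ^ card S"
    using finS by (simp add: det_pair_cov card_Plus power_add power2_eq_square)
  then have "sqrt ((2 * pi) ^ card (S <+> S) * set_det (S <+> S) (pair_cov K t))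
      = ((2 * pi) ^ card S * set_det S K) * sqrt ((1 - t\<^sup>2) ^ card S)"
    using det_pos by (simp add: real_sqrt_mult)
  also have "sqrt ((1 - t\<^sup>2) ^ card S) = (1 - t\<^sup>2) powr (real (card S) / 2)"
    using pos by (simp add: powr_half_sqrt[symmetric] powr_powr flip: powr_realpow)
  finally have root: "sqrt ((2 * pi) ^ card (S <+> S) * set_det (S <+> S) (pair_cov K t))
      = (2 * pi) ^ card S * set_det S K * (1 - t\<^sup>2) powr (real (card S) / 2)" .
  have "\<kappa>0\<^sup>2 = 1 / ((2 * pi) ^ card S * set_det S K)"
    using det_pos by (simp add: \<kappa>0_def power_divide)
  then have \<kappa>: "1 / sqrt ((2 * pi) ^ card (S <+> S) * set_det (S <+> S) (pair_cov K t)) = \<kappa>t t"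
    unfolding root \<kappa>t_def powr_minus by (simp only: inverse_eq_divide times_divide_times_eq mult_1)
  have "gaussian_density (S <+> S) (pair_cov K t) u
      = 1 / sqrt ((2 * pi) ^ card (S <+> S) * set_det (S <+> S) (pair_cov K t))
        * exp (- (?r * (bil ?u ?u + bil ?v ?v + - 2 * t * bil ?u ?v)) / 2)"
    unfolding gaussian_density_def form by (simp only: times_divide_eq_left mult_1)
  also have "- (?r * (bil ?u ?u + bil ?v ?v + - 2 * t * bil ?u ?v)) / 2 = ev t u Qt"
    unfolding ev_Qt by simp
  finally show "gaussian_density (S <+> S) (pair_cov K t) u = gt.G (Cst 1) t u"
    unfolding \<kappa> gt.G_def ev.simps mult_1 .
qed

end

lemma (in pair_prob_space) expectation_fst_snd:
  fixes g h :: "_ \<Rightarrow> real"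
  assumes g: "integrable M1 g" and h: "integrable M2 h"
  shows "integrable (M1 \<Otimes>\<^sub>M M2) (\<lambda>w. g (fst w) * h (snd w))"
    and "(LINT w|(M1 \<Otimes>\<^sub>M M2). g (fst w) * h (snd w)) = integral\<^sup>L M1 g * integral\<^sup>L M2 h"
proof -
  have [measurable]: "g \<in> borel_measurable M1" "h \<in> borel_measurable M2" using g h by auto
  show i: "integrable (M1 \<Otimes>\<^sub>M M2) (\<lambda>w. g (fst w) * h (snd w))"
  proof (rule Fubini_integrable)
    show "integrable M1 (\<lambda>x. LINT y|M2. norm (g (fst (x, y)) * h (snd (x, y))))"
      using g by (simp add: abs_mult)
    show "AE x in M1. integrable M2 (\<lambda>y. g (fst (x, y)) * h (snd (x, y)))"
      using h by simp
  qed simp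
  show "(LINT w|(M1 \<Otimes>\<^sub>M M2). g (fst w) * h (snd w)) = integral\<^sup>L M1 g * integral\<^sup>L M2 h"
    using integral_fst'[OF i] by simp
qed

context gchaos
begin

lemma cyl_coord: "i \<in> S \<Longrightarrow> cyl (\<lambda>u. u i)"
  by (rule cylI, erule measurable_coord)

lemma integrable_f: "i \<in> S \<Longrightarrow> integrable M (f i)"
  using rv_integrable[OF cyl_coord] integrable_moment1 by (simp add: rv_def[abs_def])

lemma expectation_f: "i \<in> S \<Longrightarrow> expectation (f i) = 0"
  using rv_integral[OF cyl_coord] first_moment by (simp add: rv_def)

lemma integrable_f_f: "i \<in> S \<Longrightarrow> j \<in> S \<Longrightarrow> integrable M (\<lambda>\<omega>. f i \<omega> * f j \<omega>)"
  using rv_integrable[OF cyl_mult[OF cyl_coord cyl_coord]] integrable_moment by (simp add: rv_def[abs_def])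

lemma expectation_f_f: "i \<in> S \<Longrightarrow> j \<in> S \<Longrightarrow> expectation (\<lambda>\<omega>. f i \<omega> * f j \<omega>) = K i j"
  using rv_integral[OF cyl_mult[OF cyl_coord cyl_coord]] second_moment by (simp add: rv_def)

text \<open>Cross terms between f and its independent copy vanish since both are centred; in the
  last block t^2 and 1 - t^2 add up to 1.\<close>

lemma covariance_interpolated_pair:
  assumes t: "t\<^sup>2 \<le> 1" and ij: "i \<in> S <+> S" "j \<in> S <+> S"
  shows "covariance_matrix (M \<Otimes>\<^sub>M M) (interpolated_pair f t) i j = pair_cov K t i j"
proof -
  interpret MM: pair_prob_space M M ..
  let ?N = "M \<Otimes>\<^sub>M M" and ?X = "interpolated_pair f t" and ?s = "sqrt (1 - t\<^sup>2)"
  note fs = MM.expectation_fst_snd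
  have i1: "integrable ?N (\<lambda>w. f x (fst w))" "integrable ?N (\<lambda>w. f x (snd w))" if "x \<in> S" for x
    using fs(1)[OF integrable_f[OF that] integrable_const[of 1]] fs(1)[OF integrable_const[of 1] integrable_f[OF that]] by simp_all
  have e1: "(LINT w|?N. f x (fst w)) = 0" "(LINT w|?N. f x (snd w)) = 0" if "x \<in> S" for x
    using fs(2)[OF integrable_f[OF that] integrable_const[of 1]] fs(2)[OF integrable_const[of 1] integrable_f[OF that]]
    by (simp_all add: that expectation_f)
  have mean: "integral\<^sup>L ?N (?X k) = 0" if "k \<in> S <+> S" for k
    using that by (elim PlusE) (simp_all add: interpolated_pair_def[abs_def] i1 e1)
  have i2: "integrable ?N (\<lambda>w. f x (fst w) * f y (fst w))" "integrable ?N (\<lambda>w. f x (snd w) * f y (snd w))"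
    "integrable ?N (\<lambda>w. f x (fst w) * f y (snd w))" "integrable ?N (\<lambda>w. f x (snd w) * f y (fst w))"
    if "x \<in> S" "y \<in> S" for x y
    using fs(1)[OF integrable_f_f[OF that] integrable_const[of 1]] fs(1)[OF integrable_const[of 1] integrable_f_f[OF that]]
      fs(1)[OF integrable_f[OF that(1)] integrable_f[OF that(2)]] fs(1)[OF integrable_f[OF that(2)] integrable_f[OF that(1)]]
    by (simp_all add: mult.commute)
  have e2: "(LINT w|?N. f x (fst w) * f y (fst w)) = K x y" "(LINT w|?N. f x (snd w) * f y (snd w)) = K x y"
    "(LINT w|?N. f x (fst w) * f y (snd w)) = 0" "(LINT w|?N. f x (snd w) * f y (fst w)) = 0"
    if "x \<in> S" "y \<in> S" for x y
    using fs(2)[OF integrable_f_f[OF that] integrable_const[of 1]] fs(2)[OF integrable_const[of 1] integrable_f_f[OF that]]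
      fs(2)[OF integrable_f[OF that(1)] integrable_f[OF that(2)]] fs(2)[OF integrable_f[OF that(2)] integrable_f[OF that(1)]]
    by (simp_all add: that expectation_f expectation_f_f prob_space mult.commute)
  have s2: "?s * ?s = 1 - t\<^sup>2" using t by simp
  have "covariance_matrix ?N ?X i j = (LINT w|?N. ?X i w * ?X j w)"
    unfolding covariance_matrix_def using ij by (simp add: mean)
  also have "\<dots> = pair_cov K t i j"
    using ij
  proof (elim PlusE)
    fix x y assume xy: "x \<in> S" "y \<in> S" and "i = Inl x" "j = Inl y"
    then show ?thesis by (simp add: interpolated_pair_def pair_cov_def e2)
  next
    fix x y assume xy: "x \<in> S" "y \<in> S" and eq: "i = Inl x" "j = Inr y"
    have "(LINT w|?N. ?X i w * ?X j w) = (LINT w|?N. t * (f x (fst w) * f y (fst w)) + ?s * (f x (fst w) * f y (snd w)))"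
      unfolding eq by (simp add: interpolated_pair_def algebra_simps)
    then show ?thesis unfolding eq by (simp add: pair_cov_def i2 e2 xy)
  next
    fix x y assume xy: "x \<in> S" "y \<in> S" and eq: "i = Inr x" "j = Inl y"
    have "(LINT w|?N. ?X i w * ?X j w) = (LINT w|?N. t * (f x (fst w) * f y (fst w)) + ?s * (f x (snd w) * f y (fst w)))"
      unfolding eq by (simp add: interpolated_pair_def algebra_simps)
    then show ?thesis unfolding eq by (simp add: pair_cov_def i2 e2 xy)
  next
    fix x y assume xy: "x \<in> S" "y \<in> S" and eq: "i = Inr x" "j = Inr y"
    have "(LINT w|?N. ?X i w * ?X j w) = (LINT w|?N. t * t * (f x (fst w) * f y (fst w)) + t * ?s * (f x (fst w) * f y (snd w))
        + (?s * t * (f x (snd w) * f y (fst w)) + ?s * ?s * (f x (snd w) * f y (snd w))))"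
      unfolding eq by (simp add: interpolated_pair_def algebra_simps)
    also have "\<dots> = t * t * K x y + ?s * ?s * K x y" by (simp add: i2 e2 xy)
    finally show ?thesis unfolding eq s2 by (simp add: pair_cov_def algebra_simps power2_eq_square)
  qed
  finally show ?thesis .
qed

lemma vec_density_pair:
  assumes "t\<^sup>2 < 1"
  shows "vec_density (M \<Otimes>\<^sub>M M) (S <+> S) (interpolated_pair f t) = gt.G (Cst 1) t"
proof -
  have "vec_density (M \<Otimes>\<^sub>M M) (S <+> S) (interpolated_pair f t) = gaussian_density (S <+> S) (pair_cov K t)"
    unfolding vec_density_def using assms by (intro gaussian_density_cong covariance_interpolated_pair) auto
  then show ?thesis using density_pair[OF assms] by simp
qed

text \<open>The conditional expectation divides by this density and the intensity multiplies by it;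
  being nonzero lets it cancel.\<close>

lemma vec_density_sub_nonzero:
  assumes t: "t\<^sup>2 < 1" and J: "J \<subseteq> S <+> S"
  shows "vec_density (M \<Otimes>\<^sub>M M) J (interpolated_pair f t) c \<noteq> 0"
proof -
  let ?C = "covariance_matrix (M \<Otimes>\<^sub>M M) (interpolated_pair f t)"
  have fin: "finite (S <+> S)" using finS by simp
  have "pos_def (S <+> S) ?C"
    using t by (intro pos_def_cong[OF covariance_interpolated_pair pos_def_pair]) auto
  then have "set_det J ?C \<noteq> 0"
    using pos_def_det[OF finite_subset[OF J fin] pos_def_subset[OF fin _ J]] by blast
  then show ?thesis by (simp add: vec_density_def gaussian_density_def)
qed

section \<open>From pivotal intensities to integrals over the pair\<close>

lemma discrete_deriv_Inr: "foldr discrete_deriv (map Inr b) \<Xi>2 E = \<Xi> (Inl -` E) * foldr discrete_deriv b \<Xi> (Inr -` E)"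
proof (induction b arbitrary: E)
  case (Cons y b)
  have "Inr -` insert (Inr y) E = insert y (Inr -` E)" "Inr -` (E - {Inr y}) = Inr -` E - {y}"
    "Inl -` insert (Inr y) E = Inl -` E" "Inl -` (E - {Inr y}) = Inl -` E"
    by auto
  with Cons show ?case by (simp add: discrete_deriv_def right_diff_distrib)
qed (simp add: \<Xi>2_def)

text \<open>Each derivative acts on one half of the index set and leaves the other factor of
  \<open>\<Xi>2\<close> constant.\<close>

lemma discrete_deriv_pair: "foldr discrete_deriv (map Inl a @ map Inr b) \<Xi>2 E
    = foldr discrete_deriv a \<Xi> (Inl -` E) * foldr discrete_deriv b \<Xi> (Inr -` E)"
proof (induction a arbitrary: E)
  case (Cons x a)
  have "Inl -` insert (Inl x) E = insert x (Inl -` E)" "Inl -` (E - {Inl x}) = Inl -` E - {x}"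
    "Inr -` insert (Inl x) E = Inr -` E" "Inr -` (E - {Inl x}) = Inr -` E"
    by auto
  with Cons show ?case by (simp add: discrete_deriv_def left_diff_distrib)
qed (simp add: discrete_deriv_Inr)

end

lemma count_list_mset_eq: "(\<And>i. count_list xs i = count_list ys i) \<Longrightarrow> mset xs = mset ys"
  by (rule multiset_eqI) (simp add: count_mset)

lemma count_list_remdups: "count_list (remdups xs) z = (if z \<in> set xs then 1 else 0)"
  by (induction xs) auto

lemma count_list_Inl_Inr:
  "count_list (map Inl x @ map Inr y) i = case_sum (count_list x) (count_list y) i"
proof -
  have "count_list (map Inr y) (Inl z) = 0" "count_list (map Inl x) (Inr w) = 0" for z w
    by (auto simp: count_list_0_iff)
  then show ?thesis by (auto split: sum.split simp: count_list_map_conv)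
qed

text \<open>One derivative per distinct point goes to the discrete derivatives; L holds the rest,
  the Hermite orders. Together they are the full lists x and y as multisets.\<close>

lemma reduced_count_list:
  assumes L: "set L \<subseteq> I" "\<forall>i\<in>I. count_list L i = case_sum (reduced_count x) (reduced_count y) i"
    and xy: "Inl ` set x \<union> Inr ` set y \<subseteq> I"
  shows "mset ((map Inl (remdups x) @ map Inr (remdups y)) @ L) = mset (map Inl x @ map Inr y)"
proof (rule count_list_mset_eq)
  fix i
  have pos: "z \<in> set w \<Longrightarrow> Suc (count_list w z - Suc 0) = count_list w z" for z and w :: "'c list"
    using count_list_0_iff[of w z] by (cases "count_list w z") auto
  have "count_list L i = case_sum (reduced_count x) (reduced_count y) i"
  proof (cases "i \<in> I")
    case False
    then have "count_list L i = 0" using L(1) by (auto simp: count_list_0_iff)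
    moreover have "case_sum (reduced_count x) (reduced_count y) i = 0"
    proof (cases i)
      case (Inl z)
      then have "z \<notin> set x" using False xy by auto
      then show ?thesis by (simp add: Inl reduced_count_def)
    next
      case (Inr z)
      then have "z \<notin> set y" using False xy by auto
      then show ?thesis by (simp add: Inr reduced_count_def)
    qed
    ultimately show ?thesis by simp
  qed (use L(2) in auto)
  then show "count_list ((map Inl (remdups x) @ map Inr (remdups y)) @ L) i = count_list (map Inl x @ map Inr y) i"
    unfolding count_list_append[of "_ @ _"] count_list_Inl_Inr
    by (auto simp: count_list_remdups reduced_count_def pos count_list_0_iff split: sum.split)
qed

text \<open>A list realising the multiset difference; it shows that the choice in
  \<open>mixed_deriv\<close> has a candidate.\<close>

lemma reduced_count_list_exists:
  fixes x :: "'i list" and y :: "'j list"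
  shows "\<exists>L. set L \<subseteq> Inl ` set x \<union> Inr ` set y \<and> (\<forall>i. count_list L i = case_sum (reduced_count x) (reduced_count y) i)"
proof -
  obtain L where L: "mset L = mset (map Inl x @ map Inr y) - mset (map Inl (remdups x) @ map Inr (remdups y))"
    using ex_mset by blast
  have "count_list L i = case_sum (reduced_count x) (reduced_count y) i" for i
  proof -
    have "count_list L i = count_list (map Inl x @ map Inr y) i - count_list (map Inl (remdups x) @ map Inr (remdups y)) i"
      unfolding count_mset[symmetric] L by (rule count_diff)
    then show ?thesis
      unfolding count_list_Inl_Inr by (auto simp: count_list_remdups reduced_count_def count_list_0_iff split: sum.split)
  qed
  moreover have "set L \<subseteq> Inl ` set x \<union> Inr ` set y"
  proof
    fix i assume "i \<in> set L"
    then have "i \<in># mset (map Inl x @ map Inr y)" using L by (metis in_diffD set_mset_mset)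
    then show "i \<in> Inl ` set x \<union> Inr ` set y" by simp
  qed
  ultimately show ?thesis by blast
qed

context gchaos
begin

text \<open>The pair density cancels the denominator of the Hermite polynomial, and the marginal
  density cancels as well. What remains is the right side of \<open>G_ibp\<close>, which is then
  read backwards.\<close>

lemma pivotal_intensity_eq:
  assumes t: "0 \<le> t" "t < 1" and x: "set x \<subseteq> S" "length x = m" and y: "set y \<subseteq> S" "length y = m"
  shows "pivotal_intensity M S f \<Xi> l t x y = P x y t"
proof -
  let ?N = "M \<Otimes>\<^sub>M M" and ?X = "interpolated_pair f t" and ?I = "S <+> S" and ?J = "set x <+> set y"
  let ?\<alpha> = "case_sum (reduced_count x) (reduced_count y)"
  define xs where "xs = map Inl (remdups x) @ map Inr (remdups y)"
  define L where "L = (SOME L. set L \<subseteq> ?I \<and> (\<forall>i\<in>?I. count_list L i = ?\<alpha> i))"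
  have t2: "t\<^sup>2 < 1" using t by (simp add: power_less_one_iff)
  have JI: "?J \<subseteq> ?I" using x y by auto
  have finI: "finite ?I" using finS by simp
  have sub: "Inl ` set x \<union> Inr ` set y \<subseteq> ?I" using JI by auto
  obtain L0 where L0: "set L0 \<subseteq> Inl ` set x \<union> Inr ` set y" "\<forall>i. count_list L0 i = ?\<alpha> i"
    using reduced_count_list_exists[of x y] by (elim exE conjE)
  have "\<exists>L. set L \<subseteq> ?I \<and> (\<forall>i\<in>?I. count_list L i = ?\<alpha> i)"
  proof (intro exI[of _ L0] conjI ballI)
    show "set L0 \<subseteq> ?I" using L0(1) sub by (rule subset_trans)
    show "count_list L0 i = ?\<alpha> i" for i using L0(2) by (rule spec)
  qed
  then have "set L \<subseteq> ?I \<and> (\<forall>i\<in>?I. count_list L i = ?\<alpha> i)"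
    unfolding L_def by (rule someI_ex)
  then have L: "set L \<subseteq> ?I" "\<forall>i\<in>?I. count_list L i = ?\<alpha> i" by (rule conjunct1, rule conjunct2)
  have ms: "mset (xs @ L) = mset (map Inl x @ map Inr y)"
    unfolding xs_def by (rule reduced_count_list[OF L sub])
  have set_xs: "set xs = ?J" by (auto simp: xs_def)
  have dist: "distinct xs" by (auto simp: xs_def distinct_map inj_on_def)
  have "length (xs @ L) = length (map Inl x @ map Inr y)" using ms by (rule mset_eq_length)
  then have len: "length xs + length L = 2 * m" using x y by simp
  have "(\<Sum>i\<in>?I. ?\<alpha> i) = (\<Sum>i\<in>?I. count_list L i)" using L(2) by (intro sum.cong) auto
  also have "\<dots> = length L" by (rule sum_count_set[OF L(1) finI])
  finally have sum_\<alpha>: "(\<Sum>i\<in>?I. ?\<alpha> i) = length L" .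
  \<comment> \<open>The two lists have total length 2m, so the sign of the Hermite polynomial equals
    the sign from integrating by parts.\<close>
  have sign: "(-1 :: real) ^ length L = (-1) ^ length xs"
    using len by (metis minus_one_power_iff even_add even_mult_iff even_numeral)
  define w where "w v = merge ?J (?I - ?J) (\<lambda>_. l, v)" for v :: "'i + 'i \<Rightarrow> real"
  \<comment> \<open>Off the index set the two differ, since \<open>merge\<close> is undefined there
    and \<open>fill\<close> is l; the integrands read coordinates inside it only.\<close>
  have w_fill: "w v i = fill (?I - ?J) l v i" if "i \<in> ?I" for v i
    using that by (simp add: w_def fill_def merge_def)
  let ?e = "foldr gt.D L (Cst 1)"
  have G_w: "gt.G ?e t (w v) = gt.G ?e t (fill (?I - ?J) l v)" for v
    by (rule gt.G_cong[OF vars_Ds1 w_fill])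
  have herm: "hermite ?N ?I ?X ?\<alpha> u = (-1) ^ length L * gt.G ?e t u / gt.G (Cst 1) t u" for u
    unfolding hermite_def mixed_deriv_def vec_density_pair[OF t2] sum_\<alpha> L_def[symmetric] gt.foldr_coord_deriv_G ..
  have G1: "gt.G (Cst 1) t u \<noteq> 0" for u
    unfolding gt.G_def using \<kappa>0_pos t2 by (simp add: \<kappa>t_def)
  have J1: "vec_density ?N ?J ?X (\<lambda>_. l) \<noteq> 0" by (rule vec_density_sub_nonzero[OF t2 JI])
  have disc: "discrete_derivs x \<Xi> (excursion_set S l (\<lambda>z. w v (Inl z))) * discrete_derivs y \<Xi> (excursion_set S l (\<lambda>z. w v (Inr z)))
      = foldr discrete_deriv xs \<Xi>2 (excursion_set ?I l (fill (?I - ?J) l v))" for v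
  proof -
    have "w v (Inl z) = fill (?I - ?J) l v (Inl z)" "w v (Inr z) = fill (?I - ?J) l v (Inr z)" if "z \<in> S" for z
      using that by (simp_all only: w_fill InlI InrI)
    then have "excursion_set S l (\<lambda>z. w v (Inl z)) = Inl -` excursion_set ?I l (fill (?I - ?J) l v)"
      "excursion_set S l (\<lambda>z. w v (Inr z)) = Inr -` excursion_set ?I l (fill (?I - ?J) l v)"
      by (auto simp: excursion_set_def)
    then show ?thesis unfolding xs_def discrete_deriv_pair discrete_derivs_def by simp
  qed
  have cancel: "a * (s * g / d) * (d / j) * j = s * (a * g)" if "d \<noteq> 0" "j \<noteq> 0" for a s g d j :: real
    using that by simp
  have "pivotal_intensity M S f \<Xi> l t x y
      = (LINT v|leb (?I - ?J). foldr discrete_deriv xs \<Xi>2 (excursion_set ?I l (fill (?I - ?J) l v))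
          * ((-1) ^ length L * gt.G ?e t (fill (?I - ?J) l v) / gt.G (Cst 1) t (w v))
          * (gt.G (Cst 1) t (w v) / vec_density ?N ?J ?X (\<lambda>_. l))) * vec_density ?N ?J ?X (\<lambda>_. l)"
    unfolding pivotal_intensity_def cond_expectation_at_def Let_def w_def[symmetric] disc herm vec_density_pair[OF t2] G_w ..
  also have "\<dots> = (LINT v|leb (?I - ?J). (-1) ^ length L * (foldr discrete_deriv xs \<Xi>2 (excursion_set ?I l (fill (?I - ?J) l v))
          * gt.G ?e t (fill (?I - ?J) l v)))"
    unfolding integral_mult_left_zero[symmetric] cancel[OF G1 J1] ..
  also have "\<dots> = (-1) ^ length xs * (LINT v|leb (?I - set xs). foldr discrete_deriv xs \<Xi>2 (excursion_set ?I l (fill (?I - set xs) l v))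
          * gt.G ?e t (fill (?I - set xs) l v))"
    unfolding sign set_xs by (rule integral_mult_right_zero)
  also have "\<dots> = (LINT u|leb ?I. \<Xi>2 (excursion_set ?I l u) * gt.G (foldr gt.D xs ?e) t u)"
    using set_xs JI by (intro gt.G_ibp[symmetric] t dist vars_Ds1) simp
  also have "\<dots> = p (xs @ L) t" unfolding p_def foldr_append ..
  also have "\<dots> = P x y t" unfolding P_def by (rule p_mset[OF ms])
  finally show ?thesis .
qed

end

theorem proposition2p16:
  fixes M :: "'a measure"
    and D :: "(int ^ 'd) set"
    and f :: "int ^ 'd \<Rightarrow> 'a \<Rightarrow> real"
    and K :: "int ^ 'd \<Rightarrow> int ^ 'd \<Rightarrow> real"
    and \<Xi> :: "(int ^ 'd) set \<Rightarrow> real"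
    and l :: real
    and m :: nat
  assumes "prob_space M"
    and "finite D"
    and "nondegenerate_gaussian M D f K"
    and "m \<ge> 1"
  shows "prob_space.variance M
           (chaos_tail M D f m (\<lambda>\<omega>. \<Xi> (excursion_set D l (\<lambda>x. f x \<omega>)))) =
         (\<Sum>x \<in> {xs. set xs \<subseteq> D \<and> length xs = m}. \<Sum>y \<in> {ys. set ys \<subseteq> D \<and> length ys = m}.
            (\<Prod>i<m. K (x ! i) (y ! i)) *
            iterated_integral m (\<lambda>t. pivotal_intensity M D f \<Xi> l t x y) 1)"
proof -
  interpret prob_space M by (rule assms(1))
  interpret gchaos D K \<Xi> l M f
  proof unfold_locales
    show "integral\<^sup>L (leb D) (gaussian_density D K) = 1"
      by (rule integral_gaussian_density[OF assms(1,3)])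
  qed (use assms in \<open>auto simp: nondegenerate_gaussian_def pos_def_def\<close>)
  have F: "(\<lambda>\<omega>. \<Xi> (excursion_set D l (\<lambda>x. f x \<omega>))) = rv F"
    by (simp add: rv_def[abs_def] F_def)
  have lists: "{xs. set xs \<subseteq> D \<and> length xs = m} = lists_of m" by (simp add: lists_of_def)
  obtain n where n: "m = Suc n" using assms(4) by (cases m) auto
  have it: "iterated_integral m (\<lambda>t. pivotal_intensity M D f \<Xi> l t x y) 1 = iterated_integral m (P x y) 1"
    if "x \<in> lists_of m" "y \<in> lists_of m" for x y
    unfolding n
  \<comment> \<open>At t = 1 the pair is degenerate and the two integrands are not compared; m \<ge>
    1 guarantees an outermost integral that ignores this point.\<close>
  proof (rule iterated_integral_cong_1)
    fix t :: real assume "0 \<le> t" "t < 1"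
    then show "pivotal_intensity M D f \<Xi> l t x y = P x y t"
      using that by (intro pivotal_intensity_eq) (auto simp: lists_of_def)
  qed
  have "(\<Sum>x\<in>lists_of m. \<Sum>y\<in>lists_of m. (\<Prod>i<m. K (x ! i) (y ! i)) * iterated_integral m (\<lambda>t. pivotal_intensity M D f \<Xi> l t x y) 1)
      = (\<Sum>x\<in>lists_of m. \<Sum>y\<in>lists_of m. (\<Prod>i<m. K (x ! i) (y ! i)) * iterated_integral m (P x y) 1)"
    by (intro sum.cong refl) (simp add: it)
  also have "\<dots> = EF2 - (\<Sum>k<m. am.a k)" by (rule sum_iterated_P[OF assms(4)])
  finally show ?thesis unfolding F lists variance_tail[OF assms(4)] by simp
qed

end
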